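(* Up to isomorphism, the only three-dimensional skew polynomial rings $A_{pqr}$ which have a faithful grading (refining the $\mathbb{N}$-grading) by a nonabelian group are $A_{-1,q,-q}$, $A_{-1,q,q}$, $A_{1,q,-q}$, and $A_{\zeta,\zeta^2,\zeta}$, where $q\in\Bbbk^\times$ and $\zeta$ is a primitive third root of unity. (Each of these does have such a grading, and any skew polynomial ring $A_{p'q'r'}$ with such a grading is isomorphic to one of these.)
   Context: $\Bbbk$ is an algebraically closed field of characteristic zero. For $p,q,r\in\Bbbk^\times$, $A_{pqr}=\Bbbk\langle x_1,x_2,x_3\rangle/(x_2x_1-px_1x_2,\ x_3x_1-qx_1x_3,\ x_3x_2-rx_2x_3)$, with generators in degree $1$. A grading $A=\bigoplus_{g\in G}A_g$ by a group $G$ ($A_gA_h\subseteq A_{gh}$) is faithful if $\{g: A_g\neq 0\}$ generates $G$, and refines the $\mathbb{N}$-grading if $A_n=\bigoplus_g (A_n\cap A_g)$ for all $n$. *)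

theory Defs
  imports
    "HOL-Library.Poly_Mapping"
    "HOL-Computational_Algebra.Polynomial"
    "HOL-Algebra.QuotRing"
    "HOL-Algebra.Module"
    "HOL-Algebra.Generated_Groups"
begin

text \<open>The free monoid on a type, written additively: \<open>Poly_Mapping\<close> multiplies by convolution along
  the operation \<open>+\<close> of the exponents (which need not be commutative).\<close>

datatype 'x word = Word (letters: "'x list")

instantiation word :: (type) monoid_add
begin

definition zero_word :: "'a word" where "0 = Word []"

definition plus_word :: "'a word \<Rightarrow> 'a word \<Rightarrow> 'a word" where
  "u + v = Word (letters u @ letters v)"

instance
  by standard (simp_all add: zero_word_def plus_word_def)

end

datatype gen = X1 | X2 | X3

text \<open>The free algebra on the generators \<open>x\<^sub>1, x\<^sub>2, x\<^sub>3\<close>.\<close>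

type_synonym 'k free_alg = "gen word \<Rightarrow>\<^sub>0 'k"

definition var :: "gen \<Rightarrow> 'k::ring_1 free_alg" where
  "var i = Poly_Mapping.single (Word [i]) 1"

definition const :: "'k \<Rightarrow> 'k::ring_1 free_alg" where
  "const c = Poly_Mapping.single 0 c"

definition univ_ring :: "'a::ring_1 ring" where
  "univ_ring = \<lparr>carrier = UNIV, mult = (*), one = 1, zero = 0, add = (+)\<rparr>"

definition skew_ideal :: "'k \<Rightarrow> 'k \<Rightarrow> 'k \<Rightarrow> 'k::field free_alg set" where
  "skew_ideal p q r = genideal univ_ring
     {var X2 * var X1 - const p * var X1 * var X2,
      var X3 * var X1 - const q * var X1 * var X3,
      var X3 * var X2 - const r * var X2 * var X3}"

text \<open>The skew polynomial ring \<open>A\<^sub>p\<^sub>q\<^sub>r\<close> as a \<open>\<k>\<close>-algebra; a scalar acts as multiplication by its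
  image under the structure map \<open>\<k> \<rightarrow> A\<^sub>p\<^sub>q\<^sub>r\<close>.\<close>

definition skew_poly_ring :: "'k \<Rightarrow> 'k \<Rightarrow> 'k \<Rightarrow> ('k::field, 'k free_alg set) module" where
  "skew_poly_ring p q r =
     (let Q = univ_ring Quot skew_ideal p q r in
      ring.extend Q (module.fields
        (\<lambda>c a. (skew_ideal p q r +>\<^bsub>univ_ring\<^esub> const c) \<otimes>\<^bsub>Q\<^esub> a)))"

definition skew_degree :: "'k \<Rightarrow> 'k \<Rightarrow> 'k \<Rightarrow> nat \<Rightarrow> 'k::field free_alg set set" where
  "skew_degree p q r n =
     (\<lambda>f. skew_ideal p q r +>\<^bsub>univ_ring\<^esub> f) `
       {f. \<forall>w\<in>Poly_Mapping.keys f. length (letters w) = n}"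

definition internal_direct_sum ::
    "('b, 'm) ring_scheme \<Rightarrow> 'i set \<Rightarrow> ('i \<Rightarrow> 'b set) \<Rightarrow> 'b set \<Rightarrow> bool" where
  "internal_direct_sum M I V W \<longleftrightarrow>
     (\<forall>i\<in>I. V i \<subseteq> W) \<and>
     (\<forall>w\<in>W. \<exists>!c. c \<in> (\<Pi>\<^sub>E i\<in>I. V i) \<and> finite {i\<in>I. c i \<noteq> \<zero>\<^bsub>M\<^esub>} \<and>
        w = (\<Oplus>\<^bsub>M\<^esub>i\<in>{i\<in>I. c i \<noteq> \<zero>\<^bsub>M\<^esub>}. c i))"

definition group_grading ::
    "('g, 'n) monoid_scheme \<Rightarrow> ('k::field, 'b, 'm) module_scheme \<Rightarrow> ('g \<Rightarrow> 'b set) \<Rightarrow> bool" where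
  "group_grading G A V \<longleftrightarrow>
     group G \<and>
     (\<forall>g\<in>carrier G. submodule (V g) (univ_ring :: 'k ring) A) \<and>
     internal_direct_sum A (carrier G) V (carrier A) \<and>
     (\<forall>g\<in>carrier G. \<forall>h\<in>carrier G. \<forall>a\<in>V g. \<forall>b\<in>V h. a \<otimes>\<^bsub>A\<^esub> b \<in> V (g \<otimes>\<^bsub>G\<^esub> h))"

definition faithful_grading ::
    "('g, 'n) monoid_scheme \<Rightarrow> ('k, 'b, 'm) module_scheme \<Rightarrow> ('g \<Rightarrow> 'b set) \<Rightarrow> bool" where
  "faithful_grading G A V \<longleftrightarrow>
     generate G {g\<in>carrier G. V g \<noteq> {\<zero>\<^bsub>A\<^esub>}} = carrier G"

definition refines_grading ::
    "('g, 'n) monoid_scheme \<Rightarrow> ('k, 'b, 'm) module_scheme \<Rightarrow> ('g \<Rightarrow> 'b set) \<Rightarrow> (nat \<Rightarrow> 'b set) \<Rightarrow> bool"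
  where
  "refines_grading G A V D \<longleftrightarrow>
     (\<forall>n. internal_direct_sum A (carrier G) (\<lambda>g. D n \<inter> V g) (D n))"

text \<open>HOL cannot quantify existentially over types, so the type of the group elements is a parameter.
  The support of a grading that refines the \<open>\<nat>\<close>-grading is countable, as every homogeneous
  component is finite-dimensional; a faithfully grading group is therefore countable, and nothing is
  lost by taking this type to be \<open>nat\<close> (the carrier may be any subset of it).\<close>

definition has_nonabelian_grading :: "'g itself \<Rightarrow> 'k \<Rightarrow> 'k \<Rightarrow> 'k::field \<Rightarrow> bool" where
  "has_nonabelian_grading T p q r \<longleftrightarrow>
     (\<exists>(G :: 'g monoid) V.
        group_grading G (skew_poly_ring p q r) V \<and>
        faithful_grading G (skew_poly_ring p q r) V \<and>
        refines_grading G (skew_poly_ring p q r) V (skew_degree p q r) \<and>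
        \<not> comm_group G)"

definition algebra_isomorphic ::
    "('k, 'b, 'm) module_scheme \<Rightarrow> ('k, 'c, 'n) module_scheme \<Rightarrow> bool"  (infix \<open>\<cong>\<^sub>a\<^sub>l\<^sub>g\<close> 50) where
  "A \<cong>\<^sub>a\<^sub>l\<^sub>g B \<longleftrightarrow>
     (\<exists>h \<in> ring_iso A B. \<forall>c. \<forall>a\<in>carrier A. h (c \<odot>\<^bsub>A\<^esub> a) = c \<odot>\<^bsub>B\<^esub> h a)"

definition primitive_root :: "nat \<Rightarrow> 'k::field \<Rightarrow> bool" where
  "primitive_root n z \<longleftrightarrow> n > 0 \<and> z ^ n = 1 \<and> (\<forall>m. 0 < m \<and> m < n \<longrightarrow> z ^ m \<noteq> 1)"

end

(*
  Let V be spanned by the generators and let R, a subspace of V (x) V, be the space of relations.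
  The intersection of R (x) V and V (x) R is a line, spanned by a quantum determinant; regard it as
  a trilinear form W on the dual of V.  If the algebra is graded by G, compatibly with the natural
  grading, then V has a homogeneous basis y_1, y_2, y_3, with degrees d_1, d_2, d_3 generating G,
  and W is homogeneous as well: on the dual basis, W(i,j,k) is nonzero only if d_i d_j d_k is a
  fixed element g_0.  The bilinear maps W(u,_,_) and W(_,u,_) have rank at least two for u nonzero,
  so if G is not abelian then the d_i are distinct and the support of W is a partial Latin square.
  Conjugation by g_0 permutes the d_i in the way the diagonal twist nu, with
  W(u,v,t) = W(nu t,u,v), permutes the dual basis up to scalars.  If the permutation is trivial,
  then either nu is scalar, which leads to the third roots of unity or to a parameter -1, or one
  generator is homogeneous and the other two span a graded plane; a transposition is treated in
  the same way; a three-cycle is incompatible with the Latin property.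
  Conversely a grading of the free algebra in a basis y descends to the quotient as soon as the
  relations are spanned by homogeneous ones.
*)
theory Submission
  imports Defs
begin

text \<open>The obstacle is that a homogeneous basis may be unrelated to the given generators, so
  its nine coordinates are unknown. They are not normalised: most of the argument uses only which of
  the 27 numbers \<open>W(i,j,k)\<close> vanish. What ties the two bases together is the twist,
  which is diagonal in the generators and monomial in the dual homogeneous basis: if nu
  \<open>e k\<close> has a component along \<open>e i\<close> and \<open>W(i,j,l)\<close> is
  nonzero, then \<open>W(j,l,k)\<close> is nonzero, so d_j d_l d_k = g_0 = d_i d_j d_l and hence d_i
  g_0 = g_0 d_k. Eigenvalues of the twist then locate the \<open>e k\<close> among the coordinate
  axes and planes, and few unknowns are left. For the converse, relations such as y_1^2 = y_2 y_3
  become equations between degrees. All systems that arise have noncommuting solutions among the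
  affine maps modulo 7: reflections and translations for the three families with signs, and maps 2x
  + b for the third roots of unity, because 2 has order 3 modulo 7. One finite group of natural
  numbers thus serves for all cases.\<close>

lemma UNIV_gen: "UNIV = {X1, X2, X3}"
  using gen.exhaust by auto

instance gen :: finite
  by standard (simp add: UNIV_gen)

lemma sum_gen: "(\<Sum>x\<in>UNIV. f x) = f X1 + f X2 + f X3" for f :: "gen \<Rightarrow> 'a::comm_monoid_add"
  by (simp add: UNIV_gen add.assoc)

lemma all_gen: "(\<forall>x. P x) \<longleftrightarrow> P X1 \<and> P X2 \<and> P X3"
  by (metis gen.exhaust)

lemma ex_gen: "(\<exists>x. P x) \<longleftrightarrow> P X1 \<or> P X2 \<or> P X3"
  by (metis gen.exhaust)

section \<open>The quantum determinant\<close>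

definition det3 :: "(gen \<Rightarrow> 'k) \<Rightarrow> (gen \<Rightarrow> 'k) \<Rightarrow> (gen \<Rightarrow> 'k) \<Rightarrow> 'k::field" where
  "det3 u v t = u X1 * (v X2 * t X3 - v X3 * t X2) - u X2 * (v X1 * t X3 - v X3 * t X1)
     + u X3 * (v X1 * t X2 - v X2 * t X1)"

text \<open>The superpotential of the skew polynomial ring, as a trilinear form on the dual of the space of
  generators.\<close>

definition qdet :: "'k \<Rightarrow> 'k \<Rightarrow> 'k \<Rightarrow> (gen \<Rightarrow> 'k) \<Rightarrow> (gen \<Rightarrow> 'k) \<Rightarrow> (gen \<Rightarrow> 'k) \<Rightarrow> 'k::field" where
  "qdet p q r u v t =
     - p * q * r * u X1 * v X2 * t X3 + p * q * u X1 * v X3 * t X2 + q * r * u X2 * v X1 * t X3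
     - r * u X2 * v X3 * t X1 - p * u X3 * v X1 * t X2 + u X3 * v X2 * t X1"

text \<open>The parameters of the listed rings and of the rings obtained from them by permuting the
  generators.\<close>

definition params :: "'k \<Rightarrow> 'k \<Rightarrow> 'k::field \<Rightarrow> bool" where
  "params p q r \<longleftrightarrow>
     p = -1 \<and> q^2 = r^2 \<or> p = 1 \<and> r = -q \<or>
     q = -1 \<and> (p * r)^2 = 1 \<or> q = 1 \<and> p * r = -1 \<or>
     r = -1 \<and> p^2 = q^2 \<or> r = 1 \<and> p = -q \<or>
     p^2 + p + 1 = 0 \<and> q = p^2 \<and> r = p"

text \<open>The product of \<open>u\<close> and \<open>v\<close> vanishes in the quadratic dual.\<close>

definition ann :: "'k \<Rightarrow> 'k \<Rightarrow> 'k \<Rightarrow> (gen \<Rightarrow> 'k) \<Rightarrow> (gen \<Rightarrow> 'k::field) \<Rightarrow> bool" where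
  "ann p q r u v \<longleftrightarrow> u X2 * v X1 = p * u X1 * v X2 \<and> u X3 * v X1 = q * u X1 * v X3 \<and>
     u X3 * v X2 = r * u X2 * v X3"

lemma det3_eq_0I:
  assumes "u X1 * v X2 = u X2 * v X1" "u X1 * v X3 = u X3 * v X1" "u X2 * v X3 = u X3 * v X2"
  shows "det3 u v t = 0"
proof -
  have "det3 u v t = t X3 * (u X1 * v X2 - u X2 * v X1) - t X2 * (u X1 * v X3 - u X3 * v X1)
     + t X1 * (u X2 * v X3 - u X3 * v X2)"
    by (simp add: det3_def algebra_simps)
  then show ?thesis using assms by simp
qed

lemma det3_rotate: "det3 u v t = det3 v t u"
  by (simp add: det3_def algebra_simps)

text \<open>A nonzero coordinate of \<open>u\<close> turns two of the three equations into formulas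
  for the other coordinates of \<open>v\<close> as fixed multiples of one of them. The solutions
  \<open>v\<close> therefore fill at most a line, which is the rank bound for
  \<open>W(u,_,_)\<close>.\<close>

lemma ann_rank_right:
  assumes nz: "p \<noteq> 0" "q \<noteq> 0" "r \<noteq> 0" and u: "u \<noteq> (\<lambda>_. 0)"
    and "ann p q r u v" "ann p q r u v'"
  shows "det3 v v' t = 0"
proof -
  consider "u X1 \<noteq> 0" | "u X2 \<noteq> 0" | "u X3 \<noteq> 0"
    using u by (metis gen.exhaust)
  then show ?thesis
  proof cases
    case 1
    have *: "w X2 = (u X2 / (p * u X1)) * w X1" "w X3 = (u X3 / (q * u X1)) * w X1" if "ann p q r u w" for w
      using that 1 nz by (simp_all add: ann_def nonzero_eq_divide_eq ac_simps)
    show ?thesis by (intro det3_eq_0I) (simp_all only: *[OF assms(5)] *[OF assms(6)] ac_simps)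
  next
    case 2
    have *: "w X1 = (p * u X1 / u X2) * w X2" "w X3 = (u X3 / (r * u X2)) * w X2" if "ann p q r u w" for w
      using that 2 nz by (simp_all add: ann_def nonzero_eq_divide_eq ac_simps)
    show ?thesis by (intro det3_eq_0I) (simp_all only: *[OF assms(5)] *[OF assms(6)] ac_simps)
  next
    case 3
    have *: "w X1 = (q * u X1 / u X3) * w X3" "w X2 = (r * u X2 / u X3) * w X3" if "ann p q r u w" for w
      using that 3 nz by (simp_all add: ann_def nonzero_eq_divide_eq ac_simps)
    show ?thesis by (intro det3_eq_0I) (simp_all only: *[OF assms(5)] *[OF assms(6)] ac_simps)
  qed
qed

text \<open>Reversing products passes to the opposite algebra, whose parameters are the inverses;
  the left rank bound thereby follows from the right one.\<close>

lemma ann_swap: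
  assumes "p \<noteq> 0" "q \<noteq> 0" "r \<noteq> 0"
  shows "ann p q r u v \<longleftrightarrow> ann (1/p) (1/q) (1/r) v u"
proof -
  have "a * b = x * c * d \<longleftrightarrow> d * c = 1/x * b * a" if "x \<noteq> 0" for a b c d x :: 'a
  proof -
    have "x * (1/x * b * a - d * c) = a * b - x * c * d"
      using that by (simp add: algebra_simps)
    then show ?thesis using that by (metis mult_eq_0_iff right_minus_eq)
  qed
  then show ?thesis using assms unfolding ann_def by blast
qed

lemma ann_rank_left:
  assumes nz: "p \<noteq> 0" "q \<noteq> 0" "r \<noteq> 0" and u: "u \<noteq> (\<lambda>_. 0)"
    and "ann p q r v u" "ann p q r v' u"
  shows "det3 v v' t = 0"
  using nz u assms(5,6) ann_swap[OF nz, of v u] ann_swap[OF nz, of v' u]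
  by (intro ann_rank_right[of "1/p" "1/q" "1/r" u v v' t]) simp_all

text \<open>The coefficients of \<open>t\<close> are nonzero multiples of the three relations
  evaluated at \<open>u\<close> and \<open>v\<close> when the parameters are nonzero. This links the
  kernel of the trilinear form to \<open>ann\<close>.\<close>

lemma qdet_ann: "qdet p q r u v t =
   (u X3 * v X2 - r * u X2 * v X3) * t X1 + (- p * (u X3 * v X1 - q * u X1 * v X3)) * t X2
   + (q * r * (u X2 * v X1 - p * u X1 * v X2)) * t X3"
  by (simp add: qdet_def algebra_simps)

text \<open>Cramer's rule: each coefficient times the determinant is a combination of the three
  pairings with 2 by 2 minors.\<close>

lemma basis_pairing_zero:
  assumes "det3 u v t \<noteq> 0"
    and "a * u X1 + b * u X2 + c * u X3 = 0" "a * v X1 + b * v X2 + c * v X3 = 0"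
      "a * t X1 + b * t X2 + c * t X3 = 0"
  shows "a = 0 \<and> b = 0 \<and> c = 0"
proof -
  have a: "a * det3 u v t = (a * u X1 + b * u X2 + c * u X3) * (v X2 * t X3 - v X3 * t X2)
     - (a * v X1 + b * v X2 + c * v X3) * (u X2 * t X3 - u X3 * t X2)
     + (a * t X1 + b * t X2 + c * t X3) * (u X2 * v X3 - u X3 * v X2)"
    by (simp add: det3_def algebra_simps)
  have b: "b * det3 u v t = - (a * u X1 + b * u X2 + c * u X3) * (v X1 * t X3 - v X3 * t X1)
     + (a * v X1 + b * v X2 + c * v X3) * (u X1 * t X3 - u X3 * t X1)
     - (a * t X1 + b * t X2 + c * t X3) * (u X1 * v X3 - u X3 * v X1)"
    by (simp add: det3_def algebra_simps)
  have c: "c * det3 u v t = (a * u X1 + b * u X2 + c * u X3) * (v X1 * t X2 - v X2 * t X1)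
     - (a * v X1 + b * v X2 + c * v X3) * (u X1 * t X2 - u X2 * t X1)
     + (a * t X1 + b * t X2 + c * t X3) * (u X1 * v X2 - u X2 * v X1)"
    by (simp add: det3_def algebra_simps)
  have "a * det3 u v t = 0" unfolding a assms(2-4) by simp
  moreover have "b * det3 u v t = 0" unfolding b assms(2-4) by simp
  moreover have "c * det3 u v t = 0" unfolding c assms(2-4) by simp
  ultimately show ?thesis using assms(1) by simp
qed

lemma ann_iff_qdet:
  assumes nz: "p \<noteq> 0" "q \<noteq> 0" "r \<noteq> 0" and d: "det3 (e X1) (e X2) (e X3) \<noteq> 0"
  shows "ann p q r u v \<longleftrightarrow> (\<forall>k. qdet p q r u v (e k) = 0)"
proof
  assume "ann p q r u v"
  then show "\<forall>k. qdet p q r u v (e k) = 0"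
    unfolding qdet_ann ann_def by (elim conjE, simp only:) simp
next
  assume "\<forall>k. qdet p q r u v (e k) = 0"
  then have "(u X3 * v X2 - r * u X2 * v X3) = 0 \<and> - p * (u X3 * v X1 - q * u X1 * v X3) = 0 \<and>
       q * r * (u X2 * v X1 - p * u X1 * v X2) = 0"
    by (intro basis_pairing_zero[OF d]) (simp_all only: qdet_ann)
  then show "ann p q r u v" using nz by (simp add: ann_def)
qed

text \<open>Subtracting the two equations for a pair of coordinates gives \<open>1 + p\<close> (or
  \<open>1 + q\<close>, \<open>1 + r\<close>) times the corresponding 2 by 2 minor. Independence of
  \<open>u\<close> and \<open>v\<close> keeps some minor nonzero, and its parameter must be
  -1.\<close>

lemma ann_symmetric_imp:
  assumes nz: "p \<noteq> 0" "q \<noteq> 0" "r \<noteq> 0" and "ann p q r u v" "ann p q r v u" "det3 u v t \<noteq> 0"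
  shows "p = -1 \<and> u X1 * v X2 \<noteq> u X2 * v X1 \<or> q = -1 \<and> u X1 * v X3 \<noteq> u X3 * v X1
      \<or> r = -1 \<and> u X2 * v X3 \<noteq> u X3 * v X2"
proof -
  have *: "a * d = b * c" if "b * c = x * a * d" "d * a = x * c * b" "x \<noteq> -1" for a b c d x :: 'a
  proof -
    have "(1 + x) * (a * d - b * c) = (d * a - x * c * b) - (b * c - x * a * d)"
      by (simp add: algebra_simps)
    also have "\<dots> = 0" by (simp only: that(1) that(2)) simp
    finally have "(1 + x) * (a * d - b * c) = 0" .
    moreover have "1 + x \<noteq> 0" using that(3) by (metis add_eq_0_iff)
    ultimately show ?thesis by simp
  qed
  show ?thesis
  proof (rule ccontr)
    assume n: "\<not> ?thesis"
    have "u X1 * v X2 = u X2 * v X1"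
    proof (cases "p = -1")
      case False
      show ?thesis by (rule *[OF _ _ False]) (use assms(4,5) in \<open>unfold ann_def, blast+\<close>)
    qed (use n in simp)
    moreover have "u X1 * v X3 = u X3 * v X1"
    proof (cases "q = -1")
      case False
      show ?thesis by (rule *[OF _ _ False]) (use assms(4,5) in \<open>unfold ann_def, blast+\<close>)
    qed (use n in simp)
    moreover have "u X2 * v X3 = u X3 * v X2"
    proof (cases "r = -1")
      case False
      show ?thesis by (rule *[OF _ _ False]) (use assms(4,5) in \<open>unfold ann_def, blast+\<close>)
    qed (use n in simp)
    ultimately have "det3 u v t = 0" by (rule det3_eq_0I)
    with assms show False by simp
  qed
qed

section \<open>Permuting the generators\<close>

definition sw12 :: "gen \<Rightarrow> gen" where "sw12 x = (case x of X1 \<Rightarrow> X2 | X2 \<Rightarrow> X1 | X3 \<Rightarrow> X3)"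
definition sw23 :: "gen \<Rightarrow> gen" where "sw23 x = (case x of X1 \<Rightarrow> X1 | X2 \<Rightarrow> X3 | X3 \<Rightarrow> X2)"

lemma sw_simps [simp]: "sw12 X1 = X2" "sw12 X2 = X1" "sw12 X3 = X3"
  "sw23 X1 = X1" "sw23 X2 = X3" "sw23 X3 = X2"
  by (simp_all add: sw12_def sw23_def)

lemma qdet_sw12: "p \<noteq> 0 \<Longrightarrow> qdet (1/p) r q (u \<circ> sw12) (v \<circ> sw12) (t \<circ> sw12) = - (1/p) * qdet p q r u v t"
  by (simp add: qdet_def algebra_simps)

lemma qdet_sw23: "r \<noteq> 0 \<Longrightarrow> qdet q p (1/r) (u \<circ> sw23) (v \<circ> sw23) (t \<circ> sw23) = - (1/r) * qdet p q r u v t"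
  by (simp add: qdet_def algebra_simps)

lemma det3_sw12: "det3 (u \<circ> sw12) (v \<circ> sw12) (t \<circ> sw12) = - det3 u v t"
  by (simp add: det3_def algebra_simps)

lemma det3_sw23: "det3 (u \<circ> sw23) (v \<circ> sw23) (t \<circ> sw23) = - det3 u v t"
  by (simp add: det3_def algebra_simps)

lemma minus_eq_one_iff: "- x = 1 \<longleftrightarrow> x = -1" for x :: "'k::field"
  by (metis minus_minus)

lemma (in group) left_cancel:
  "x \<in> carrier G \<Longrightarrow> y \<in> carrier G \<Longrightarrow> z \<in> carrier G \<Longrightarrow> x \<otimes> y = x \<otimes> z \<longleftrightarrow> y = z"
  by (simp add: Units_eq)

lemma cube_root:
  fixes p :: "'k::field"
  assumes "p^2 + p + 1 = 0" shows "p^3 = 1" "p \<noteq> 0"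
proof -
  have "p^3 - 1 = (p - 1) * (p^2 + p + 1)" by (simp add: algebra_simps power2_eq_square power3_eq_cube)
  then show "p^3 = 1" using assms by simp
  show "p \<noteq> 0" using assms by auto
qed

text \<open>The swap permutes the six families with signs and replaces the cube root
  \<open>p\<close> by \<open>1/p\<close>. With \<open>params_sw23\<close> it allows later arguments
  to treat one preferred coordinate only.\<close>

lemma params_sw12:
  fixes p q r :: "'k::field"
  assumes nz: "p \<noteq> 0" "q \<noteq> 0" "r \<noteq> 0" and "params (1/p) r q"
  shows "params p q r"
proof -
  have *: "1/p = -1 \<longleftrightarrow> p = -1" "1/p = 1 \<longleftrightarrow> p = 1"
     "(1/p)^2 = r^2 \<longleftrightarrow> (p * r)^2 = 1" "1/p = -r \<longleftrightarrow> p * r = -1"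
     "((1/p) * q)^2 = 1 \<longleftrightarrow> p^2 = q^2" "(1/p) * q = -1 \<longleftrightarrow> p = - q"
    using nz by (auto simp: field_simps power2_eq_square minus_eq_one_iff)
  \<comment> \<open>After rewriting with \<open>*\<close> the sign families agree propositionally up
    to the orientation of equations, which the listed instances settle. Only the cubic family is
    left to compute.\<close>
  from assms(4) consider
     "params p q r" | "(1/p)^2 + (1/p) + 1 = 0" "r = (1/p)^2" "q = 1/p"
    using eq_commute[of "q^2" "r^2"] minus_equation_iff[of q r] eq_commute[of "-q" r] eq_commute[of q "-r"]
      eq_commute[of "-q" p] eq_commute[of q "-p"] minus_equation_iff[of q p]
    unfolding params_def * by sat
  then show ?thesis
  proof cases
    case 2
    from cube_root[OF 2(1)] have 3: "(1/p)^3 = 1" by simp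
    have "p = (1/p)^2"
      using 3 nz by (simp add: field_simps power2_eq_square power3_eq_cube)
    moreover have "p^2 = 1/p"
      using 3 nz by (simp add: field_simps power2_eq_square power3_eq_cube)
    ultimately have "p^2 + p + 1 = 0 \<and> q = p^2 \<and> r = p"
      using 2 by (simp add: algebra_simps)
    then show ?thesis by (simp add: params_def)
  qed
qed

lemma params_sw23:
  fixes p q r :: "'k::field"
  assumes nz: "p \<noteq> 0" "q \<noteq> 0" "r \<noteq> 0" and "params q p (1/r)"
  shows "params p q r"
proof -
  have *: "1/r = -1 \<longleftrightarrow> r = -1" "1/r = 1 \<longleftrightarrow> r = 1"
     "p^2 = (1/r)^2 \<longleftrightarrow> (p * r)^2 = 1" "1/r = -p \<longleftrightarrow> p * r = -1"
     "(q * (1/r))^2 = 1 \<longleftrightarrow> q^2 = r^2" "q * (1/r) = -1 \<longleftrightarrow> q = - r"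
    using nz by (auto simp: field_simps power2_eq_square minus_eq_one_iff)
  from assms(4) consider
     "params p q r" | "q^2 + q + 1 = 0" "p = q^2" "1/r = q"
    using eq_commute[of "q^2" "p^2"] minus_equation_iff[of q p] eq_commute[of "-q" p]
      minus_equation_iff[of q r] eq_commute[of "-q" r] eq_commute[of q "-r"]
      eq_commute[of "-q" p] eq_commute[of q "-p"] minus_equation_iff[of q p]
    unfolding params_def * by sat
  then show ?thesis
  proof cases
    case 2
    from cube_root[OF 2(1)] have 3: "q^3 = 1" by simp
    have "q = p^2"
      using 3 2 by (simp add: power2_eq_square power3_eq_cube mult.assoc)
    moreover have "r = 1/q" using 2 nz by (simp add: field_simps)
    moreover have "1/q = q^2"
      using 3 nz by (simp add: field_simps power2_eq_square power3_eq_cube)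
    ultimately have "p^2 + p + 1 = 0 \<and> q = p^2 \<and> r = p"
      using 2 by (simp add: algebra_simps)
    then show ?thesis by (simp add: params_def)
  qed
qed

lemma basis_expand:
  fixes e :: "gen \<Rightarrow> gen \<Rightarrow> 'k::field"
  assumes "det3 (e X1) (e X2) (e X3) \<noteq> 0"
  obtains c where "\<And>x. t x = c X1 * e X1 x + c X2 * e X2 x + c X3 * e X3 x"
proof -
  let ?D = "det3 (e X1) (e X2) (e X3)"
  define c where "c i = (case i of X1 \<Rightarrow> det3 t (e X2) (e X3) / ?D | X2 \<Rightarrow> det3 (e X1) t (e X3) / ?D
     | X3 \<Rightarrow> det3 (e X1) (e X2) t / ?D)" for i
  have "t x * ?D = det3 t (e X2) (e X3) * e X1 x + det3 (e X1) t (e X3) * e X2 x + det3 (e X1) (e X2) t * e X3 x" for x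
    by (cases x) (simp_all add: det3_def algebra_simps)
  then have "t x = c X1 * e X1 x + c X2 * e X2 x + c X3 * e X3 x" for x
    using assms by (simp add: c_def add_divide_distrib[symmetric] nonzero_eq_divide_eq)
  then show ?thesis by (rule that)
qed

lemma qdet_sum_left:
  assumes "\<And>x. t x = a * u X1 x + b * u X2 x + c * u X3 x"
  shows "qdet p q r t v w = a * qdet p q r (u X1) v w + b * qdet p q r (u X2) v w + c * qdet p q r (u X3) v w"
  by (simp add: qdet_def assms algebra_simps)

section \<open>Homogeneous quantum determinants\<close>

text \<open>All that is kept of a grading: \<open>e\<close> is the basis dual to a homogeneous basis
  of the space of generators, and \<open>d\<close> lists the degrees of that homogeneous basis.
  Distinctness of the degrees is not assumed but derived in \<open>d_inj\<close>.\<close>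

locale graded_qdet = group G for G (structure) +
  fixes p q r :: "'k::field_char_0" and e :: "gen \<Rightarrow> gen \<Rightarrow> 'k" and d :: "gen \<Rightarrow> 'a" and g0 :: 'a
  assumes nz: "p \<noteq> 0" "q \<noteq> 0" "r \<noteq> 0"
    and basis: "det3 (e X1) (e X2) (e X3) \<noteq> 0"
    and d_closed [simp]: "d i \<in> carrier G"
    and hom: "qdet p q r (e i) (e j) (e k) \<noteq> 0 \<Longrightarrow> d i \<otimes> d j \<otimes> d k = g0"
    and noncomm: "\<exists>i j. d i \<otimes> d j \<noteq> d j \<otimes> d i"
begin

abbreviation "w i j k \<equiv> qdet p q r (e i) (e j) (e k) \<noteq> 0"

lemma permuted12: "graded_qdet G (1/p) r q (\<lambda>i. e i \<circ> sw12) d g0"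
  using nz basis hom noncomm by unfold_locales (auto simp: qdet_sw12 det3_sw12)

lemma permuted23: "graded_qdet G q p (1/r) (\<lambda>i. e i \<circ> sw23) d g0"
  using nz basis hom noncomm by unfold_locales (auto simp: qdet_sw23 det3_sw23)

lemma basis': assumes "i \<noteq> j" "i \<noteq> k" "j \<noteq> k" shows "det3 (e i) (e j) (e k) \<noteq> 0"
proof -
  have "det3 (e i) (e j) (e k) = det3 (e X1) (e X2) (e X3) \<or> det3 (e i) (e j) (e k) = - det3 (e X1) (e X2) (e X3)"
    using assms by (cases i; cases j; cases k) (simp_all add: det3_def algebra_simps)
  with basis show ?thesis by auto
qed

lemma other_index:
  fixes i j :: gen
  assumes "i \<noteq> j" obtains k where "k \<noteq> i" "k \<noteq> j" "\<And>x. x = i \<or> x = j \<or> x = k"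
proof -
  have "\<exists>k. k \<noteq> i \<and> k \<noteq> j \<and> (\<forall>x. x = i \<or> x = j \<or> x = k)"
    using assms by (cases i; cases j) (simp_all add: all_gen ex_gen)
  then show ?thesis using that by blast
qed

lemma e_nonzero: "e i \<noteq> (\<lambda>_. 0)"
proof
  assume "e i = (\<lambda>_. 0)"
  then have "det3 (e X1) (e X2) (e X3) = 0" by (cases i) (simp_all add: det3_def)
  with basis show False by simp
qed

lemma ann_iff: "ann p q r u v \<longleftrightarrow> (\<forall>k. qdet p q r u v (e k) = 0)"
  by (rule ann_iff_qdet[OF nz basis])

text \<open>A kernel of dimension at most one cannot contain two of the basis vectors.\<close>

lemma row: assumes "j \<noteq> j'" obtains l where "w i j l \<or> w i j' l"
proof -
  obtain k where k: "k \<noteq> j" "k \<noteq> j'" using other_index[OF assms] by metis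
  have "\<not> (ann p q r (e i) (e j) \<and> ann p q r (e i) (e j'))"
    using ann_rank_right[OF nz e_nonzero] basis'[of j j' k] k assms by blast
  then show ?thesis using that unfolding ann_iff by blast
qed

lemma col: assumes "j \<noteq> j'" obtains l where "w j i l \<or> w j' i l"
proof -
  obtain k where k: "k \<noteq> j" "k \<noteq> j'" using other_index[OF assms] by metis
  have "\<not> (ann p q r (e j) (e i) \<and> ann p q r (e j') (e i))"
    using ann_rank_left[OF nz e_nonzero] basis'[of j j' k] k assms by blast
  then show ?thesis using that unfolding ann_iff by blast
qed

text \<open>If two degrees agree, the rank bounds force products \<open>a c x = c a y = a a z\<close> with
  \<open>x, y, z \<in> {a, c}\<close>, and every choice makes \<open>a\<close> and \<open>c\<close> commute.\<close>

lemma d_inj: assumes "d i = d j" shows "i = j"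
proof (rule ccontr)
  assume "i \<noteq> j"
  then obtain k where k: "k \<noteq> i" "k \<noteq> j" "\<And>x. x = i \<or> x = j \<or> x = k" by (rule other_index) blast
  define a c where "a = d i" and "c = d k"
  have dx: "d x = a \<or> d x = c" for x using k(3)[of x] assms by (auto simp: a_def c_def)
  have [simp]: "a \<in> carrier G" "c \<in> carrier G" by (simp_all add: a_def c_def)
  have nc: "a \<otimes> c \<noteq> c \<otimes> a" using noncomm dx by metis
  then have ne: "a \<noteq> c" by auto
  obtain l where "w i k l \<or> w j k l" using col[OF \<open>i \<noteq> j\<close>] by metis
  then have "a \<otimes> c \<otimes> d l = g0" using hom assms a_def c_def by metis
  then obtain x where x: "a \<otimes> c \<otimes> x = g0" "x = a \<or> x = c" using dx by blast
  obtain l where "w k i l \<or> w k j l" using row[OF \<open>i \<noteq> j\<close>] by metis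
  then have "c \<otimes> a \<otimes> d l = g0" using hom assms a_def c_def by metis
  then obtain y where y: "c \<otimes> a \<otimes> y = g0" "y = a \<or> y = c" using dx by blast
  obtain l where "w i i l \<or> w i j l" using row[OF \<open>i \<noteq> j\<close>] by metis
  then have "a \<otimes> a \<otimes> d l = g0" using hom assms a_def c_def by metis
  then obtain z where z: "a \<otimes> a \<otimes> z = g0" "z = a \<or> z = c" using dx by blast
  from z(2) show False
  proof
    assume "z = a"
    then have "c \<otimes> x = a \<otimes> a" "a \<otimes> c \<otimes> x = a \<otimes> a \<otimes> a" "c \<otimes> a \<otimes> y = a \<otimes> a \<otimes> a"
      using x y z(1) left_cancel[of a "c \<otimes> x" "a \<otimes> a"] by (auto simp: m_assoc)
    note eqs = this
    from x(2) show False
    proof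
      assume "x = a"
      then show False using eqs(1) ne by simp
    next
      assume xc: "x = c"
      from y(2) show False
      proof
        assume "y = a"
        then show False using eqs(3) ne by simp
      next
        assume "y = c"
        then have "(a \<otimes> c) \<otimes> c = (c \<otimes> a) \<otimes> c" using eqs(2,3) xc by metis
        then show False using nc by simp
      qed
    qed
  next
    assume "z = c"
    then have "c \<otimes> x = a \<otimes> c"
      using x z(1) left_cancel[of a "c \<otimes> x" "a \<otimes> c"] by (auto simp: m_assoc)
    then show False using x(2) nc ne by auto
  qed
qed

text \<open>In a group, two factors of a triple product with value \<open>g0\<close> fix the third,
  and \<open>d_inj\<close> turns equal degrees into equal indices.\<close>

lemma latin1: assumes "w i j k" "w i j l" shows "k = l"
proof -
  have "(d i \<otimes> d j) \<otimes> d k = (d i \<otimes> d j) \<otimes> d l" using hom[OF assms(1)] hom[OF assms(2)] by simp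
  then show ?thesis by (intro d_inj) (simp add: left_cancel)
qed

lemma latin2: assumes "w i j k" "w i l k" shows "j = l"
proof -
  have "(d i \<otimes> d j) \<otimes> d k = (d i \<otimes> d l) \<otimes> d k" using hom[OF assms(1)] hom[OF assms(2)] by simp
  then show ?thesis by (intro d_inj) (simp add: left_cancel)
qed

lemma latin3: assumes "w i j k" "w l j k" shows "i = l"
proof -
  have "(d i \<otimes> d j) \<otimes> d k = (d l \<otimes> d j) \<otimes> d k" using hom[OF assms(1)] hom[OF assms(2)] by simp
  then show ?thesis by (intro d_inj) simp
qed

lemma comm_left: assumes "w i j k" "w j i k" shows "d i \<otimes> d j = d j \<otimes> d i"
proof -
  have "(d i \<otimes> d j) \<otimes> d k = (d j \<otimes> d i) \<otimes> d k" using hom[OF assms(1)] hom[OF assms(2)] by simp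
  then show ?thesis by simp
qed

lemma comm_right: assumes "w k i j" "w k j i" shows "d i \<otimes> d j = d j \<otimes> d i"
proof -
  have "d k \<otimes> (d i \<otimes> d j) = d k \<otimes> (d j \<otimes> d i)"
    using hom[OF assms(1)] hom[OF assms(2)] by (simp add: m_assoc)
  then show ?thesis by (simp add: left_cancel)
qed

end

text \<open>The difference of the two equations is \<open>(x + y) * (s - t) = 0\<close>. It is
  applied with \<open>s\<close> and \<open>t\<close> the two terms of a nonzero 2 by 2
  determinant.\<close>

lemma cross_scaled_eq:
  fixes x y s t :: "'b::field"
  assumes "x * s = y * t" "x * t = y * s" "s \<noteq> t"
  shows "y = - x"
proof -
  have "(x + y) * (s - t) = (x * s - y * t) - (x * t - y * s)" by (simp add: algebra_simps)
  also have "\<dots> = 0" unfolding assms(1,2) by simp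
  finally show ?thesis using assms(3) by (simp add: add_eq_0_iff)
qed

text \<open>The Nakayama automorphism, which moves the last argument of the superpotential to the front.\<close>

definition twist :: "'k \<Rightarrow> 'k \<Rightarrow> 'k \<Rightarrow> gen \<Rightarrow> 'k::field" where
  "twist p q r x = (case x of X1 \<Rightarrow> 1 / (p * q) | X2 \<Rightarrow> p / r | X3 \<Rightarrow> q * r)"

lemma twist_simps [simp]: "twist p q r X1 = 1 / (p * q)" "twist p q r X2 = p / r" "twist p q r X3 = q * r"
  by (simp_all add: twist_def)

section \<open>The twist, and gradings with a homogeneous generator and a graded plane\<close>

context graded_qdet begin

abbreviation "nu \<equiv> twist p q r"

lemma nu_nz [simp]: "nu x \<noteq> 0"
  using nz by (cases x) simp_all

lemma qdet_cyc: "qdet p q r u v t = qdet p q r (\<lambda>x. nu x * t x) u v"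
  using nz by (simp add: qdet_def field_simps)

text \<open>Expand nu \<open>e k\<close> in the basis and let \<open>c i\<close> be a nonzero
  coefficient. Some \<open>W(i,j,l)\<close> is nonzero, and by \<open>latin3\<close> only the
  \<open>i\<close>-th term contributes to \<open>W(nu e_k, e_j, e_l)\<close>, which is
  \<open>W(j,l,k)\<close>. Hence d_j d_l d_k = g0 = d_i d_j d_l, so d_i g0 = g0 d_k. This equation
  determines \<open>i\<close>, so there is only one nonzero coefficient.\<close>

lemma nu_e: "\<exists>c i. c \<noteq> 0 \<and> (\<forall>x. nu x * e k x = c * e i x) \<and> d i \<otimes> g0 = g0 \<otimes> d k"
proof -
  obtain c where c: "\<And>x. nu x * e k x = c X1 * e X1 x + c X2 * e X2 x + c X3 * e X3 x"
    using basis_expand[OF basis, of "\<lambda>x. nu x * e k x"] by metis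
  have *: "d i \<otimes> g0 = g0 \<otimes> d k" if "c i \<noteq> 0" for i
  proof -
    obtain j l where w: "w i j l" using row[of X1 X2 i] by blast
    have z: "qdet p q r (e i') (e j) (e l) = 0" if "i' \<noteq> i" for i'
      using latin3[OF w, of i'] that by blast
    have "qdet p q r (e j) (e l) (e k) = qdet p q r (\<lambda>x. nu x * e k x) (e j) (e l)"
      by (rule qdet_cyc)
    also have "\<dots> = c X1 * qdet p q r (e X1) (e j) (e l) + c X2 * qdet p q r (e X2) (e j) (e l)
       + c X3 * qdet p q r (e X3) (e j) (e l)"
      by (rule qdet_sum_left) (rule c)
    also have "\<dots> = c i * qdet p q r (e i) (e j) (e l)"
      by (cases i) (simp_all add: z)
    also have "\<dots> \<noteq> 0" using w that by simp
    finally have "d j \<otimes> d l \<otimes> d k = g0" by (rule hom)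
    moreover have "d i \<otimes> d j \<otimes> d l = g0" using w by (rule hom)
    ultimately show ?thesis by (metis d_closed m_assoc m_closed)
  qed
  have uniq: "i = i'" if "c i \<noteq> 0" "c i' \<noteq> 0" for i i'
  proof -
    have "g0 \<in> carrier G" using hom row[of X1 X2 X1] by (metis d_closed gen.distinct(1) m_closed)
    then show ?thesis using *[OF that(1)] *[OF that(2)] by (metis d_inj d_closed right_cancel)
  qed
  have "\<exists>i. c i \<noteq> 0"
  proof (rule ccontr)
    assume "\<nexists>i. c i \<noteq> 0"
    then have "nu x * e k x = 0" for x using c[of x] by simp
    then show False using e_nonzero[of k] by (simp add: fun_eq_iff)
  qed
  then obtain i where i: "c i \<noteq> 0" by blast
  have "c i' = 0" if "i' \<noteq> i" for i' using uniq[OF i, of i'] that by blast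
  then have "nu x * e k x = c i * e i x" for x
    using c[of x] by (cases i) simp_all
  then show ?thesis using i *[OF i] by blast
qed

text \<open>Only the 2 by 2 matrix of the first two coordinates of \<open>e i\<close> and
  \<open>e j\<close> is unknown. A nonzero entry with a repeated index empties neighbouring entries
  by the Latin property; their vanishing is a pair of equations that forces a sign relation between
  parameters.\<close>

lemma third_coordinate:
  assumes ijk: "i \<noteq> j" "k \<noteq> i" "k \<noteq> j" "\<And>x. x = i \<or> x = j \<or> x = k"
    and z: "e k X1 = 0" "e k X2 = 0" "e i X3 = 0" "e j X3 = 0"
  shows "params p q r"
proof -
  define a b a' b' c where abc: "a = e i X1" "b = e i X2" "a' = e j X1" "b' = e j X2" "c = e k X3"
  have "det3 (e i) (e j) (e k) \<noteq> 0" using basis' ijk by metis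
  then have c: "c \<noteq> 0" and D: "a * b' - b * a' \<noteq> 0"
    by (auto simp: det3_def z abc)
  note [simp] = qdet_def z abc[symmetric]
  have W: "qdet p q r (e i) (e i) (e k) = q * r * c * (1 - p) * a * b"
    "qdet p q r (e j) (e j) (e k) = q * r * c * (1 - p) * a' * b'"
    "qdet p q r (e i) (e j) (e k) = q * r * c * (b * a' - p * a * b')"
    "qdet p q r (e j) (e i) (e k) = q * r * c * (a * b' - p * b * a')"
    "qdet p q r (e i) (e k) (e i) = c * (p * q - r) * a * b"
    "qdet p q r (e j) (e k) (e j) = c * (p * q - r) * a' * b'"
    "qdet p q r (e i) (e k) (e j) = c * (p * q * a * b' - r * b * a')"
    "qdet p q r (e j) (e k) (e i) = c * (p * q * b * a' - r * a * b')"
    "qdet p q r (e k) (e i) (e j) = c * (b * a' - p * a * b')"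
    "qdet p q r (e k) (e j) (e i) = c * (a * b' - p * b * a')"
    by (simp_all add: algebra_simps)
  have noncomm': "\<not> (d i \<otimes> d j = d j \<otimes> d i \<and> d i \<otimes> d k = d k \<otimes> d i \<and> d j \<otimes> d k = d k \<otimes> d j)"
  proof
    assume *: "d i \<otimes> d j = d j \<otimes> d i \<and> d i \<otimes> d k = d k \<otimes> d i \<and> d j \<otimes> d k = d k \<otimes> d j"
    have "d x \<otimes> d y = d y \<otimes> d x" for x y
      using ijk(4)[of x] ijk(4)[of y] * by (elim disjE) simp_all
    then show False using noncomm by blast
  qed
  have allperm: False if "w i j k" "w j i k" "w i k j" "w k i j" "w j k i" "w k j i"
    using noncomm' comm_left[OF that(1,2)] comm_left[OF that(3,4)] comm_left[OF that(5,6)] by blast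
  note nz' = nz c
  \<comment> \<open>If both products vanish, \<open>e i\<close> and \<open>e j\<close> lie on
    coordinate axes, so all six permutations of \<open>i j k\<close> are in the support and all
    degrees commute.\<close>
  have ab: "a * b \<noteq> 0 \<or> a' * b' \<noteq> 0"
  proof (rule ccontr)
    assume "\<not> ?thesis"
    then have "a = 0 \<and> b' = 0 \<and> b \<noteq> 0 \<and> a' \<noteq> 0 \<or> b = 0 \<and> a' = 0 \<and> a \<noteq> 0 \<and> b' \<noteq> 0"
      using D by auto
    then show False
      by (intro allperm) (unfold W, use nz' in auto)
  qed
  show ?thesis
  proof (cases "p = 1")
    case True
    show ?thesis
    proof (cases "q = r")
      case qr: True
      have "False"
        by (intro allperm; unfold W; use D nz' True qr in \<open>auto simp: algebra_simps\<close>)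
      then show ?thesis ..
    next
      case False
      \<comment> \<open>Either triple excludes both \<open>i k j\<close> and \<open>j k i\<close> by
        the Latin property.\<close>
      have "w i k i \<or> w j k j" unfolding W using ab nz' True False by auto
      then have "\<not> w i k j" "\<not> w j k i"
        using latin1[of i k i j] latin1[of j k j i] latin3[of i k i j] latin3[of j k j i] ijk(1) by blast+
      then have 1: "q * (a * b') = r * (b * a')" "q * (b * a') = r * (a * b')"
        unfolding W using nz' True by (auto simp: algebra_simps)
      have "r = - q" by (rule cross_scaled_eq[OF 1]) (use D in auto)
      then show ?thesis using True by (simp add: params_def)
    qed
  next
    case False
    have "w i i k \<or> w j j k" unfolding W using ab nz' False by auto
    then have "\<not> w i j k" "\<not> w j i k"
      using latin2[of i i k j] latin2[of j j k i] latin3[of i i k j] latin3[of j j k i] ijk(1) by blast+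
    then have 1: "b * a' = p * (a * b')" "a * b' = p * (b * a')"
      unfolding W using nz' by (auto simp: algebra_simps)
    have p: "p = -1" by (rule cross_scaled_eq[of 1 "b * a'" p "a * b'"]) (use 1 D in auto)
    have ba: "b * a' = - (a * b')" using 1(1) unfolding p by simp
    then have "a \<noteq> 0" "b' \<noteq> 0" "b \<noteq> 0" "a' \<noteq> 0" using D by auto
    \<comment> \<open>For \<open>p = -1\<close> the values at \<open>i k i\<close> and
      \<open>i k j\<close> are nonzero multiples of \<open>q + r\<close> and of
      \<open>r - q\<close>, so one of these two factors is zero.\<close>
    have "\<not> (w i k i \<and> w i k j)" using latin1[of i k i j] ijk(1) by blast
    moreover have "c * (p * q * a * b' - r * b * a') = c * (r - q) * (a * b')"
    proof -
      have "c * (p * q * a * b' - r * b * a') = c * (p * q * (a * b') - r * (b * a'))"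
        by (simp add: algebra_simps)
      then show ?thesis unfolding ba p by (simp add: algebra_simps)
    qed
    ultimately have "q + r = 0 \<or> r = q"
      unfolding W using p nz' \<open>a \<noteq> 0\<close> \<open>b \<noteq> 0\<close> \<open>b' \<noteq> 0\<close>
      by (auto simp: eq_neg_iff_add_eq_0 add.commute)
    then have "q^2 = r^2"
      by (auto simp: power2_eq_iff add_eq_0_iff)
    then show ?thesis using p by (simp add: params_def)
  qed
qed

end

text \<open>The values at \<open>a a b\<close> are \<open>1 - p\<close> times \<open>S a b\<close>,
  the derivative of the cubic \<open>x1 * x2 * x3\<close> at \<open>a\<close> in direction
  \<open>b\<close>. Their zeros say that the coordinatewise ratios of \<open>v\<close> to
  \<open>u\<close> have vanishing first and second elementary symmetric functions, hence are
  proportional to 1, \<rho>, \<rho>^2 with \<rho>^2 + \<rho> + 1 = 0. The same holds for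
  \<open>t\<close>, with the other root by independence. The zero at \<open>v u t\<close> then
  identifies \<rho> with \<open>p\<close>.\<close>

lemma zeta_numeric:
  fixes p :: "'k::field_char_0"
  assumes p: "p \<noteq> 0"
    and nz: "qdet p (1/p) p u u u \<noteq> 0" "qdet p (1/p) p v v v \<noteq> 0" "qdet p (1/p) p t t t \<noteq> 0"
    and z: "qdet p (1/p) p u u v = 0" "qdet p (1/p) p u u t = 0"
      "qdet p (1/p) p v v u = 0" "qdet p (1/p) p t t u = 0" "qdet p (1/p) p v u t = 0"
    and indep: "det3 u v t \<noteq> 0"
  shows "p^2 + p + 1 = 0"
proof -
  define S where "S a b = a X2 * a X3 * b X1 + a X1 * a X3 * b X2 + a X1 * a X2 * b X3" for a b :: "gen \<Rightarrow> 'k"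
  have S: "qdet p (1/p) p a a b = (1 - p) * S a b" for a b
    using p by (simp add: qdet_def S_def algebra_simps)
  have p1: "p \<noteq> 1" using nz(1) by (auto simp: S)
  then have Sz: "S u v = 0" "S u t = 0" "S v u = 0" "S t u = 0"
    using z by (simp_all add: S)
  have SS: "S a a = 3 * (a X1 * a X2 * a X3)" for a by (simp add: S_def)
  have unz: "u x \<noteq> 0" for x using nz(1) by (cases x) (auto simp: S SS)
  have vnz: "v x \<noteq> 0" for x using nz(2) by (cases x) (auto simp: S SS)
  have tnz: "t x \<noteq> 0" for x using nz(3) by (cases x) (auto simp: S SS)
  have ratio: "\<exists>c \<rho>. c \<noteq> 0 \<and> \<rho>^2 + \<rho> + 1 = 0 \<and> a X1 = c * u X1 \<and> a X2 = c * \<rho> * u X2 \<and> a X3 = c * (- 1 - \<rho>) * u X3"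
    if "S u a = 0" "S a u = 0" "\<And>x. a x \<noteq> 0" for a
  proof -
    define c where "c = a X1 / u X1"
    define \<rho> where "\<rho> = (a X2 / u X2) / c"
    have c: "c \<noteq> 0" using that(3) unz by (simp add: c_def)
    have a1: "a X1 = c * u X1" using unz by (simp add: c_def)
    have a2: "a X2 = c * \<rho> * u X2" using unz c by (simp add: \<rho>_def)
    have "u X1 * u X2 * (a X3 - c * (- 1 - \<rho>) * u X3) = S u a"
      by (simp add: S_def a1 a2 algebra_simps)
    then have a3: "a X3 = c * (- 1 - \<rho>) * u X3" using that(1) unz by simp
    have "- (c^2 * u X1 * u X2 * u X3 * (\<rho>^2 + \<rho> + 1)) = S a u"
      by (simp add: S_def a1 a2 a3 algebra_simps power2_eq_square)
    then have "\<rho>^2 + \<rho> + 1 = 0" using that(2) unz c by simp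
    then show ?thesis using c a1 a2 a3 by blast
  qed
  obtain c \<rho> where c: "c \<noteq> 0" and \<rho>: "\<rho>^2 + \<rho> + 1 = 0" and v: "v X1 = c * u X1" "v X2 = c * \<rho> * u X2" "v X3 = c * (- 1 - \<rho>) * u X3"
    using ratio[OF Sz(1,3) vnz] by blast
  obtain b \<sigma> where b: "b \<noteq> 0" and \<sigma>: "\<sigma>^2 + \<sigma> + 1 = 0" and t: "t X1 = b * u X1" "t X2 = b * \<sigma> * u X2" "t X3 = b * (- 1 - \<sigma>) * u X3"
    using ratio[OF Sz(2,4) tnz] by blast
  have "\<sigma> \<noteq> \<rho>"
  proof
    assume "\<sigma> = \<rho>"
    then have "det3 u v t = 0" by (simp add: det3_def v t algebra_simps)
    with indep show False by simp
  qed
  moreover have "(\<sigma> - \<rho>) * (\<sigma> + \<rho> + 1) = (\<sigma>^2 + \<sigma> + 1) - (\<rho>^2 + \<rho> + 1)"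
    by (simp add: algebra_simps power2_eq_square)
  ultimately have "\<sigma> + \<rho> + 1 = 0" using \<rho> \<sigma> by simp
  then have \<sigma>': "\<sigma> = - 1 - \<rho>" by (simp add: eq_diff_eq add_eq_0_iff algebra_simps)
  have "qdet p (1/p) p v u t = c * b * u X1 * u X2 * u X3 * (- p * (\<rho>^2 + 4 * \<rho> + 1) + (\<rho>^2 - 2 * \<rho> - 2))"
    using p by (simp add: qdet_def v t \<sigma>' algebra_simps power2_eq_square)
  \<comment> \<open>Division with remainder by the polynomial of \<rho>; the factor 3 is invertible
    in characteristic zero.\<close>
  also have "- p * (\<rho>^2 + 4 * \<rho> + 1) + (\<rho>^2 - 2 * \<rho> - 2) = 3 * \<rho> * (\<rho> - p) + (- p - 2) * (\<rho>^2 + \<rho> + 1)"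
    by (simp add: algebra_simps power2_eq_square)
  finally have "\<rho> * (\<rho> - p) = 0" using z(5) c b unz \<rho> by simp
  moreover have "\<rho> \<noteq> 0" using \<rho> by auto
  ultimately show ?thesis using \<rho> by simp
qed

context graded_qdet begin

lemma second_coordinate:
  assumes ijk: "i \<noteq> j" "k \<noteq> i" "k \<noteq> j" "\<And>x. x = i \<or> x = j \<or> x = k"
    and z: "e k X1 = 0" "e k X3 = 0" "e i X2 = 0" "e j X2 = 0"
  shows "params p q r"
proof -
  have "params q p (1/r)"
    by (rule graded_qdet.third_coordinate[OF permuted23 ijk]) (simp_all add: z)
  then show ?thesis by (rule params_sw23[OF nz])
qed

lemma first_coordinate:
  assumes ijk: "i \<noteq> j" "k \<noteq> i" "k \<noteq> j" "\<And>x. x = i \<or> x = j \<or> x = k"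
    and z: "e k X2 = 0" "e k X3 = 0" "e i X1 = 0" "e j X1 = 0"
  shows "params p q r"
proof -
  have "params (1/p) r q"
    by (rule graded_qdet.second_coordinate[OF permuted12 ijk]) (simp_all add: z)
  then show ?thesis by (rule params_sw12[OF nz])
qed

lemma axis:
  assumes ijk: "i \<noteq> j" "k \<noteq> i" "k \<noteq> j" "\<And>x. x = i \<or> x = j \<or> x = k"
    and "\<And>x. x \<noteq> a \<Longrightarrow> e k x = 0" "e i a = 0" "e j a = 0"
  shows "params p q r"
  using first_coordinate[OF ijk] second_coordinate[OF ijk] third_coordinate[OF ijk] assms(5-)
  by (cases a) simp_all

text \<open>One parameter is -1 by \<open>ann_symmetric_imp\<close>, and the equalities in
  \<open>sc\<close>, cleared of denominators, then relate the other two.\<close>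

lemma scalar_twist_ann:
  assumes sc: "nu X1 = nu X2" "nu X2 = nu X3" and "i \<noteq> j"
    and "ann p q r (e i) (e j)" "ann p q r (e j) (e i)"
  shows "params p q r"
proof -
  obtain k where "k \<noteq> i" "k \<noteq> j" using other_index[OF \<open>i \<noteq> j\<close>] by metis
  then have D: "det3 (e i) (e j) (e k) \<noteq> 0" using basis' \<open>i \<noteq> j\<close> by metis
  have 1: "r = p^2 * q" using sc nz by (simp add: field_simps power2_eq_square)
  have 2: "p * q^2 * r = 1" using sc nz by (simp add: field_simps power2_eq_square)
  consider "p = -1" | "q = -1" | "r = -1" using ann_symmetric_imp[OF nz assms(4,5) D] by blast
  then show ?thesis
  proof cases
    case 1
    then show ?thesis using \<open>r = p^2 * q\<close> by (simp add: params_def)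
  next
    case 2
    then show ?thesis using \<open>p * q^2 * r = 1\<close> by (simp add: params_def)
  next
    case 3
    have "p = q * r * r" using sc(2) nz by (simp add: field_simps)
    then have "p = q" using 3 by simp
    then show ?thesis using 3 by (simp add: params_def)
  qed
qed

text \<open>A scalar twist makes the support invariant under cyclic rotation. For noncommuting
  \<open>d i\<close> and \<open>d j\<close> this excludes \<open>i i j\<close> and
  \<open>j j i\<close>, and \<open>i j k\<close> and \<open>j i k\<close> cannot both occur. If
  exactly one occurs, the third roots of unity appear; if neither does, \<open>e i\<close> and
  \<open>e j\<close> annihilate each other in both orders.\<close>

lemma scalar_twist:
  assumes sc: "nu X1 = nu X2" "nu X2 = nu X3"
  shows "params p q r"
proof -
  define l where "l = nu X1"
  have nu: "nu x = l" for x using sc by (cases x) (simp_all add: l_def)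
  have l: "l \<noteq> 0" using nu nu_nz by metis
  have cyc: "qdet p q r (e i) (e j) (e k) = l * qdet p q r (e k) (e i) (e j)" for i j k
    by (subst qdet_cyc) (simp add: nu, simp add: qdet_def algebra_simps)
  have rot: "w i j k \<longleftrightarrow> w k i j" for i j k using cyc[of i j k] l by simp
  \<comment> \<open>For each rotation \<open>a b c\<close> of the triple, rotation and the Latin
    property leave no entry \<open>a c x\<close>, so the rank bound forces the cube
    \<open>a a a\<close> into the support. Rotation fixes a cube, whence the scalar \<open>l\<close>
    is 1.\<close>
  have zeta: "params p q r" if w: "w i j k" and n: "\<not> w j i k" and ijk: "i \<noteq> j" "i \<noteq> k" "j \<noteq> k" for i j k
  proof -
    have *: "w a a a \<and> \<not> w a a b \<and> \<not> w a a c"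
      if "w a b c" "\<not> w b a c" "a \<noteq> b" "a \<noteq> c" "b \<noteq> c" "\<And>x. x = a \<or> x = b \<or> x = c" for a b c
    proof -
      have w': "w c a b" "w b c a" using that(1) rot by blast+
      have aab: "\<not> w a a b"
        using that(1,4) rot[of a a b] rot[of b a a] latin1[of a b c a] by blast
      have aac: "\<not> w a a c"
        using w'(1) that(3) rot[of a a c] latin1[of c a b a] by blast
      have "\<not> w a c x" for x
        using that(6)[of x] that(2,5) aac w'(1) rot[of a c a] rot[of a c b] rot[of a c c] latin1[of c a b c]
        by (elim disjE) blast+
      then obtain x where x: "w a a x" using row[of a c a] \<open>a \<noteq> c\<close> by blast
      then show ?thesis using aab aac that(6)[of x] by (elim disjE) blast+
    qed
    have ex: "x = i \<or> x = j \<or> x = k" for x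
      using ijk by (cases i; cases j; cases k; cases x) simp_all
    have w2: "w j k i" "w k i j" "\<not> w k j i" "\<not> w i k j" using w n rot by blast+
    have a: "w i i i" "\<not> w i i j" "\<not> w i i k" using *[OF w n ijk ex] by blast+
    have b: "w j j j" "\<not> w j j k" "\<not> w j j i" using *[OF w2(1,3)] ijk ex by metis+
    have c: "w k k k" "\<not> w k k i" "\<not> w k k j" using *[OF w2(2,4)] ijk ex by metis+
    have l1: "l = 1" using a(1) cyc[of i i i] by simp
    have q: "q = 1/p" using nu[of X1] nz by (simp add: l1 field_simps)
    have r: "r = p" using nu[of X2] nz by (simp add: l1 field_simps)
    have D: "det3 (e i) (e j) (e k) \<noteq> 0" using basis' ijk by blast
    have 0: "p^2 + p + 1 = 0"
      using zeta_numeric[of p "e i" "e j" "e k"] nz a b c n D unfolding q r by blast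
    have "p * p^2 = 1" using cube_root(1)[OF 0] by (simp add: power2_eq_square power3_eq_cube mult.assoc)
    then have "1/p = p^2" using nz by (simp add: field_simps)
    then show ?thesis using 0 q r by (simp add: params_def)
  qed
  obtain i j where ij: "d i \<otimes> d j \<noteq> d j \<otimes> d i" using noncomm by blast
  then have "i \<noteq> j" by auto
  then obtain k where k: "k \<noteq> i" "k \<noteq> j" "\<And>x. x = i \<or> x = j \<or> x = k" by (rule other_index) blast
  have n: "\<not> w i i j" "\<not> w j j i"
    using comm_right[of i i j] comm_right[of j j i] rot[of i j i] rot[of j i j] ij by metis+
  have "\<not> (w i j k \<and> w j i k)" using comm_left[of i j k] ij by blast
  then consider "w i j k" "\<not> w j i k" | "w j i k" "\<not> w i j k" | "\<not> w i j k" "\<not> w j i k" by blast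
  then show ?thesis
  proof cases
    case 1 then show ?thesis using zeta[OF 1] \<open>i \<noteq> j\<close> k(1,2) by blast
  next
    case 2 then show ?thesis using zeta[OF 2] \<open>i \<noteq> j\<close> k(1,2) by blast
  next
    case 3
    have "\<not> w i j x" for x
      using k(3)[of x] 3 n rot[of i j i] rot[of i j j] rot[of j i j] by (elim disjE) blast+
    moreover have "\<not> w j i x" for x
      using k(3)[of x] 3 n rot[of j i j] rot[of j i i] rot[of i j i] by (elim disjE) blast+
    ultimately have "ann p q r (e i) (e j)" "ann p q r (e j) (e i)" unfolding ann_iff by blast+
    then show ?thesis using scalar_twist_ann[OF sc \<open>i \<noteq> j\<close>] by blast
  qed
qed

end

section \<open>Case distinction on the permutation induced by the twist\<close>

context graded_qdet begin

text \<open>The effect of \<open>qdet_cyc\<close> on the support: an index that moves from the last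
  place to the front is relabelled by \<open>s\<close>.\<close>

lemma rotate_index:
  assumes s: "\<And>k. c k \<noteq> 0" "\<And>k x. nu x * e k x = c k * e (s k) x"
  shows "w x y z \<longleftrightarrow> w (s z) x y"
proof -
  have "qdet p q r (e x) (e y) (e z) = c z * qdet p q r (e (s z)) (e x) (e y)"
    by (subst qdet_cyc) (simp add: s(2), simp add: qdet_def algebra_simps)
  then show ?thesis using s(1) by simp
qed

text \<open>Here \<open>e j\<close> is proportional to the reflection of \<open>e i\<close> in the plane where the first coordinate
  vanishes, and \<open>e k\<close> lies in that plane.\<close>

lemma reflection_first:
  assumes s: "\<And>k. c k \<noteq> 0" "\<And>k x. nu x * e k x = c k * e (s k) x"
    and ijk: "i \<noteq> j" "k \<noteq> i" "k \<noteq> j" "\<And>x. x = i \<or> x = j \<or> x = k"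
    and s': "s i = j" "s j = i" "s k = k"
    and nu: "nu X1 = - nu X2" "nu X2 = nu X3"
  shows "params p q r"
proof -
  note twist_simps [simp del]
  define m where "m = nu X2"
  have m: "nu X1 = - m" "nu X2 = m" "nu X3 = m" "m \<noteq> 0"
    using nu nu_nz[of X2] unfolding m_def by (simp_all only: simp_thms)
  define t where "t = m / c i"
  have t: "t \<noteq> 0" using m s(1) by (simp add: t_def)
  define u1 u2 u3 where u: "u1 = e i X1" "u2 = e i X2" "u3 = e i X3"
  have v: "e j X1 = - t * u1" "e j X2 = t * u2" "e j X3 = t * u3"
    using s(1)[of i] s(2)[of X1 i] s(2)[of X2 i] s(2)[of X3 i]
    unfolding s' m u t_def by (auto simp: field_simps)
  have D: "det3 (e i) (e j) (e k) \<noteq> 0" using basis' ijk by metis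
  \<comment> \<open>Otherwise \<open>e k\<close> belongs to the eigenvalue \<open>-m\<close>, so it
    lies on the first axis. The determinant then reduces to a minor of the second and third
    coordinates of \<open>e i\<close> and \<open>e j\<close>, which are proportional.\<close>
  have z1: "e k X1 = 0"
  proof (rule ccontr)
    assume n: "e k X1 \<noteq> 0"
    have "(c k + m) * e k X1 = 0"
      using s(2)[of X1 k, symmetric] by (simp add: s' m distrib_right)
    then have "c k = - m" using n by (simp add: eq_neg_iff_add_eq_0)
    then have "2 * m * e k X2 = 0" "2 * m * e k X3 = 0"
      using s(2)[of X2 k] s(2)[of X3 k] m by (simp_all add: s')
    then have "e k X2 = 0" "e k X3 = 0" using m by simp_all
    then have "det3 (e i) (e j) (e k) = 0" by (simp add: det3_def v u)
    with D show False by simp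
  qed
  define z2 z3 where z: "z2 = e k X2" "z3 = e k X3"
  have D': "u1 \<noteq> 0" "u3 * z2 - u2 * z3 \<noteq> 0"
    using D by (auto simp: det3_def v u[symmetric] z[symmetric] z1 algebra_simps)
  \<comment> \<open>The twist equations are cleared of denominators. Once \<open>p\<close> or
    \<open>q\<close> is known to be 1 or -1, they give the relation between the other two
    parameters.\<close>
  have "1 / (p * q) = - (p / r)" "p / r = q * r" using nu by (simp_all add: twist_simps)
  then have "1 = - (p / r) * (p * q)" "1 = - (q * r) * (p * q)" "p = q * r * r"
    using nz by (simp_all add: divide_eq_eq eq_divide_eq)
  note E = this
  have "r = r * (- (p / r) * (p * q))" unfolding E(1)[symmetric] by simp
  then have "r = - (p^2 * q)" using nz by (simp add: power2_eq_square)
  moreover have "p * q^2 * r = - (- (q * r) * (p * q))" by (simp add: power2_eq_square)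
  ultimately have pqr: "r = - (p^2 * q)" "p = q * r^2" "p * q^2 * r = -1"
    unfolding E(2)[symmetric] using E(3) by (simp_all only: power2_eq_square mult.assoc)
  note rot = rotate_index[OF s]
  have ri: "w x y i \<longleftrightarrow> w j x y" and rj: "w x y j \<longleftrightarrow> w i x y" and rk: "w x y k \<longleftrightarrow> w k x y" for x y
    using rot[of x y i] rot[of x y j] rot[of x y k] unfolding s' by blast+
  \<comment> \<open>Twisted rotation leads from \<open>i i i\<close> through \<open>j i i\<close>,
    \<open>j j i\<close>, \<open>j j j\<close> and \<open>i j j\<close> to \<open>i i j\<close>. The
    Latin property forbids \<open>i i i\<close> and \<open>i i j\<close> together, so the whole
    orbit is absent.\<close>
  have not1: "\<not> w i i i" "\<not> w i i j" "\<not> w i j j" "\<not> w j i i"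
    using ri[of i i] ri[of j i] ri[of j j] rj[of j j] rj[of i j] rj[of i i] latin1[of i i i j] ijk(1) by blast+
  \<comment> \<open>Without \<open>i i k\<close>, the square of \<open>e i\<close> is zero in the
    quadratic dual, which forces \<open>p = 1\<close> or \<open>q = 1\<close>. With it,
    \<open>i j k\<close> and \<open>j i k\<close> are absent, and it depends on \<open>i j i\<close>
    whether \<open>e i\<close> and \<open>e j\<close> annihilate each other.\<close>
  show ?thesis
  proof (cases "w i i k")
    case False
    then have "ann p q r (e i) (e i)"
      unfolding ann_iff using not1(1,2) ijk(4) by metis
    then have "u2 * (1 - p) = 0" "u3 * (1 - q) = 0" using D'(1) by (auto simp: ann_def u[symmetric])
    then consider "p = 1" | "q = 1" using D'(2) by auto
    then show ?thesis
    proof cases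
      case 1
      then show ?thesis using pqr(1) by (simp add: params_def)
    next
      case 2
      then show ?thesis using pqr(3) by (simp add: params_def)
    qed
  next
    case True
    then have kii: "w k i i" using rk by blast
    have ijk': "\<not> w i j k" using rk[of i j] kii latin1[of k i i j] ijk(1) by blast
    then have jik: "\<not> w j i k" using rk[of j i] ri[of k j] rj[of j k] ri[of j k] rj[of i k] rj[of k j] by blast
    show ?thesis
    proof (cases "w i j i")
      case False
      have "\<not> w i j x" for x using ijk(4)[of x] False not1(3) ijk' by (elim disjE) blast+
      moreover have "\<not> w j i x" for x
        using ijk(4)[of x] not1(4) jik rj[of j i] False by (elim disjE) blast+
      ultimately have "ann p q r (e i) (e j)" "ann p q r (e j) (e i)" unfolding ann_iff by blast+
      from ann_symmetric_imp[OF nz this D] consider "p = -1" | "q = -1"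
        by (auto simp: v u[symmetric])
      then show ?thesis
      proof cases
        case 1
        then show ?thesis using pqr(1) by (simp add: params_def)
      next
        case 2
        then show ?thesis using pqr(3) by (simp add: params_def)
      qed
    next
      case True
      \<comment> \<open>Replacing \<open>e i\<close> by its reflection \<open>e j\<close> in the
        last place flips the sign of \<open>A\<close> only. The common factor
        \<open>u1 * u2 * u3\<close> is nonzero because \<open>i j i\<close> is in the support, so
        both linear equations in \<open>A\<close>, \<open>B\<close>, \<open>C\<close> hold.\<close>
      define A B C where ABC: "A = 1 - r" "B = p * (1 - q)" "C = q * r * (1 - p)"
      have "qdet p q r (e i) (e i) (e i) = u1 * u2 * u3 * (A - B + C)"
        "qdet p q r (e i) (e i) (e j) = t * u1 * u2 * u3 * (- A - B + C)"
        by (simp_all add: qdet_def v u[symmetric] ABC algebra_simps)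
      moreover have "qdet p q r (e i) (e j) (e i) = u1 * u2 * u3 * t * ((1 - r) + p * (1 + q) - q * r * (1 + p))"
        by (simp add: qdet_def v u[symmetric] algebra_simps)
      ultimately have AB: "A - B + C = 0" "- A - B + C = 0"
        using True not1(1,2) t by auto
      have "2 * A = (A - B + C) - (- A - B + C)" by simp
      then have "A = 0" unfolding AB by simp
      then have r: "r = 1" by (simp add: ABC)
      have "B = C" using AB \<open>A = 0\<close> by simp
      then have pq: "p = q" using r by (simp add: ABC algebra_simps)
      have "\<not> w i k i" using ri[of i k] jik by blast
      moreover have "qdet p q r (e i) (e k) (e i) = u1 * (1 - p^2) * (u3 * z2 - u2 * z3)"
        by (simp add: qdet_def u[symmetric] z1 z[symmetric] r pq[symmetric] algebra_simps power2_eq_square)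
      ultimately have "p^2 = 1" using D' by simp
      then have "p = -1" using pqr(1) r pq by (metis mult_1 minus_minus)
      then show ?thesis using r pq by (simp add: params_def)
    qed
  qed
qed

text \<open>The square of nu acts on \<open>e i\<close> and \<open>e j\<close> as the scalar
  \<open>c i * c j\<close>. A coordinate in which nu^2 has another value must be the axis of
  \<open>e k\<close>. Otherwise the entries of nu agree up to sign, and not all are equal since
  \<open>e i\<close> and \<open>e j\<close> are independent; relabelling makes the exceptional entry
  the first.\<close>

lemma reflection:
  assumes s: "\<And>k. c k \<noteq> 0" "\<And>k x. nu x * e k x = c k * e (s k) x"
    and ijk: "i \<noteq> j" "k \<noteq> i" "k \<noteq> j" "\<And>x. x = i \<or> x = j \<or> x = k"
    and s': "s i = j" "s j = i" "s k = k"
  shows "params p q r"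
proof -
  have D: "det3 (e i) (e j) (e k) \<noteq> 0" using basis' ijk by metis
  have sq: "((nu x)^2 - c i * c j) * e i x = 0" "((nu x)^2 - c i * c j) * e j x = 0" for x
  proof -
    have "(nu x)^2 * e i x = nu x * (nu x * e i x)" by (simp add: power2_eq_square)
    also have "\<dots> = c i * c j * e i x" using s(2)[of x i] s(2)[of x j] by (simp add: s' mult.left_commute)
    finally show "((nu x)^2 - c i * c j) * e i x = 0" by (simp add: algebra_simps)
    have "(nu x)^2 * e j x = nu x * (nu x * e j x)" by (simp add: power2_eq_square)
    also have "\<dots> = c i * c j * e j x" using s(2)[of x i] s(2)[of x j] by (simp add: s' mult.left_commute)
    finally show "((nu x)^2 - c i * c j) * e j x = 0" by (simp add: algebra_simps)
  qed
  show ?thesis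
  proof (cases "\<exists>a. (nu a)^2 \<noteq> c i * c j")
    case True
    then obtain a where a: "(nu a)^2 \<noteq> c i * c j" by blast
    then have a0: "e i a = 0" "e j a = 0" using sq[of a] by simp_all
    then have "e k a \<noteq> 0" using D by (cases a) (auto simp: det3_def)
    then have ck: "c k = nu a" using s(2)[of a k] by (simp add: s')
    have "e k x = 0" if "x \<noteq> a" for x
    proof (rule ccontr)
      assume n: "e k x \<noteq> 0"
      then have "nu x = nu a" using s(2)[of x k] ck by (simp add: s')
      then have "e i x = 0" "e j x = 0" using sq[of x] a by simp_all
      then have "det3 (e i) (e j) (e k) = 0" using that a0 by (cases a; cases x) (auto simp: det3_def)
      with D show False by simp
    qed
    then show ?thesis using axis[OF ijk] a0 by blast
  next
    case False
    then have "(nu x)^2 = (nu y)^2" for x y by metis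
    then have pm: "nu x = nu y \<or> nu x = - nu y" for x y by (metis power2_eq_iff)
    have ns: "\<not> (nu X1 = nu X2 \<and> nu X2 = nu X3)"
    proof
      assume "nu X1 = nu X2 \<and> nu X2 = nu X3"
      then have "nu x = nu X1" for x by (cases x) simp_all
      then have "nu X1 * e i x = c i * e j x" for x using s(2)[of x i] s' by metis
      then have "e j x = (nu X1 / c i) * e i x" for x using s(1)[of i] by (simp add: field_simps del: twist_simps)
      then have "det3 (e i) (e j) (e k) = 0" by (intro det3_eq_0I) simp_all
      with D show False by simp
    qed
    consider "nu X1 = - nu X2" "nu X2 = nu X3" | "nu X2 = - nu X1" "nu X1 = nu X3" | "nu X3 = - nu X1" "nu X1 = nu X2"
      using pm[of X1 X2] pm[of X1 X3] pm[of X2 X3] ns by fastforce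
    then show ?thesis
    proof cases
      case 1
      then show ?thesis by (rule reflection_first[OF s ijk s'])
    next
      case 2
      have "params (1/p) r q"
      proof (rule graded_qdet.reflection_first[OF permuted12 s(1) _ ijk s'])
        show "twist (1/p) r q x * (e k \<circ> sw12) x = c k * (e (s k) \<circ> sw12) x" for k x
          using s(2)[of "sw12 x" k] by (cases x) (simp_all add: mult.commute)
      qed (use 2 in \<open>simp_all add: mult.commute\<close>)
      then show ?thesis by (rule params_sw12[OF nz])
    next
      case 3
      \<comment> \<open>The third coordinate is moved to the second place and then to the first; the
        parameters are moved back in the opposite order.\<close>
      interpret T: graded_qdet G q p "1/r" "\<lambda>i. e i \<circ> sw23" d g0 by (rule permuted23)
      have "params (1/q) (1/r) p"
      proof (rule graded_qdet.reflection_first[OF T.permuted12 s(1) _ ijk s'])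
        show "twist (1/q) (1/r) p x * (e k \<circ> sw23 \<circ> sw12) x = c k * (e (s k) \<circ> sw23 \<circ> sw12) x" for k x
          using s(2)[of "sw23 (sw12 x)" k] by (cases x) (simp_all add: mult.commute)
      qed (use 3 in \<open>simp_all add: mult.commute\<close>)
      then have "params q p (1/r)" by (rule params_sw12[OF T.nz])
      then show ?thesis by (rule params_sw23[OF nz])
    qed
  qed
qed

text \<open>All \<open>e k\<close> are eigenvectors of a diagonal matrix. If it is not scalar, three
  entries that are not all equal include a simple one; its eigenline is a coordinate axis, which
  contains one \<open>e k\<close>, and the other two vanish in that coordinate.\<close>

lemma diagonal:
  assumes s: "\<And>k x. nu x * e k x = c k * e k x"
  shows "params p q r"
proof (cases "nu X1 = nu X2 \<and> nu X2 = nu X3")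
  case True
  then show ?thesis using scalar_twist by blast
next
  case False
  note twist_simps [simp del]
  from False have "\<exists>a. \<forall>x. x \<noteq> a \<longrightarrow> nu x \<noteq> nu a"
  proof (cases "nu X2 = nu X3")
    case True
    then show ?thesis using False by (intro exI[of _ X1]) (simp add: all_gen)
  next
    case n: False
    show ?thesis
    proof (cases "nu X1 = nu X2")
      case True
      then show ?thesis using n by (intro exI[of _ X3]) (simp add: all_gen)
    next
      case False
      then show ?thesis using n by (intro exI[of _ X2]) (simp add: all_gen eq_commute)
    qed
  qed
  then obtain a where a: "\<And>x. x \<noteq> a \<Longrightarrow> nu x \<noteq> nu a" by blast
  have "\<exists>k. e k a \<noteq> 0"
    using basis by (rule contrapos_np) (cases a; simp add: det3_def)
  then obtain k where k: "e k a \<noteq> 0" by blast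
  then have "c k = nu a" using s[of a k] by simp
  then have kx: "e k x = 0" if "x \<noteq> a" for x using s[of x k] a[OF that] by simp
  have "X1 \<noteq> k \<or> X2 \<noteq> k" by auto
  then obtain i where "i \<noteq> k" by blast
  then obtain j where "j \<noteq> i" "j \<noteq> k" "\<And>x. x = i \<or> x = k \<or> x = j" by (rule other_index) blast
  then have ij: "i \<noteq> j" "k \<noteq> i" "k \<noteq> j" "\<And>x. x = i \<or> x = j \<or> x = k"
    using \<open>i \<noteq> k\<close> by blast+
  have ma: "e m a = 0" if "m \<noteq> k" for m
  proof (rule ccontr)
    assume "e m a \<noteq> 0"
    then have "c m = nu a" using s[of a m] by simp
    then have "e m x = 0" if "x \<noteq> a" for x using s[of x m] a[OF that] by simp
    then have "e k x * e m y = e k y * e m x" for x y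
      using kx[of x] kx[of y] by (cases "x = a"; cases "y = a") simp_all
    then have "det3 (e k) (e m) t = 0" for t by (intro det3_eq_0I)
    moreover obtain l where "l \<noteq> k" "l \<noteq> m" using other_index[of k m] \<open>m \<noteq> k\<close> by blast
    ultimately show False using basis'[of k m l] \<open>m \<noteq> k\<close> by blast
  qed
  show ?thesis by (rule axis[OF ij kx ma ma]) (use ij in auto)
qed

text \<open>Each of the six triples \<open>a a x\<close> and \<open>a b x\<close>, if present,
  generates under twisted rotation two triples that agree in their first two places but not in the
  third, or another triple already excluded. Both rows being empty contradicts the rank
  bound.\<close>

lemma no_three_cycle:
  assumes s: "\<And>k. c k \<noteq> 0" "\<And>k x. nu x * e k x = c k * e (s k) x"
    and s': "s a = b" "s b = c'" "s c' = a" and ne: "a \<noteq> b" "b \<noteq> c'" "a \<noteq> c'" and ex: "\<And>x. x = a \<or> x = b \<or> x = c'"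
  shows False
proof -
  have ra: "w x y a \<longleftrightarrow> w b x y" and rb: "w x y b \<longleftrightarrow> w c' x y" and rc: "w x y c' \<longleftrightarrow> w a x y" for x y
    using rotate_index[OF s, of x y a] rotate_index[OF s, of x y b] rotate_index[OF s, of x y c'] unfolding s' by blast+
  have aaa: "\<not> w a a a"
    using ra[of a a] ra[of b a] ra[of b b] latin1[of b b a b] ne by blast
  have aac: "\<not> w a a c'" using aaa rc[of a a] by blast
  have aab: "\<not> w a a b"
  proof
    assume "w a a b"
    then have 1: "w c' a a" using rb by blast
    then have "w b c' a" using ra by blast
    then have "w b b c'" using ra by blast
    then have "w a b b" using rc by blast
    then have "w c' a b" using rb by blast
    then show False using 1 latin1 ne by blast
  qed
  have abb: "\<not> w a b b"
  proof
    assume "w a b b"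
    then have 1: "w c' a b" using rb by blast
    then have "w c' c' a" using rb by blast
    then have "w b c' c'" using ra by blast
    then have "w a b c'" using rc by blast
    then have "w a a b" using rc by blast
    then show False using aab by blast
  qed
  have abc: "\<not> w a b c'" using aab rc[of a b] by blast
  have aba: "\<not> w a b a"
  proof
    assume "w a b a"
    then have "w b a b" using ra by blast
    then have 1: "w c' b a" using rb by blast
    then have "w b c' b" using ra by blast
    then have "w c' b c'" using rb by blast
    then show False using 1 latin1 ne by blast
  qed
  obtain l where "w a a l \<or> w a b l" using row[OF ne(1)] by blast
  then show False using aaa aac aab abb abc aba ex[of l] by (elim disjE) blast+
qed

theorem parameters: "params p q r"
proof -
  have "\<exists>c i. c \<noteq> 0 \<and> (\<forall>x. nu x * e k x = c * e i x) \<and> d i \<otimes> g0 = g0 \<otimes> d k" for k by (rule nu_e)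
  then have "\<forall>k. \<exists>y. fst y \<noteq> 0 \<and> (\<forall>x. nu x * e k x = fst y * e (snd y) x) \<and> d (snd y) \<otimes> g0 = g0 \<otimes> d k"
    by simp
  then obtain f where "\<forall>k. fst (f k) \<noteq> 0 \<and> (\<forall>x. nu x * e k x = fst (f k) * e (snd (f k)) x) \<and>
      d (snd (f k)) \<otimes> g0 = g0 \<otimes> d k"
    by (rule exE[OF choice])
  then obtain c s where s: "\<And>k. c k \<noteq> 0" "\<And>k x. nu x * e k x = c k * e (s k) x"
      and conj: "\<And>k. d (s k) \<otimes> g0 = g0 \<otimes> d k"
    using that[of "fst \<circ> f" "snd \<circ> f"] by simp
  obtain l where "w X1 X1 l \<or> w X1 X2 l" using row[of X1 X2 X1] by blast
  then have "g0 \<in> carrier G" using hom by (metis d_closed m_closed)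
  then have inj: "k = l" if "s k = s l" for k l
  proof -
    have "g0 \<otimes> d k = g0 \<otimes> d l" using conj[of k] conj[of l] that by metis
    then have "d k = d l" using \<open>g0 \<in> carrier G\<close> by (simp add: left_cancel)
    then show ?thesis by (rule d_inj)
  qed
  show ?thesis
  proof (cases "\<forall>k. s k = k")
    case True
    then show ?thesis using diagonal[of c] s(2) by simp
  next
    case False
    then obtain i where i: "s i \<noteq> i" by blast
    then obtain k where k: "k \<noteq> i" "k \<noteq> s i" "\<And>x. x = i \<or> x = s i \<or> x = k" using other_index[of i "s i"] by metis
    have "s (s i) \<noteq> s i" using inj i by blast
    show ?thesis
    proof (cases "s (s i) = i")
      case True
      have "s k \<noteq> i" "s k \<noteq> s i" using inj[of k "s i"] inj[of k i] True k by metis+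
      then have "s k = k" using k(3)[of "s k"] by blast
      then show ?thesis
        by (intro reflection[OF s _ _ _ k(3) refl True \<open>s k = k\<close>]) (use i k in auto)
    next
      case False
      then have "s (s i) = k" using k(3)[of "s (s i)"] \<open>s (s i) \<noteq> s i\<close> by blast
      moreover have "s k \<noteq> s i" "s k \<noteq> k" using inj[of k i] inj[of k "s i"] k calculation by metis+
      ultimately have "s k = i" using k(3)[of "s k"] by blast
      have False
        by (rule no_three_cycle[OF s refl \<open>s (s i) = k\<close> \<open>s k = i\<close> _ _ _ k(3)]) (use i k in auto)
      then show ?thesis ..
    qed
  qed
qed

end

section \<open>The free algebra and its quotient\<close>

lemma univ_ring_simps [simp]:
  "carrier univ_ring = UNIV" "x \<otimes>\<^bsub>univ_ring\<^esub> y = x * y" "\<one>\<^bsub>univ_ring\<^esub> = 1"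
  "\<zero>\<^bsub>univ_ring\<^esub> = 0" "x \<oplus>\<^bsub>univ_ring\<^esub> y = x + y"
  by (simp_all add: univ_ring_def)

lemma ring_univ_ring: "ring univ_ring"
proof (rule ringI)
  show "abelian_group univ_ring"
    by (rule abelian_groupI) (auto simp: algebra_simps intro: exI[of _ "- _"])
  show "monoid univ_ring"
    by (rule monoidI) (auto simp: algebra_simps)
qed (auto simp: algebra_simps)

lemma a_inv_univ_ring [simp]: "\<ominus>\<^bsub>univ_ring\<^esub> x = - x"
proof -
  interpret ring univ_ring by (rule ring_univ_ring)
  show ?thesis by (rule minus_equality) simp_all
qed

abbreviation (input) lookup :: "('a \<Rightarrow>\<^sub>0 'b::zero) \<Rightarrow> 'a \<Rightarrow> 'b" where
  "lookup \<equiv> Poly_Mapping.lookup"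

lemma free_alg_expand: "f = (\<Sum>w\<in>Poly_Mapping.keys f. Poly_Mapping.single w (lookup f w))"
  by (rule poly_mapping_eqI) (simp add: lookup_sum lookup_single when_def not_in_keys_iff_lookup_eq_zero)

text \<open>Used to reduce additive and bilinear identities in the free algebra to
  monomials.\<close>

lemma poly_mapping_additive_induct [case_names zero single add]:
  fixes f :: "'a \<Rightarrow>\<^sub>0 'b::comm_monoid_add"
  assumes "P 0" "\<And>u a. P (Poly_Mapping.single u a)" "\<And>f g. P f \<Longrightarrow> P g \<Longrightarrow> P (f + g)"
  shows "P f"
proof -
  have "P (\<Sum>w\<in>S. Poly_Mapping.single w (lookup f w))" if "finite S" for S
    using that by (induction S) (simp_all add: assms)
  then show ?thesis by (subst free_alg_expand) simp
qed

lemma word_add [simp]: "Word xs + Word ys = Word (xs @ ys)"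
  by (simp add: plus_word_def)

lemma word_zero: "0 = Word []"
  by (simp add: zero_word_def)

lemma lookup_mult_Word:
  fixes f g :: "'x word \<Rightarrow>\<^sub>0 'k::ring_1"
  shows "lookup (f * g) (Word xs) = (\<Sum>i\<le>length xs. lookup f (Word (take i xs)) * lookup g (Word (drop i xs)))"
proof (induction f rule: poly_mapping_additive_induct)
  case (single u a)
  show ?case
  proof (induction g rule: poly_mapping_additive_induct)
    case (single v b)
    obtain us vs where uv: "u = Word us" "v = Word vs" by (metis word.exhaust)
    have split: "us = take i xs \<and> vs = drop i xs \<longleftrightarrow> i = length us \<and> us @ vs = xs" if "i \<le> length xs" for i
    proof
      assume "us = take i xs \<and> vs = drop i xs"
      then show "i = length us \<and> us @ vs = xs" using that by simp
    qed auto
    have "(\<Sum>i\<le>length xs. lookup (Poly_Mapping.single u a) (Word (take i xs)) *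
        lookup (Poly_Mapping.single v b) (Word (drop i xs)))
      = (\<Sum>i\<le>length xs. if us = take i xs \<and> vs = drop i xs then a * b else 0)"
      by (rule sum.cong) (simp_all add: lookup_single when_def uv)
    also have "\<dots> = (\<Sum>i\<le>length xs. if i = length us then (if us @ vs = xs then a * b else 0) else 0)"
      by (rule sum.cong[OF refl], subst split) simp_all
    also have "\<dots> = (if us @ vs = xs then a * b else 0)"
      by auto
    finally show ?case by (simp add: uv mult_single lookup_single when_def)
  qed (simp_all add: lookup_add algebra_simps sum.distrib)
qed (simp_all add: lookup_add algebra_simps sum.distrib)

definition lin :: "(gen \<Rightarrow> 'k) \<Rightarrow> 'k::ring_1 free_alg" where
  "lin v = (\<Sum>x\<in>UNIV. Poly_Mapping.single (Word [x]) (v x))"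

definition quad :: "(gen \<Rightarrow> gen \<Rightarrow> 'k) \<Rightarrow> 'k::ring_1 free_alg" where
  "quad m = (\<Sum>x\<in>UNIV. \<Sum>y\<in>UNIV. Poly_Mapping.single (Word [x, y]) (m x y))"

text \<open>Membership of \<open>quad m\<close> in the space of relations.\<close>

definition qrel :: "'k \<Rightarrow> 'k \<Rightarrow> 'k \<Rightarrow> (gen \<Rightarrow> gen \<Rightarrow> 'k::field) \<Rightarrow> bool" where
  "qrel p q r m \<longleftrightarrow> m X1 X1 = 0 \<and> m X2 X2 = 0 \<and> m X3 X3 = 0 \<and>
     m X1 X2 = - p * m X2 X1 \<and> m X1 X3 = - q * m X3 X1 \<and> m X2 X3 = - r * m X3 X2"

lemma lookup_lin: "lookup (lin v) (Word xs) = (case xs of [x] \<Rightarrow> v x | _ \<Rightarrow> 0)"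
proof -
  have "lookup (lin v) (Word xs) = (\<Sum>x\<in>UNIV. if xs = [x] then v x else 0)"
    unfolding lin_def lookup_sum by (rule sum.cong) (auto simp: lookup_single when_def)
  also have "\<dots> = (case xs of [x] \<Rightarrow> v x | _ \<Rightarrow> 0)"
    by (auto split: list.split)
  finally show ?thesis .
qed

lemma lookup_quad: "lookup (quad m) (Word xs) = (case xs of [x, y] \<Rightarrow> m x y | _ \<Rightarrow> 0)"
proof -
  have "lookup (quad m) (Word xs) = (\<Sum>x\<in>UNIV. \<Sum>y\<in>UNIV. if xs = [x, y] then m x y else 0)"
    unfolding quad_def lookup_sum by (intro sum.cong) (auto simp: lookup_single when_def)
  also have "\<dots> = (case xs of [x, y] \<Rightarrow> m x y | _ \<Rightarrow> 0)"
  proof (cases "\<exists>x y. xs = [x, y]")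
    case True
    then obtain x y where xs: "xs = [x, y]" by blast
    have "(\<Sum>x'\<in>UNIV. \<Sum>y'\<in>UNIV. if xs = [x', y'] then m x' y' else 0)
        = (\<Sum>x'\<in>UNIV. if x' = x then m x y else 0)"
      by (rule sum.cong) (auto simp: xs)
    then show ?thesis by (simp add: xs)
  qed (auto split: list.split)
  finally show ?thesis .
qed

lemma free_alg_eqI: "(\<And>xs. lookup f (Word xs) = lookup g (Word xs)) \<Longrightarrow> f = g"
  by (rule poly_mapping_eqI) (metis word.exhaust)

lemma lookup_const: "lookup (const c) (Word xs) = (if xs = [] then c else 0)"
  by (auto simp: const_def lookup_single word_zero when_def)

lemma lookup_const_mult: "lookup (const c * f) (Word xs) = c * lookup f (Word xs)"
proof -
  have "lookup (const c * f) (Word xs) = (\<Sum>i\<le>length xs. if i = 0 then c * lookup f (Word xs) else 0)"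
    unfolding lookup_mult_Word by (rule sum.cong) (auto simp: lookup_const)
  then show ?thesis by simp
qed

lemma lookup_mult_const: "lookup (f * const c) (Word xs) = lookup f (Word xs) * c"
proof -
  have "lookup (f * const c) (Word xs) = (\<Sum>i\<le>length xs. if i = length xs then lookup f (Word xs) * c else 0)"
    unfolding lookup_mult_Word by (rule sum.cong) (auto simp: lookup_const)
  then show ?thesis by simp
qed

lemma const_commute: "const c * f = f * const c" for c :: "'k::comm_ring_1"
  by (rule free_alg_eqI) (simp add: lookup_const_mult lookup_mult_const mult.commute)

lemma const_simps: "const 0 = 0" "const 1 = 1" "const (a + b) = const a + const b" "const (a * b) = const a * const b"
  by (simp_all add: const_def single_add mult_single)

lemma var_lin: "var x = lin (\<lambda>y. if y = x then 1 else 0)"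
  by (rule free_alg_eqI) (auto simp: lookup_lin var_def lookup_single when_def split: list.split)

lemma lin_mult: "lin u * lin v = quad (\<lambda>x y. u x * v y)"
  by (simp add: lin_def quad_def sum_product mult_single)

lemma skew_ideal_quad: "skew_ideal p q r = genideal univ_ring
   {quad (\<lambda>x y. if (x, y) = (X2, X1) then 1 else if (x, y) = (X1, X2) then - p else 0),
    quad (\<lambda>x y. if (x, y) = (X3, X1) then 1 else if (x, y) = (X1, X3) then - q else 0),
    quad (\<lambda>x y. if (x, y) = (X3, X2) then 1 else if (x, y) = (X2, X3) then - r else 0)}"
proof -
  have "var b * var a - const c * var a * var b =
      quad (\<lambda>x y. if (x, y) = (b, a) then 1 else if (x, y) = (a, b) then - c else 0)"
    if "a \<noteq> b" for a b :: gen and c :: 'a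
    by (rule free_alg_eqI)
      (use that in \<open>auto simp: lookup_minus mult.assoc lookup_const_mult var_lin lin_mult lookup_quad split: list.split\<close>)
  from this[of X1 X2] this[of X1 X3] this[of X2 X3] show ?thesis
    by (simp add: skew_ideal_def)
qed

lemma ideal_skew_ideal: "ideal (skew_ideal p q r) univ_ring"
  unfolding skew_ideal_def by (rule ring.genideal_ideal[OF ring_univ_ring]) simp

lemma skew_ideal_mult:
  assumes "f \<in> skew_ideal p q r"
  shows "h * f \<in> skew_ideal p q r" "f * h \<in> skew_ideal p q r"
  using ideal.I_l_closed[OF ideal_skew_ideal assms, of h] ideal.I_r_closed[OF ideal_skew_ideal assms, of h] by simp_all

lemma skew_ideal_zero: "0 \<in> skew_ideal p q r"
  using additive_subgroup.zero_closed[OF ideal.axioms(1)[OF ideal_skew_ideal]] by simp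

lemma skew_ideal_add: "f \<in> skew_ideal p q r \<Longrightarrow> g \<in> skew_ideal p q r \<Longrightarrow> f + g \<in> skew_ideal p q r"
  using additive_subgroup.a_closed[OF ideal.axioms(1)[OF ideal_skew_ideal]] by simp

lemma skew_ideal_minus: "f \<in> skew_ideal p q r \<Longrightarrow> - f \<in> skew_ideal p q r"
  using skew_ideal_mult(1)[of f p q r "-1"] by simp

lemma skew_ideal_diff: "f \<in> skew_ideal p q r \<Longrightarrow> g \<in> skew_ideal p q r \<Longrightarrow> f - g \<in> skew_ideal p q r"
  using skew_ideal_add[OF _ skew_ideal_minus] by (metis diff_conv_add_uminus)

lemma skew_ideal_sum: "(\<And>i. i \<in> S \<Longrightarrow> f i \<in> skew_ideal p q r) \<Longrightarrow> sum f S \<in> skew_ideal p q r"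
  by (induction S rule: infinite_finite_induct) (simp_all add: skew_ideal_zero skew_ideal_add)

lemma quad_add: "quad m + quad m' = quad (\<lambda>x y. m x y + m' x y)"
  by (rule free_alg_eqI) (simp add: lookup_add lookup_quad split: list.split)

lemma const_quad: "const c * quad m = quad (\<lambda>x y. c * m x y)"
  by (rule free_alg_eqI) (simp add: lookup_const_mult lookup_quad split: list.split)

lemma quad_in_skew_idealI:
  assumes "qrel p q r m" shows "quad m \<in> skew_ideal p q r"
proof -
  let ?I = "skew_ideal p q r"
  let ?A = "\<lambda>x y. if (x, y) = (X2, X1) then 1 else if (x, y) = (X1, X2) then - p else 0"
  let ?B = "\<lambda>x y. if (x, y) = (X3, X1) then 1 else if (x, y) = (X1, X3) then - q else 0"
  let ?C = "\<lambda>x y. if (x, y) = (X3, X2) then 1 else if (x, y) = (X2, X3) then - r else 0"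
  have mem: "quad ?A \<in> ?I" "quad ?B \<in> ?I" "quad ?C \<in> ?I"
    unfolding skew_ideal_quad using ring.genideal_self[OF ring_univ_ring] by fastforce+
  have "m = (\<lambda>x y. m X2 X1 * ?A x y + m X3 X1 * ?B x y + m X3 X2 * ?C x y)"
  proof (intro ext)
    show "m x y = m X2 X1 * ?A x y + m X3 X1 * ?B x y + m X3 X2 * ?C x y" for x y
      using assms unfolding qrel_def by (cases x; cases y) simp_all
  qed
  then have "quad m = const (m X2 X1) * quad ?A + const (m X3 X1) * quad ?B + const (m X3 X2) * quad ?C"
    unfolding const_quad quad_add by (rule arg_cong)
  then show ?thesis using mem by (simp only: skew_ideal_add skew_ideal_mult)
qed

text \<open>The last hypothesis ranges over the whole space of relations instead of three
  generators, so that it can be checked after a linear change of variables.\<close>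

lemma skew_ideal_minimal:
  assumes "0 \<in> K" "\<And>f g. f \<in> K \<Longrightarrow> g \<in> K \<Longrightarrow> f + g \<in> K" "\<And>f h. f \<in> K \<Longrightarrow> h * f \<in> K" "\<And>f h. f \<in> K \<Longrightarrow> f * h \<in> K"
    and "\<And>m. qrel p q r m \<Longrightarrow> quad m \<in> K"
  shows "skew_ideal p q r \<subseteq> K"
  unfolding skew_ideal_quad
proof (rule ring.genideal_minimal[OF ring_univ_ring])
  show "ideal K univ_ring"
  proof (rule idealI[OF ring_univ_ring])
    show "subgroup K (add_monoid univ_ring)"
    proof
      show "inv\<^bsub>add_monoid univ_ring\<^esub> x \<in> K" if "x \<in> K" for x
        using assms(3)[OF that, of "-1"] a_inv_univ_ring[of x] by (simp add: a_inv_def)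
    qed (use assms(1,2) in auto)
  qed (use assms(3,4) in auto)
qed (auto intro!: assms(5) simp: qrel_def)

text \<open>\<open>?K\<close> is an ideal because only the constant term of a multiplier reaches
  degree two. Consequently the quotient keeps degrees zero and one intact, and in degree two loses
  exactly the relations.\<close>

lemma skew_ideal_lookup:
  assumes "f \<in> skew_ideal p q r"
  shows "lookup f (Word []) = 0" "lookup f (Word [x]) = 0" "qrel p q r (\<lambda>x y. lookup f (Word [x, y]))"
proof -
  let ?K = "{f. lookup f (Word []) = 0 \<and> (\<forall>x. lookup f (Word [x]) = 0) \<and> qrel p q r (\<lambda>x y. lookup f (Word [x, y]))}"
  have "skew_ideal p q r \<subseteq> ?K"
  proof (rule skew_ideal_minimal)
    show "h * f \<in> ?K" "f * h \<in> ?K" if "f \<in> ?K" for f h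
      using that by (simp_all add: lookup_mult_Word atMost_Suc qrel_def)
  qed (auto simp: lookup_add lookup_quad qrel_def algebra_simps)
  then show "lookup f (Word []) = 0" "lookup f (Word [x]) = 0" "qrel p q r (\<lambda>x y. lookup f (Word [x, y]))"
    using assms by blast+
qed

lemma quad_in_skew_ideal_iff: "quad m \<in> skew_ideal p q r \<longleftrightarrow> qrel p q r m"
  using quad_in_skew_idealI skew_ideal_lookup(3)[of "quad m" p q r] by (auto simp: lookup_quad)

lemma lin_in_skew_ideal: "lin v \<in> skew_ideal p q r \<Longrightarrow> v x = 0"
  using skew_ideal_lookup(2)[of "lin v" p q r x] by (simp add: lookup_lin)

definition proj :: "'k \<Rightarrow> 'k \<Rightarrow> 'k \<Rightarrow> 'k::field free_alg \<Rightarrow> 'k free_alg set" where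
  "proj p q r f = skew_ideal p q r +>\<^bsub>univ_ring\<^esub> f"

lemma proj_eq_iff: "proj p q r f = proj p q r g \<longleftrightarrow> f - g \<in> skew_ideal p q r"
proof
  have mem: "x \<in> proj p q r y \<longleftrightarrow> x - y \<in> skew_ideal p q r" for x y
    unfolding proj_def a_r_coset_def' by (auto intro: bexI[of _ "x - y"])
  {
    assume "proj p q r f = proj p q r g"
    moreover have "f \<in> proj p q r f" by (simp add: mem skew_ideal_zero)
    ultimately show "f - g \<in> skew_ideal p q r" using mem by blast
  next
    assume *: "f - g \<in> skew_ideal p q r"
    show "proj p q r f = proj p q r g"
    proof (rule Set.set_eqI)
      fix x
      have "x - g = (x - f) + (f - g)" "x - f = (x - g) - (f - g)" by simp_all
      then show "x \<in> proj p q r f \<longleftrightarrow> x \<in> proj p q r g"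
        unfolding mem using skew_ideal_add[OF _ *] skew_ideal_diff[OF _ *] by metis
    qed
  }
qed

text \<open>These equations replace coset arithmetic by computation with representatives.\<close>

lemma skew_poly_ring_simps:
  "carrier (skew_poly_ring p q r) = range (proj p q r)"
  "proj p q r f \<otimes>\<^bsub>skew_poly_ring p q r\<^esub> proj p q r g = proj p q r (f * g)"
  "proj p q r f \<oplus>\<^bsub>skew_poly_ring p q r\<^esub> proj p q r g = proj p q r (f + g)"
  "\<zero>\<^bsub>skew_poly_ring p q r\<^esub> = proj p q r 0"
  "\<one>\<^bsub>skew_poly_ring p q r\<^esub> = proj p q r 1"
  "c \<odot>\<^bsub>skew_poly_ring p q r\<^esub> proj p q r f = proj p q r (const c * f)"
proof -
  interpret ideal "skew_ideal p q r" univ_ring by (rule ideal_skew_ideal)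
  note defs = skew_poly_ring_def Let_def ring.extend_def module.fields_def FactRing_def
  show "carrier (skew_poly_ring p q r) = range (proj p q r)"
    by (auto simp: defs A_RCOSETS_def' proj_def)
  show "proj p q r f \<otimes>\<^bsub>skew_poly_ring p q r\<^esub> proj p q r g = proj p q r (f * g)"
    using rcoset_mult_add[of f g] by (simp add: defs proj_def)
  show "proj p q r f \<oplus>\<^bsub>skew_poly_ring p q r\<^esub> proj p q r g = proj p q r (f + g)"
    using a_rcos_sum[of f g] by (simp add: defs proj_def)
  show "\<zero>\<^bsub>skew_poly_ring p q r\<^esub> = proj p q r 0"
    by (auto simp: defs proj_def a_r_coset_def')
  show "\<one>\<^bsub>skew_poly_ring p q r\<^esub> = proj p q r 1"
    by (simp add: defs proj_def)
  show "c \<odot>\<^bsub>skew_poly_ring p q r\<^esub> proj p q r f = proj p q r (const c * f)"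
    using rcoset_mult_add[of "const c" f] by (simp add: defs proj_def)
qed

lemma skew_degree_proj:
  "skew_degree p q r n = proj p q r ` {f. \<forall>w\<in>Poly_Mapping.keys f. length (letters w) = n}"
  unfolding skew_degree_def proj_def ..

lemma abelian_group_skew_poly_ring: "abelian_group (skew_poly_ring p q r)"
proof (rule abelian_groupI)
  fix x assume "x \<in> carrier (skew_poly_ring p q r)"
  then obtain f where "x = proj p q r f" by (auto simp: skew_poly_ring_simps)
  then show "\<exists>y\<in>carrier (skew_poly_ring p q r). y \<oplus>\<^bsub>skew_poly_ring p q r\<^esub> x = \<zero>\<^bsub>skew_poly_ring p q r\<^esub>"
    by (intro bexI[of _ "proj p q r (- f)"]) (simp_all add: skew_poly_ring_simps)
qed (auto simp: skew_poly_ring_simps algebra_simps)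

lemma a_inv_skew_poly_ring:
  "\<ominus>\<^bsub>skew_poly_ring p q r\<^esub> proj p q r f = proj p q r (- f)"
proof -
  interpret abelian_group "skew_poly_ring p q r" by (rule abelian_group_skew_poly_ring)
  show ?thesis by (rule minus_equality) (simp_all add: skew_poly_ring_simps)
qed

lemma finsum_skew_poly_ring:
  assumes "finite S" "\<And>i. i \<in> S \<Longrightarrow> g i = proj p q r (f i)"
  shows "(\<Oplus>\<^bsub>skew_poly_ring p q r\<^esub>i\<in>S. g i) = proj p q r (sum f S)"
proof -
  interpret abelian_group "skew_poly_ring p q r" by (rule abelian_group_skew_poly_ring)
  show ?thesis
    using assms
  proof (induction S)
    case empty
    then show ?case by (simp add: skew_poly_ring_simps)
  next
    case (insert i S)
    have "(\<Oplus>\<^bsub>skew_poly_ring p q r\<^esub>i\<in>insert i S. g i) = g i \<oplus>\<^bsub>skew_poly_ring p q r\<^esub> (\<Oplus>\<^bsub>skew_poly_ring p q r\<^esub>i\<in>S. g i)"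
      using insert by (intro finsum_insert) (auto simp: skew_poly_ring_simps)
    then show ?case using insert by (simp add: skew_poly_ring_simps)
  qed
qed

section \<open>Gradings of the quotient\<close>

lemma proj_sum_mono_neutral:
  assumes "finite T" "S \<subseteq> T" "\<And>i. i \<in> T - S \<Longrightarrow> proj p q r (f i) = proj p q r 0"
  shows "proj p q r (sum f T) = proj p q r (sum f S)"
proof -
  have "sum f T - sum f S = sum f (T - S)" using assms(1,2) by (simp add: sum_diff)
  also have "\<dots> \<in> skew_ideal p q r" using assms(3) by (intro skew_ideal_sum) (simp add: proj_eq_iff)
  finally show ?thesis by (simp add: proj_eq_iff)
qed

text \<open>Two decompositions of an element are subtracted over the union of their supports;
  closure under differences then reduces uniqueness to the independence of finite families of
  representatives.\<close>

lemma internal_direct_sumI: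
  assumes V: "\<And>i. i \<in> I \<Longrightarrow> V i \<subseteq> W" "W \<subseteq> range (proj p q r)"
    and zero: "\<And>i. i \<in> I \<Longrightarrow> proj p q r 0 \<in> V i"
    and diff: "\<And>i f g. i \<in> I \<Longrightarrow> proj p q r f \<in> V i \<Longrightarrow> proj p q r g \<in> V i \<Longrightarrow> proj p q r (f - g) \<in> V i"
    and ex: "\<And>f. proj p q r f \<in> W \<Longrightarrow>
      \<exists>T b. finite T \<and> T \<subseteq> I \<and> (\<forall>i\<in>T. proj p q r (b i) \<in> V i) \<and> proj p q r f = proj p q r (sum b T)"
    and indep: "\<And>T b i. finite T \<Longrightarrow> T \<subseteq> I \<Longrightarrow> (\<And>i. i \<in> T \<Longrightarrow> proj p q r (b i) \<in> V i) \<Longrightarrow>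
      proj p q r (sum b T) = proj p q r 0 \<Longrightarrow> i \<in> T \<Longrightarrow> proj p q r (b i) = proj p q r 0"
  shows "internal_direct_sum (skew_poly_ring p q r) I V W"
  unfolding internal_direct_sum_def skew_poly_ring_simps
proof (intro conjI ballI ex_ex1I)
  show "V i \<subseteq> W" if "i \<in> I" for i by (rule V(1)[OF that])
next
  fix w assume "w \<in> W"
  then obtain f where w: "w = proj p q r f" "proj p q r f \<in> W" using V(2) by blast
  obtain T b where T: "finite T" "T \<subseteq> I" "\<forall>i\<in>T. proj p q r (b i) \<in> V i" "proj p q r f = proj p q r (sum b T)"
    using ex[OF w(2)] by blast
  define c where "c = (\<lambda>i\<in>I. if i \<in> T then proj p q r (b i) else proj p q r 0)"
  let ?S = "{i \<in> I. c i \<noteq> proj p q r 0}"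
  have S: "?S \<subseteq> T" by (auto simp: c_def)
  have "(\<Oplus>\<^bsub>skew_poly_ring p q r\<^esub>i\<in>?S. c i) = proj p q r (sum b ?S)"
    by (rule finsum_skew_poly_ring) (use S T in \<open>auto simp: c_def intro: finite_subset\<close>)
  also have "\<dots> = proj p q r (sum b T)"
    by (rule proj_sum_mono_neutral[symmetric]) (use S T in \<open>auto simp: c_def\<close>)
  finally have "w = (\<Oplus>\<^bsub>skew_poly_ring p q r\<^esub>i\<in>?S. c i)" using w T by simp
  moreover have "c \<in> (\<Pi>\<^sub>E i\<in>I. V i)" using T zero by (auto simp: c_def)
  moreover have "finite ?S" using S T by (auto intro: finite_subset)
  ultimately show "\<exists>c. c \<in> (\<Pi>\<^sub>E i\<in>I. V i) \<and> finite {i \<in> I. c i \<noteq> proj p q r 0} \<and>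
      w = (\<Oplus>\<^bsub>skew_poly_ring p q r\<^esub>i\<in>{i \<in> I. c i \<noteq> proj p q r 0}. c i)" by blast
next
  fix w c c'
  assume c: "c \<in> (\<Pi>\<^sub>E i\<in>I. V i) \<and> finite {i \<in> I. c i \<noteq> proj p q r 0} \<and>
      w = (\<Oplus>\<^bsub>skew_poly_ring p q r\<^esub>i\<in>{i \<in> I. c i \<noteq> proj p q r 0}. c i)"
    and c': "c' \<in> (\<Pi>\<^sub>E i\<in>I. V i) \<and> finite {i \<in> I. c' i \<noteq> proj p q r 0} \<and>
      w = (\<Oplus>\<^bsub>skew_poly_ring p q r\<^esub>i\<in>{i \<in> I. c' i \<noteq> proj p q r 0}. c' i)"
  note cc = c[THEN conjunct1] c[THEN conjunct2, THEN conjunct1] c[THEN conjunct2, THEN conjunct2]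
  note cc' = c'[THEN conjunct1] c'[THEN conjunct2, THEN conjunct1] c'[THEN conjunct2, THEN conjunct2]
  define T where "T = {i \<in> I. c i \<noteq> proj p q r 0} \<union> {i \<in> I. c' i \<noteq> proj p q r 0}"
  have T: "finite T" "T \<subseteq> I" using cc(2) cc'(2) by (auto simp: T_def)
  have choose: "\<exists>f. \<forall>i\<in>I. a i = proj p q r (f i)" if "a \<in> (\<Pi>\<^sub>E i\<in>I. V i)" for a
  proof (intro bchoice ballI)
    fix i assume i: "i \<in> I"
    have "a i \<in> W" using PiE_mem[OF that i] V(1)[OF i] by blast
    then show "\<exists>y. a i = proj p q r y" using V(2) by blast
  qed
  obtain f where f: "\<forall>i\<in>I. c i = proj p q r (f i)" using choose[OF cc(1)] by (rule exE)
  obtain f' where f': "\<forall>i\<in>I. c' i = proj p q r (f' i)" using choose[OF cc'(1)] by (rule exE)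
  have "w = proj p q r (sum f T)"
  proof -
    have "w = proj p q r (sum f {i \<in> I. c i \<noteq> proj p q r 0})"
      unfolding cc(3) by (rule finsum_skew_poly_ring) (use cc(2) f in auto)
    also have "\<dots> = proj p q r (sum f T)"
      by (rule proj_sum_mono_neutral[symmetric]) (use T f in \<open>auto simp: T_def\<close>)
    finally show ?thesis .
  qed
  moreover have "w = proj p q r (sum f' T)"
  proof -
    have "w = proj p q r (sum f' {i \<in> I. c' i \<noteq> proj p q r 0})"
      unfolding cc'(3) by (rule finsum_skew_poly_ring) (use cc'(2) f' in auto)
    also have "\<dots> = proj p q r (sum f' T)"
      by (rule proj_sum_mono_neutral[symmetric]) (use T f' in \<open>auto simp: T_def\<close>)
    finally show ?thesis .
  qed
  ultimately have "proj p q r (sum f T) = proj p q r (sum f' T)" by (rule subst)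
  then have "proj p q r (\<Sum>i\<in>T. f i - f' i) = proj p q r 0"
    by (simp add: proj_eq_iff sum_subtractf)
  moreover have "proj p q r (f i - f' i) \<in> V i" if "i \<in> T" for i
  proof (rule diff)
    show i: "i \<in> I" using T that by blast
    show "proj p q r (f i) \<in> V i" "proj p q r (f' i) \<in> V i"
      using PiE_mem[OF cc(1) i] PiE_mem[OF cc'(1) i] f f' i by simp_all
  qed
  ultimately have "proj p q r (f i - f' i) = proj p q r 0" if "i \<in> T" for i
    using indep[OF T, of "\<lambda>i. f i - f' i" i] that by blast
  then have eq: "c i = c' i" if "i \<in> T" for i
  proof -
    have "i \<in> I" "f i - f' i \<in> skew_ideal p q r"
      using that T \<open>\<And>i. i \<in> T \<Longrightarrow> proj p q r (f i - f' i) = proj p q r 0\<close>[OF that]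
      by (auto simp: proj_eq_iff)
    then show ?thesis using f f' by (simp add: proj_eq_iff)
  qed
  show "c = c'"
  proof (rule PiE_ext[of c I V])
    show "c i = c' i" if "i \<in> I" for i
      using eq[of i] that by (cases "i \<in> T") (auto simp: T_def)
  qed (use cc(1) cc'(1) in auto)
qed

lemma internal_direct_sumD:
  assumes "internal_direct_sum M I V W"
  shows "i \<in> I \<Longrightarrow> V i \<subseteq> W"
    and "w \<in> W \<Longrightarrow> \<exists>!c. c \<in> (\<Pi>\<^sub>E i\<in>I. V i) \<and> finite {i\<in>I. c i \<noteq> \<zero>\<^bsub>M\<^esub>} \<and>
      w = (\<Oplus>\<^bsub>M\<^esub>i\<in>{i\<in>I. c i \<noteq> \<zero>\<^bsub>M\<^esub>}. c i)"
  by (erule assms[unfolded internal_direct_sum_def, THEN conjunct1, THEN bspec],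
      erule assms[unfolded internal_direct_sum_def, THEN conjunct2, THEN bspec])

lemma internal_direct_sum_ex:
  assumes "internal_direct_sum (skew_poly_ring p q r) I V W" "proj p q r f \<in> W" "W \<subseteq> range (proj p q r)"
  obtains T b where "finite T" "T \<subseteq> I" "\<And>i. i \<in> T \<Longrightarrow> proj p q r (b i) \<in> V i" "proj p q r f = proj p q r (sum b T)"
proof -
  have V: "V i \<subseteq> range (proj p q r)" if "i \<in> I" for i
    using internal_direct_sumD(1)[OF assms(1) that] assms(3) by (rule subset_trans)
  obtain c where c: "c \<in> (\<Pi>\<^sub>E i\<in>I. V i)" "finite {i\<in>I. c i \<noteq> proj p q r 0}"
    "proj p q r f = (\<Oplus>\<^bsub>skew_poly_ring p q r\<^esub>i\<in>{i\<in>I. c i \<noteq> proj p q r 0}. c i)"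
    using ex1_implies_ex[OF internal_direct_sumD(2)[OF assms(1,2)]] unfolding skew_poly_ring_simps
    by (elim exE conjE)
  have "\<exists>b. \<forall>i\<in>I. c i = proj p q r (b i)"
  proof (intro bchoice ballI)
    fix i assume i: "i \<in> I"
    show "\<exists>y. c i = proj p q r y" using PiE_mem[OF c(1) i] V[OF i] by blast
  qed
  then obtain b where b: "\<forall>i\<in>I. c i = proj p q r (b i)" by (rule exE)
  show ?thesis
  proof (rule that)
    show "proj p q r f = proj p q r (sum b {i\<in>I. c i \<noteq> proj p q r 0})"
      unfolding c(3) by (rule finsum_skew_poly_ring) (use c b in auto)
    show "proj p q r (b i) \<in> V i" if "i \<in> {i\<in>I. c i \<noteq> proj p q r 0}" for i
      using that PiE_mem[OF c(1), of i] b by simp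
  qed (use c in auto)
qed

text \<open>The given family, extended by zero, and the zero family both decompose 0, so uniqueness
  identifies them.\<close>

lemma internal_direct_sum_indep:
  assumes "internal_direct_sum (skew_poly_ring p q r) I V W" "proj p q r 0 \<in> W"
    and zero: "\<And>i. i \<in> I \<Longrightarrow> proj p q r 0 \<in> V i"
    and T: "finite T" "T \<subseteq> I" "\<And>i. i \<in> T \<Longrightarrow> proj p q r (b i) \<in> V i" and sum: "proj p q r (sum b T) = proj p q r 0"
    and "i \<in> T"
  shows "proj p q r (b i) = proj p q r 0"
proof -
  define P where "P c \<longleftrightarrow> c \<in> (\<Pi>\<^sub>E i\<in>I. V i) \<and> finite {i\<in>I. c i \<noteq> proj p q r 0} \<and>
    proj p q r 0 = (\<Oplus>\<^bsub>skew_poly_ring p q r\<^esub>i\<in>{i\<in>I. c i \<noteq> proj p q r 0}. c i)" for c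
  have uniq: "\<exists>!c. P c"
    using internal_direct_sumD(2)[OF assms(1,2)] unfolding skew_poly_ring_simps P_def .
  define c where "c = (\<lambda>i\<in>I. if i \<in> T then proj p q r (b i) else proj p q r 0)"
  let ?S = "{i \<in> I. c i \<noteq> proj p q r 0}"
  have S: "?S \<subseteq> T" by (auto simp: c_def)
  have "(\<Oplus>\<^bsub>skew_poly_ring p q r\<^esub>i\<in>?S. c i) = proj p q r (sum b ?S)"
    by (rule finsum_skew_poly_ring) (use S T in \<open>auto simp: c_def intro: finite_subset\<close>)
  also have "\<dots> = proj p q r (sum b T)"
    by (rule proj_sum_mono_neutral[symmetric]) (use S T in \<open>auto simp: c_def\<close>)
  finally have eq: "(\<Oplus>\<^bsub>skew_poly_ring p q r\<^esub>i\<in>?S. c i) = proj p q r (sum b T)" .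
  have "P c" unfolding P_def
  proof (intro conjI)
    show "c \<in> (\<Pi>\<^sub>E i\<in>I. V i)" using T zero by (auto simp: c_def)
    show "finite ?S" using S T by (auto intro: finite_subset)
    show "proj p q r 0 = (\<Oplus>\<^bsub>skew_poly_ring p q r\<^esub>i\<in>?S. c i)" unfolding eq sum ..
  qed
  moreover have "P (\<lambda>i\<in>I. proj p q r 0)"
  proof -
    have empty: "{i \<in> I. (\<lambda>i\<in>I. proj p q r 0) i \<noteq> proj p q r 0} = {}" by auto
    have "finsum (skew_poly_ring p q r) h {} = proj p q r 0" for h
      using finsum_skew_poly_ring[of "{}" h p q r "\<lambda>_. 0"] by simp
    then show ?thesis unfolding P_def empty using zero by (intro conjI) (auto simp del: restrict_apply)
  qed
  ultimately have "c = (\<lambda>i\<in>I. proj p q r 0)" using uniq by blast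
  then have "c i = proj p q r 0" using \<open>i \<in> T\<close> T by auto
  then show ?thesis using \<open>i \<in> T\<close> T by (auto simp: c_def)
qed

section \<open>Linear changes of variables and the components of degree zero and one\<close>

definition unit_vec :: "gen \<Rightarrow> gen \<Rightarrow> 'k::zero_neq_one" where
  "unit_vec x y = (if y = x then 1 else 0)"

text \<open>The coefficients of the quadratic form \<open>m\<close> after substituting the linear forms \<open>P i\<close> for the
  generators.\<close>

definition congr :: "(gen \<Rightarrow> gen \<Rightarrow> 'k) \<Rightarrow> (gen \<Rightarrow> gen \<Rightarrow> 'k) \<Rightarrow> gen \<Rightarrow> gen \<Rightarrow> 'k::field" where
  "congr P m x y = (\<Sum>i\<in>UNIV. \<Sum>j\<in>UNIV. m i j * P i x * P j y)"

lemma det3_sum_left: "det3 (\<lambda>x. \<Sum>i\<in>S. u i x) v t = (\<Sum>i\<in>S. det3 (u i) v t)"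
  by (induction S rule: infinite_finite_induct) (simp_all add: det3_def algebra_simps)

lemma lin_sum: "(\<Sum>i\<in>S. lin (v i)) = lin (\<lambda>x. \<Sum>i\<in>S. v i x)"
  by (rule free_alg_eqI) (simp add: lookup_sum lookup_lin split: list.split)

lemma const_lin: "const c * lin v = lin (\<lambda>x. c * v x)"
  by (rule free_alg_eqI) (simp add: lookup_const_mult lookup_lin split: list.split)

lemma quad_sum: "(\<Sum>i\<in>S. quad (m i)) = quad (\<lambda>x y. \<Sum>i\<in>S. m i x y)"
  by (rule free_alg_eqI) (simp add: lookup_sum lookup_quad split: list.split)

lemma quad_congr: "quad (congr P m) = (\<Sum>i\<in>UNIV. \<Sum>j\<in>UNIV. const (m i j) * (lin (P i) * lin (P j)))"
  unfolding lin_mult const_quad quad_sum by (simp add: congr_def[abs_def] mult.assoc)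

lemma proj_lin_eq_iff: "proj p q r (lin u) = proj p q r (lin v) \<longleftrightarrow> u = v"
proof
  assume "proj p q r (lin u) = proj p q r (lin v)"
  then have "lin u - lin v \<in> skew_ideal p q r" by (simp add: proj_eq_iff)
  moreover have "lin u - lin v = lin (\<lambda>x. u x - v x)"
    by (rule free_alg_eqI) (simp add: lookup_minus lookup_lin split: list.split)
  ultimately have "u x - v x = 0" for x using lin_in_skew_ideal[of "\<lambda>x. u x - v x"] by simp
  then show "u = v" by (simp add: fun_eq_iff)
qed simp

lemma proj_const_eq_0_iff: "proj p q r (const c) = proj p q r 0 \<longleftrightarrow> c = 0"
proof
  assume "proj p q r (const c) = proj p q r 0"
  then have "const c \<in> skew_ideal p q r" by (simp add: proj_eq_iff)
  then show "c = 0" using skew_ideal_lookup(1)[of "const c"] by (simp add: lookup_const)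
qed (simp add: const_simps)

lemma skew_degree_0E:
  assumes "x \<in> skew_degree p q r 0" obtains c where "x = proj p q r (const c)"
proof -
  obtain f where f: "x = proj p q r f" "\<forall>w\<in>Poly_Mapping.keys f. length (letters w) = 0"
    using assms unfolding skew_degree_proj by blast
  have "f = const (lookup f (Word []))"
  proof (rule free_alg_eqI)
    show "lookup f (Word xs) = lookup (const (lookup f (Word []))) (Word xs)" for xs
      using f(2)[rule_format, of "Word xs"] by (cases xs) (auto simp: lookup_const in_keys_iff)
  qed
  then show ?thesis using that f(1) by metis
qed

lemma skew_degree_1E:
  assumes "x \<in> skew_degree p q r 1" obtains v where "x = proj p q r (lin v)"
proof -
  obtain f where f: "x = proj p q r f" "\<forall>w\<in>Poly_Mapping.keys f. length (letters w) = 1"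
    using assms unfolding skew_degree_proj by blast
  have z: "lookup f (Word xs) = 0" if "length xs \<noteq> 1" for xs
    using f(2) that by (metis in_keys_iff word.sel)
  have "f = lin (\<lambda>x. lookup f (Word [x]))"
  proof (rule free_alg_eqI)
    show "lookup f (Word xs) = lookup (lin (\<lambda>x. lookup f (Word [x]))) (Word xs)" for xs
      by (auto simp: lookup_lin z split: list.split)
  qed
  then show ?thesis using that f(1) by metis
qed

lemma lin_in_skew_degree: "proj p q r (lin v) \<in> skew_degree p q r 1"
  unfolding skew_degree_proj
proof (intro imageI CollectI ballI)
  fix w assume "w \<in> Poly_Mapping.keys (lin v)"
  then show "length (letters w) = 1"
    by (cases w) (auto simp: in_keys_iff lookup_lin split: list.splits)
qed

lemma const_in_skew_degree: "proj p q r (const c) \<in> skew_degree p q r 0"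
  unfolding skew_degree_proj
proof (intro imageI CollectI ballI)
  fix w assume "w \<in> Poly_Mapping.keys (const c)"
  then show "length (letters w) = 0"
    by (cases w) (auto simp: in_keys_iff lookup_const split: if_splits)
qed

lemma skew_degree_subset: "skew_degree p q r n \<subseteq> range (proj p q r)"
  unfolding skew_degree_proj by blast

section \<open>Homogeneous bases for a given grading\<close>

locale skew_grading = group G for G (structure) +
  fixes p q r :: "'k::field" and V
  assumes grading: "group_grading G (skew_poly_ring p q r) V"
begin

abbreviation "pr \<equiv> proj p q r"

lemma submod: "g \<in> carrier G \<Longrightarrow> submodule (V g) univ_ring (skew_poly_ring p q r)"
  using grading unfolding group_grading_def by blast

lemma V_add: assumes "g \<in> carrier G" "pr f \<in> V g" "pr h \<in> V g" shows "pr (f + h) \<in> V g"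
  using subgroup.m_closed[OF submodule.axioms(1)[OF submod[OF assms(1)]] assms(2,3)] by (simp add: skew_poly_ring_simps)

lemma V_smult: assumes "g \<in> carrier G" "pr f \<in> V g" shows "pr (const c * f) \<in> V g"
  using submodule.smult_closed[OF submod[OF assms(1)] _ assms(2), of c] by (simp add: skew_poly_ring_simps)

lemma V_zero: "g \<in> carrier G \<Longrightarrow> pr 0 \<in> V g"
  using subgroup.one_closed[OF submodule.axioms(1)[OF submod]] by (simp add: skew_poly_ring_simps)

lemma V_sum: assumes "g \<in> carrier G" "\<And>i. i \<in> S \<Longrightarrow> pr (f i) \<in> V g" shows "pr (sum f S) \<in> V g"
  using assms(2) by (induction S rule: infinite_finite_induct) (simp_all add: V_zero V_add assms(1))

lemma V_neg: assumes "g \<in> carrier G" "pr f \<in> V g" shows "pr (- f) \<in> V g"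
proof -
  have "const (-1) * f = - f" by (rule free_alg_eqI) (simp add: lookup_const_mult)
  then show ?thesis using V_smult[OF assms, of "-1"] by simp
qed

lemma V_mult: assumes "g \<in> carrier G" "h \<in> carrier G" "pr f \<in> V g" "pr f' \<in> V h" shows "pr (f * f') \<in> V (g \<otimes> h)"
proof -
  have "pr f \<otimes>\<^bsub>skew_poly_ring p q r\<^esub> pr f' \<in> V (g \<otimes> h)"
    using grading assms unfolding group_grading_def by blast
  then show ?thesis by (simp add: skew_poly_ring_simps)
qed

lemma V_direct: "internal_direct_sum (skew_poly_ring p q r) (carrier G) V (range pr)"
  using grading unfolding group_grading_def skew_poly_ring_simps by blast

lemma V_subset: "g \<in> carrier G \<Longrightarrow> V g \<subseteq> range pr"
  by (rule internal_direct_sumD(1)[OF V_direct])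

lemma V_indep:
  assumes "finite T" "T \<subseteq> carrier G" "\<And>i. i \<in> T \<Longrightarrow> pr (b i) \<in> V i" "pr (sum b T) = pr 0" "i \<in> T"
  shows "pr (b i) = pr 0"
  using internal_direct_sum_indep[OF V_direct _ V_zero assms(1-4) assms(5)] by blast

lemma V_indep2:
  assumes "g \<in> carrier G" "h \<in> carrier G" "g \<noteq> h" "pr f \<in> V g" "pr f \<in> V h"
  shows "pr f = pr 0"
proof -
  have "pr (if g = g then f else - f) = pr 0"
    by (rule V_indep[of "{g, h}" "\<lambda>x. if x = g then f else - f" g]) (use assms V_neg in auto)
  then show ?thesis by simp
qed

end

locale skew_refined_grading = skew_grading G p q r V
  for G (structure) and p q r :: "'k::field" and V +
  assumes refines: "refines_grading G (skew_poly_ring p q r) V (skew_degree p q r)"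
begin

lemma degree_decomp:
  assumes "pr f \<in> skew_degree p q r n"
  obtains T b where "finite T" "T \<subseteq> carrier G" "\<And>i. i \<in> T \<Longrightarrow> pr (b i) \<in> skew_degree p q r n \<inter> V i"
    "pr f = pr (sum b T)"
  using internal_direct_sum_ex[OF refines[unfolded refines_grading_def, rule_format] assms skew_degree_subset] by blast

text \<open>The part of degree zero consists of scalars, so compatibility with the natural grading
  gives a nonzero scalar that is homogeneous of some degree \<open>g\<close>. Then 1 has degree
  \<open>g\<close>, and 1 * 1 = 1 yields g g = g.\<close>

lemma one_in_V_one: "pr 1 \<in> V \<one>"
proof -
  have "pr (const 1) \<in> skew_degree p q r 0" by (rule const_in_skew_degree)
  then obtain T b where T: "finite T" "T \<subseteq> carrier G" "\<And>i. i \<in> T \<Longrightarrow> pr (b i) \<in> skew_degree p q r 0 \<inter> V i"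
    "pr (const 1) = pr (sum b T)" by (rule degree_decomp) blast
  have "\<exists>i\<in>T. pr (b i) \<noteq> pr 0"
  proof (rule ccontr)
    assume "\<not> ?thesis"
    then have "pr (sum b T) = pr (sum b {})"
      using T by (intro proj_sum_mono_neutral) auto
    then show False using T(4) proj_const_eq_0_iff[of p q r 1] by simp
  qed
  then obtain g where g: "g \<in> T" "pr (b g) \<noteq> pr 0" by blast
  obtain c where c: "pr (b g) = pr (const c)" using T(3)[OF g(1)] skew_degree_0E by blast
  have c0: "c \<noteq> 0" using g(2) unfolding c proj_const_eq_0_iff .
  have gG: "g \<in> carrier G" using g T by blast
  have "pr (const c) \<in> V g" using T(3)[OF g(1)] c by simp
  from V_smult[OF gG this, of "1/c"] have 1: "pr 1 \<in> V g"
    using c0 by (simp add: const_simps(4)[symmetric] const_simps(2))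
  have "pr (1 * 1) \<in> V (g \<otimes> g)" by (rule V_mult[OF gG gG 1 1])
  then have "pr 1 \<in> V (g \<otimes> g)" by simp
  moreover have "pr 1 \<noteq> pr 0" using proj_const_eq_0_iff[of p q r 1] by (simp add: const_simps)
  ultimately have "g \<otimes> g = g" using V_indep2[OF _ gG _ _ 1, of "g \<otimes> g"] gG by blast
  then have "g = \<one>" using gG by simp
  then show ?thesis using 1 by simp
qed

text \<open>The determinant is linear in its first argument, so some homogeneous component of
  \<open>u\<close> keeps it nonzero.\<close>

lemma homogeneous_replacement:
  assumes "det3 u v t \<noteq> 0"
  obtains u' g where "g \<in> carrier G" "pr (lin u') \<in> V g" "det3 u' v t \<noteq> 0"
proof -
  obtain T b where T: "finite T" "T \<subseteq> carrier G" "\<And>i. i \<in> T \<Longrightarrow> pr (b i) \<in> skew_degree p q r 1 \<inter> V i"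
    "pr (lin u) = pr (sum b T)" using degree_decomp[OF lin_in_skew_degree] by blast
  have "\<forall>i\<in>T. \<exists>w. pr (b i) = pr (lin w)" using T(3) skew_degree_1E by blast
  from bchoice[OF this] obtain w where w: "\<forall>i\<in>T. pr (b i) = pr (lin (w i))" by (rule exE)
  have "sum b T - (\<Sum>i\<in>T. lin (w i)) \<in> skew_ideal p q r"
    unfolding sum_subtractf[symmetric] using w by (intro skew_ideal_sum) (simp add: proj_eq_iff)
  then have "pr (sum b T) = pr (\<Sum>i\<in>T. lin (w i))" by (simp add: proj_eq_iff)
  with T(4) have "pr (lin u) = pr (\<Sum>i\<in>T. lin (w i))" by (rule trans)
  then have u: "u = (\<lambda>x. \<Sum>i\<in>T. w i x)" by (simp add: lin_sum proj_lin_eq_iff)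
  have "(\<Sum>i\<in>T. det3 (w i) v t) \<noteq> 0" using assms unfolding u det3_sum_left .
  then obtain g where "g \<in> T" "det3 (w g) v t \<noteq> 0" by (meson sum.neutral)
  then show ?thesis using that[of g "w g"] T w by fastforce
qed

text \<open>Steinitz exchange: rotating the determinant brings the next unit vector to the front for
  replacement.\<close>

lemma homogeneous_basis:
  obtains P d where "det3 (P X1) (P X2) (P X3) \<noteq> 0" "\<And>i. d i \<in> carrier G" "\<And>i. pr (lin (P i)) \<in> V (d i)"
proof -
  have "det3 (unit_vec X1) (unit_vec X2) (unit_vec X3) \<noteq> (0 :: 'k)"
    by (simp add: det3_def unit_vec_def)
  then obtain u a where u: "a \<in> carrier G" "pr (lin u) \<in> V a" "det3 u (unit_vec X2) (unit_vec X3) \<noteq> 0"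
    by (rule homogeneous_replacement)
  then have "det3 (unit_vec X2) (unit_vec X3) u \<noteq> 0" by (simp add: det3_rotate[of u])
  then obtain v b where v: "b \<in> carrier G" "pr (lin v) \<in> V b" "det3 v (unit_vec X3) u \<noteq> 0"
    by (rule homogeneous_replacement)
  then have "det3 (unit_vec X3) u v \<noteq> 0" by (simp add: det3_rotate[of v])
  then obtain t c where t: "c \<in> carrier G" "pr (lin t) \<in> V c" "det3 t u v \<noteq> 0"
    by (rule homogeneous_replacement)
  then have "det3 u v t \<noteq> 0" by (simp add: det3_rotate[of t])
  then show ?thesis
    using that[of "\<lambda>i. case i of X1 \<Rightarrow> u | X2 \<Rightarrow> v | X3 \<Rightarrow> t" "\<lambda>i. case i of X1 \<Rightarrow> a | X2 \<Rightarrow> b | X3 \<Rightarrow> c"] u v t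
    by (auto split: gen.split)
qed

end

section \<open>Homogeneity of the superpotential\<close>

lemma qrel_sum:
  assumes "\<And>i. i \<in> S \<Longrightarrow> qrel p q r (m i)"
  shows "qrel p q r (\<lambda>x y. \<Sum>i\<in>S. c i * m i x y)"
  using assms unfolding qrel_def
  by (auto simp: sum_distrib_left intro!: sum.cong sum.neutral)

lemma dual_basis:
  fixes P :: "gen \<Rightarrow> gen \<Rightarrow> 'k::field"
  assumes "det3 (P X1) (P X2) (P X3) \<noteq> 0"
  obtains e where "\<And>i j. (\<Sum>x\<in>UNIV. P i x * e j x) = (if i = j then 1 else 0)"
    "\<And>x y. (\<Sum>i\<in>UNIV. P i x * e i y) = (if x = y then 1 else 0)"
    "det3 (e X1) (e X2) (e X3) \<noteq> 0"
proof -
  let ?D = "det3 (P X1) (P X2) (P X3)"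
  \<comment> \<open>\<open>cp\<close> is the cross product, so \<open>f\<close> is the dual basis
    multiplied by the determinant.\<close>
  define cp where "cp u v x = (case x of X1 \<Rightarrow> u X2 * v X3 - u X3 * v X2 | X2 \<Rightarrow> u X3 * v X1 - u X1 * v X3
    | X3 \<Rightarrow> u X1 * v X2 - u X2 * v X1)" for u v :: "gen \<Rightarrow> 'k" and x
  define f where "f i = (case i of X1 \<Rightarrow> cp (P X2) (P X3) | X2 \<Rightarrow> cp (P X3) (P X1) | X3 \<Rightarrow> cp (P X1) (P X2))" for i
  have 1: "(\<Sum>x\<in>UNIV. P i x * f j x) = (if i = j then ?D else 0)" for i j
    by (cases i; cases j) (simp_all add: sum_gen f_def cp_def det3_def algebra_simps)
  have 2: "(\<Sum>i\<in>UNIV. P i x * f i y) = (if x = y then ?D else 0)" for x y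
    by (cases x; cases y) (simp_all add: sum_gen f_def cp_def det3_def algebra_simps)
  have 3: "det3 (f X1) (f X2) (f X3) = ?D * ?D"
    by (simp add: f_def cp_def det3_def algebra_simps)
  define c where "c = 1 / ?D"
  have c: "c * ?D = 1" "c \<noteq> 0" using assms by (simp_all add: c_def)
  define e where "e i x = c * f i x" for i x
  have "det3 (e X1) (e X2) (e X3) = c * c * c * det3 (f X1) (f X2) (f X3)"
    by (simp add: e_def det3_def algebra_simps)
  then have "det3 (e X1) (e X2) (e X3) \<noteq> 0" using 3 assms c(2) by simp
  moreover have "(\<Sum>x\<in>UNIV. P i x * e j x) = (if i = j then 1 else 0)" for i j
  proof -
    have "(\<Sum>x\<in>UNIV. P i x * e j x) = c * (\<Sum>x\<in>UNIV. P i x * f j x)"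
      by (simp add: e_def sum_distrib_left mult.left_commute)
    then show ?thesis using c(1) by (simp add: 1)
  qed
  moreover have "(\<Sum>i\<in>UNIV. P i x * e i y) = (if x = y then 1 else 0)" for x y
  proof -
    have "(\<Sum>i\<in>UNIV. P i x * e i y) = c * (\<Sum>i\<in>UNIV. P i x * f i y)"
      by (simp add: e_def sum_distrib_left mult.left_commute)
    then show ?thesis using c(1) by (simp add: 2)
  qed
  ultimately show ?thesis using that by blast
qed

text \<open>The superpotential belongs to V \<otimes> R; the next lemma is its counterpart for R
  \<otimes> V.\<close>

lemma qdet_unit_right: "qrel p q r (\<lambda>x y. qdet p q r u (unit_vec x) (unit_vec y))"
  if "r \<noteq> 0" "p \<noteq> 0" "q \<noteq> 0"
  using that by (simp add: qrel_def qdet_def unit_vec_def)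

lemma qdet_unit_left: "qrel p q r (\<lambda>x y. qdet p q r (unit_vec x) (unit_vec y) t)"
  if "r \<noteq> 0" "p \<noteq> 0" "q \<noteq> 0"
  using that by (simp add: qrel_def qdet_def unit_vec_def)

lemma qdet_expand: "qdet p q r u v t =
  (\<Sum>c\<in>UNIV. (\<Sum>b\<in>UNIV. (\<Sum>a\<in>UNIV. qdet p q r (unit_vec a) (unit_vec b) (unit_vec c) * u a) * v b) * t c)"
  by (simp add: sum_gen qdet_def unit_vec_def algebra_simps)

lemma qdet_lin2: "(\<Sum>j\<in>(UNIV :: gen set). qdet p q r u (f j) t * g j) = qdet p q r u (\<lambda>x. \<Sum>j\<in>UNIV. g j * f j x) t"
  by (simp add: sum_gen qdet_def algebra_simps)

lemma qdet_lin3: "(\<Sum>j\<in>(UNIV :: gen set). qdet p q r u v (f j) * g j) = qdet p q r u v (\<lambda>x. \<Sum>j\<in>UNIV. g j * f j x)"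
  by (simp add: sum_gen qdet_def algebra_simps)

lemma qdet_lin1: "(\<Sum>j\<in>(UNIV :: gen set). qdet p q r (f j) u v * g j) = qdet p q r (\<lambda>x. \<Sum>j\<in>UNIV. g j * f j x) u v"
  by (simp add: sum_gen qdet_def algebra_simps)

text \<open>The intersection of \<open>R \<otimes> V\<close> and \<open>V \<otimes> R\<close> is spanned by the superpotential.\<close>

lemma superpotential_unique:
  fixes X :: "gen \<Rightarrow> gen \<Rightarrow> gen \<Rightarrow> 'k::field"
  assumes nz: "p \<noteq> 0" "q \<noteq> 0" "r \<noteq> 0"
    and right: "\<And>a. qrel p q r (\<lambda>b c. X a b c)" and left: "\<And>c. qrel p q r (\<lambda>a b. X a b c)"
  shows "X a b c = X X3 X2 X1 * qdet p q r (unit_vec a) (unit_vec b) (unit_vec c)"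
proof -
  note R1 = right[of X1, unfolded qrel_def] and R2 = right[of X2, unfolded qrel_def] and R3 = right[of X3, unfolded qrel_def]
  note L1 = left[of X1, unfolded qrel_def] and L2 = left[of X2, unfolded qrel_def] and L3 = left[of X3, unfolded qrel_def]
  have bb: "X a b b = 0" "X b b a = 0" for a b
    using R1 R2 R3 L1 L2 L3 by (cases a; cases b; simp)+
  have aba: "X a b a = 0" for a b
    using bb[of X1] bb[of X2] bb[of X3] R1 R2 R3 L1 L2 L3 nz by (cases a; cases b) auto
  have 1: "X X2 X3 X1 = - r * X X3 X2 X1" using L1 by blast
  have 2: "X X3 X1 X2 = - p * X X3 X2 X1" using R3 by blast
  have 3: "X X2 X1 X3 = - q * X X2 X3 X1" using R2 by blast
  have 4: "X X1 X3 X2 = - q * X X3 X1 X2" using L2 by blast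
  have 5: "X X1 X2 X3 = - r * X X1 X3 X2" using R1 by blast
  show ?thesis
    by (cases a; cases b; cases c) (simp_all add: bb aba qdet_def unit_vec_def 5 4 3 2 1)
qed

context skew_refined_grading begin

text \<open>A relation is zero in the algebra. Grouping its monomials
  \<open>lin (P i) * lin (P j)\<close> by degree writes zero as a sum of homogeneous elements of
  distinct degrees, so each group is again a relation.\<close>

lemma mask_relation:
  assumes P: "\<And>i. d i \<in> carrier G" "\<And>i. pr (lin (P i)) \<in> V (d i)"
    and rel: "qrel p q r (congr P m)"
  shows "qrel p q r (congr P (\<lambda>i j. if d i \<otimes> d j = g then m i j else 0))"
proof -
  define t where "t i j = const (m i j) * (lin (P i) * lin (P j))" for i j
  have tV: "pr (t i j) \<in> V (d i \<otimes> d j)" for i j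
    unfolding t_def using P by (intro V_smult V_mult) simp_all
  define S where "S g = {ij \<in> UNIV. d (fst ij) \<otimes> d (snd ij) = g}" for g
  define b where "b g = (\<Sum>ij\<in>S g. t (fst ij) (snd ij))" for g
  define T where "T = (\<lambda>ij. d (fst ij) \<otimes> d (snd ij)) ` UNIV"
  have T: "finite T" "T \<subseteq> carrier G" using P by (auto simp: T_def)
  have "sum b T = (\<Sum>ij\<in>UNIV. t (fst ij) (snd ij))"
    unfolding b_def S_def by (rule sum.group) (auto simp: T_def)
  also have "\<dots> = (\<Sum>i\<in>UNIV. \<Sum>j\<in>UNIV. t i j)"
    by (simp add: sum.cartesian_product UNIV_Times_UNIV[symmetric] case_prod_unfold del: UNIV_Times_UNIV)
  also have "\<dots> = quad (congr P m)" unfolding quad_congr t_def ..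
  finally have "pr (sum b T) = pr 0" using rel by (simp add: proj_eq_iff quad_in_skew_ideal_iff)
  moreover have "pr (b g) \<in> V g" if "g \<in> T" for g
    unfolding b_def
  proof (rule V_sum)
    show "pr (t (fst ij) (snd ij)) \<in> V g" if "ij \<in> S g" for ij
      using tV[of "fst ij" "snd ij"] that by (simp add: S_def)
  qed (use that T in blast)
  ultimately have 1: "pr (b g) = pr 0" if "g \<in> T" using V_indep[OF T] that by blast
  have "b g = quad (congr P (\<lambda>i j. if d i \<otimes> d j = g then m i j else 0))"
  proof -
    have "b g = (\<Sum>ij\<in>UNIV. if d (fst ij) \<otimes> d (snd ij) = g then t (fst ij) (snd ij) else 0)"
      unfolding b_def S_def by (rule sum.inter_filter) simp
    also have "\<dots> = (\<Sum>i\<in>UNIV. \<Sum>j\<in>UNIV. if d i \<otimes> d j = g then t i j else 0)"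
      by (simp add: sum.cartesian_product UNIV_Times_UNIV[symmetric] case_prod_unfold del: UNIV_Times_UNIV)
    also have "\<dots> = quad (congr P (\<lambda>i j. if d i \<otimes> d j = g then m i j else 0))"
      unfolding quad_congr t_def by (intro sum.cong refl) (simp add: const_simps)
    finally show ?thesis .
  qed
  moreover have "b g = 0" if "g \<notin> T"
  proof -
    have "S g = {}" using that unfolding S_def T_def by blast
    then show ?thesis by (simp add: b_def)
  qed
  ultimately have "quad (congr P (\<lambda>i j. if d i \<otimes> d j = g then m i j else 0)) \<in> skew_ideal p q r"
    using 1 skew_ideal_zero by (cases "g \<in> T") (simp_all add: proj_eq_iff)
  then show ?thesis by (simp add: quad_in_skew_ideal_iff)
qed

text \<open>Restricting the form to index triples of total degree \<open>g\<close> restricts each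
  slice to pairs of one degree, so by \<open>mask_relation\<close> the result lies in both V
  \<otimes> R and R \<otimes> V and is a multiple of the form itself. For a degree \<open>g\<close>
  that occurs the multiple is nonzero, hence no other degree occurs.\<close>

lemma superpotential_homogeneous:
  fixes P e :: "gen \<Rightarrow> gen \<Rightarrow> 'k" and d :: "gen \<Rightarrow> 'a"
  assumes nz: "p \<noteq> 0" "q \<noteq> 0" "r \<noteq> 0"
    and P: "\<And>i. d i \<in> carrier G" "\<And>i. pr (lin (P i)) \<in> V (d i)"
    and dual: "\<And>i j. (\<Sum>x\<in>UNIV. P i x * e j x) = (if i = j then 1 else 0)"
      "\<And>x y. (\<Sum>i\<in>UNIV. P i x * e i y) = (if x = y then 1 else 0)"
  obtains g0 where "\<And>i j k. qdet p q r (e i) (e j) (e k) \<noteq> 0 \<Longrightarrow> d i \<otimes> d j \<otimes> d k = g0"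
proof -
  define w where "w i j k = qdet p q r (e i) (e j) (e k)" for i j k
  have unit: "(\<lambda>x. \<Sum>j\<in>UNIV. P j y * e j x) = unit_vec y" for y
    by (rule ext) (simp add: dual(2) unit_vec_def eq_commute)
  have rel_right: "qrel p q r (congr P (w i))" for i
  proof -
    have "congr P (w i) x y = (\<Sum>j\<in>UNIV. (\<Sum>k\<in>UNIV. w i j k * P k y) * P j x)" for x y
      by (simp add: congr_def sum_gen algebra_simps)
    then have "congr P (w i) x y = qdet p q r (e i) (unit_vec x) (unit_vec y)" for x y
      by (simp add: w_def qdet_lin3 qdet_lin2 unit)
    then have "congr P (w i) = (\<lambda>x y. qdet p q r (e i) (unit_vec x) (unit_vec y))" by (intro ext)
    then show ?thesis using qdet_unit_right[OF nz(3,1,2)] by simp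
  qed
  have rel_left: "qrel p q r (congr P (\<lambda>i j. w i j k))" for k
  proof -
    have "congr P (\<lambda>i j. w i j k) x y = (\<Sum>i\<in>UNIV. (\<Sum>j\<in>UNIV. w i j k * P j y) * P i x)" for x y
      by (simp add: congr_def sum_gen algebra_simps)
    then have "congr P (\<lambda>i j. w i j k) x y = qdet p q r (unit_vec x) (unit_vec y) (e k)" for x y
      by (simp add: w_def qdet_lin2 qdet_lin1 unit)
    then have "congr P (\<lambda>i j. w i j k) = (\<lambda>x y. qdet p q r (unit_vec x) (unit_vec y) (e k))" by (intro ext)
    then show ?thesis using qdet_unit_left[OF nz(3,1,2)] by simp
  qed
  have main: "\<exists>\<kappa>. \<forall>i j k. (if d i \<otimes> d j \<otimes> d k = g then w i j k else 0) = \<kappa> * w i j k" if g: "g \<in> carrier G" for g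
  proof -
    define wd where "wd i j k = (if d i \<otimes> d j \<otimes> d k = g then w i j k else 0)" for i j k
    \<comment> \<open>\<open>X\<close> is the restricted form written in the original generators,
      where \<open>superpotential_unique\<close> applies; \<open>contract\<close> undoes the change
      of basis.\<close>
    define X where "X a b c = (\<Sum>k\<in>UNIV. (\<Sum>j\<in>UNIV. (\<Sum>i\<in>UNIV. wd i j k * P i a) * P j b) * P k c)" for a b c
    have "qrel p q r (congr P (wd i))" for i
    proof -
      have "wd i = (\<lambda>j k. if d j \<otimes> d k = inv (d i) \<otimes> g then w i j k else 0)"
        using P(1) g by (auto simp: wd_def fun_eq_iff m_assoc inv_solve_left)
      then show ?thesis using mask_relation[OF P rel_right] by simp
    qed
    moreover have "(\<lambda>b c. X a b c) = (\<lambda>b c. \<Sum>i\<in>UNIV. P i a * congr P (wd i) b c)" for a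
      by (intro ext) (simp add: X_def congr_def sum_gen algebra_simps)
    ultimately have right: "qrel p q r (\<lambda>b c. X a b c)" for a
      using qrel_sum[of UNIV p q r "\<lambda>i. congr P (wd i)" "\<lambda>i. P i a"] by simp
    have "qrel p q r (congr P (\<lambda>i j. wd i j k))" for k
    proof -
      have "(\<lambda>i j. wd i j k) = (\<lambda>i j. if d i \<otimes> d j = g \<otimes> inv (d k) then w i j k else 0)"
        using P(1) g by (auto simp: wd_def fun_eq_iff inv_solve_right)
      then show ?thesis using mask_relation[OF P rel_left] by simp
    qed
    moreover have "(\<lambda>a b. X a b c) = (\<lambda>a b. \<Sum>k\<in>UNIV. P k c * congr P (\<lambda>i j. wd i j k) a b)" for c
      by (intro ext) (simp add: X_def congr_def sum_gen algebra_simps)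
    ultimately have left: "qrel p q r (\<lambda>a b. X a b c)" for c
      using qrel_sum[of UNIV p q r "\<lambda>k. congr P (\<lambda>i j. wd i j k)" "\<lambda>k. P k c"] by simp
    have X: "X a b c = X X3 X2 X1 * qdet p q r (unit_vec a) (unit_vec b) (unit_vec c)" for a b c
      by (rule superpotential_unique[OF nz right left])
    have contract: "(\<Sum>x\<in>UNIV. (\<Sum>i\<in>UNIV. f i * P i x) * e j x) = f j" for f j
    proof -
      have "(\<Sum>x\<in>UNIV. (\<Sum>i\<in>UNIV. f i * P i x) * e j x) = (\<Sum>i\<in>UNIV. f i * (\<Sum>x\<in>UNIV. P i x * e j x))"
        by (simp add: sum_gen algebra_simps)
      also have "\<dots> = f j" unfolding dual(1) by (cases j) (simp_all add: sum_gen)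
      finally show ?thesis .
    qed
    have "wd i j k = X X3 X2 X1 * w i j k" for i j k
    proof -
      have "X X3 X2 X1 * w i j k = (\<Sum>c\<in>UNIV. (\<Sum>b\<in>UNIV. (\<Sum>a\<in>UNIV.
          (X X3 X2 X1 * qdet p q r (unit_vec a) (unit_vec b) (unit_vec c)) * e i a) * e j b) * e k c)"
        unfolding w_def by (subst qdet_expand) (simp only: sum_gen algebra_simps)
      also have "\<dots> = (\<Sum>c\<in>UNIV. (\<Sum>b\<in>UNIV. (\<Sum>a\<in>UNIV. X a b c * e i a) * e j b) * e k c)"
        unfolding X[symmetric] ..
      also have "\<dots> = (\<Sum>a\<in>UNIV. (\<Sum>b\<in>UNIV. (\<Sum>c\<in>UNIV. X a b c * e k c) * e j b) * e i a)"
        by (simp add: sum_gen algebra_simps)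
      also have "\<dots> = wd i j k" unfolding X_def contract ..
      finally show ?thesis by simp
    qed
    then show ?thesis unfolding wd_def by blast
  qed
  show ?thesis
  proof (cases "\<exists>i j k. w i j k \<noteq> 0")
    case True
    then obtain i j k where 1: "w i j k \<noteq> 0" by blast
    define g where "g = d i \<otimes> d j \<otimes> d k"
    obtain \<kappa> where \<kappa>: "\<And>i j k. (if d i \<otimes> d j \<otimes> d k = g then w i j k else 0) = \<kappa> * w i j k"
      using main[of g] P(1) unfolding g_def by blast
    have "\<kappa> \<noteq> 0" using \<kappa>[of i j k] 1 by (auto simp: g_def)
    then have "d i \<otimes> d j \<otimes> d k = g" if "w i j k \<noteq> 0" for i j k
      using \<kappa>[of i j k] that by (auto split: if_splits)
    then show ?thesis using that unfolding w_def by blast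
  next
    case False
    then show ?thesis using that unfolding w_def by blast
  qed
qed

end

section \<open>The degrees of a homogeneous basis generate the group\<close>

lemma unit_vec_combination:
  assumes "\<And>x y. (\<Sum>i\<in>UNIV. P i x * e i y) = (if x = y then 1 else (0::'k::field))"
  shows "var y = (\<Sum>i\<in>UNIV. const (e i y) * lin (P i))"
proof -
  have "(\<lambda>z. if z = y then 1 else 0) = (\<lambda>z. \<Sum>i\<in>UNIV. e i y * P i z)"
    using assms[of _ y] by (simp add: mult.commute)
  then show ?thesis by (simp add: var_lin const_lin lin_sum)
qed

context skew_refined_grading begin

text \<open>For a subgroup \<open>H\<close> containing the degrees of a homogeneous basis, this
  predicate holds of every element; faithfulness then shows that those degrees generate
  \<open>G\<close>.\<close>

definition supported :: "'a set \<Rightarrow> 'k free_alg \<Rightarrow> bool" where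
  "supported H f \<longleftrightarrow> (\<exists>T b. finite T \<and> T \<subseteq> H \<and> (\<forall>g\<in>T. pr (b g) \<in> V g) \<and> pr f = pr (sum b T))"

lemma supported_single:
  assumes "g \<in> H" "pr f \<in> V g" shows "supported H f"
  unfolding supported_def by (intro exI[of _ "{g}"] exI[of _ "\<lambda>_. f"]) (use assms in auto)

lemma supported_add:
  assumes "H \<subseteq> carrier G" "supported H f" "supported H f'" shows "supported H (f + f')"
proof -
  obtain T b where T: "finite T" "T \<subseteq> H" "\<forall>g\<in>T. pr (b g) \<in> V g" "pr f = pr (sum b T)"
    using assms(2) unfolding supported_def by blast
  obtain T' b' where T': "finite T'" "T' \<subseteq> H" "\<forall>g\<in>T'. pr (b' g) \<in> V g" "pr f' = pr (sum b' T')"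
    using assms(3) unfolding supported_def by blast
  define c where "c g = (if g \<in> T then b g else 0)" for g
  define c' where "c' g = (if g \<in> T' then b' g else 0)" for g
  have "sum c (T \<union> T') = sum b T" "sum c' (T \<union> T') = sum b' T'"
    using T(1) T'(1) by (simp_all add: c_def c'_def sum.If_cases Int_absorb1 Int_absorb2 flip: Int_def)
  then have *: "(f + f') - (\<Sum>g\<in>T \<union> T'. c g + c' g) = (f - sum b T) + (f' - sum b' T')"
    by (simp add: sum.distrib)
  have "(f + f') - (\<Sum>g\<in>T \<union> T'. c g + c' g) \<in> skew_ideal p q r"
    unfolding * using T(4) T'(4) by (intro skew_ideal_add) (simp_all add: proj_eq_iff)
  then have "pr (f + f') = pr (\<Sum>g\<in>T \<union> T'. c g + c' g)" by (simp add: proj_eq_iff)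
  moreover have "pr (c g + c' g) \<in> V g" if "g \<in> T \<union> T'" for g
  proof -
    have g: "g \<in> carrier G" using that T T' assms(1) by blast
    show ?thesis using T(3) T'(3) V_zero[OF g] by (intro V_add[OF g]) (simp_all add: c_def c'_def)
  qed
  ultimately show ?thesis
    unfolding supported_def using T T' by (intro exI[of _ "T \<union> T'"] exI[of _ "\<lambda>g. c g + c' g"]) auto
qed

lemma supported_sum:
  assumes "subgroup H G" "\<And>i. i \<in> S \<Longrightarrow> supported H (f i)" shows "supported H (sum f S)"
proof -
  have 0: "supported H 0" using subgroup.one_closed[OF assms(1)] V_zero by (intro supported_single[of "\<one>"]) auto
  show ?thesis
    using assms(2) by (induction S rule: infinite_finite_induct) (simp_all add: 0 supported_add subgroup.subset[OF assms(1)])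
qed

lemma supported_mult:
  assumes H: "subgroup H G" "supported H f" and h: "h \<in> H" "pr f' \<in> V h" shows "supported H (f' * f)"
proof -
  obtain T b where T: "finite T" "T \<subseteq> H" "\<forall>g\<in>T. pr (b g) \<in> V g" "pr f = pr (sum b T)"
    using H(2) unfolding supported_def by blast
  have HG: "H \<subseteq> carrier G" by (rule subgroup.subset[OF H(1)])
  have "supported H (\<Sum>g\<in>T. f' * b g)"
  proof (rule supported_sum[OF H(1)])
    fix g assume "g \<in> T"
    then show "supported H (f' * b g)"
      using T HG h subgroup.m_closed[OF H(1)] by (intro supported_single[of "h \<otimes> g"] V_mult) auto
  qed
  moreover have "pr (f' * f) = pr (\<Sum>g\<in>T. f' * b g)"
    using T(4) skew_ideal_mult(1)[of "f - sum b T" p q r f'] by (simp add: proj_eq_iff sum_distrib_left right_diff_distrib)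
  ultimately show ?thesis unfolding supported_def by simp
qed

text \<open>Words are built letter by letter from homogeneous linear forms with degrees in
  \<open>H\<close>; the empty word relies on \<open>one_in_V_one\<close>.\<close>

lemma all_supported:
  assumes H: "subgroup H G" and P: "\<And>i. d i \<in> H" "\<And>i. pr (lin (P i)) \<in> V (d i)"
    and var: "\<And>y. var y = (\<Sum>i\<in>UNIV. const (e i y) * lin (P i))"
  shows "supported H f"
proof -
  have HG: "H \<subseteq> carrier G" by (rule subgroup.subset[OF H])
  have *: "supported H (Poly_Mapping.single (Word xs) a)" for xs a
  proof (induction xs)
    case Nil
    have "Poly_Mapping.single (Word []) a = const a * 1" by (simp add: const_def word_zero)
    moreover have "pr (const a * 1) \<in> V \<one>" using one_in_V_one by (intro V_smult) simp_all
    ultimately show ?case using subgroup.one_closed[OF H] by (intro supported_single[of "\<one>"]) simp_all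
  next
    case (Cons x xs)
    have "Poly_Mapping.single (Word (x # xs)) a = var x * Poly_Mapping.single (Word xs) a"
      by (simp add: var_def mult_single)
    also have "\<dots> = (\<Sum>i\<in>UNIV. (const (e i x) * lin (P i)) * Poly_Mapping.single (Word xs) a)"
      unfolding var by (simp only: sum_distrib_right)
    also have "supported H \<dots>"
      using P HG by (intro supported_sum[OF H] supported_mult[OF H Cons P(1)] V_smult) auto
    finally show ?case .
  qed
  show ?thesis
  proof (induction f rule: poly_mapping_additive_induct)
    case zero
    show ?case using *[of "[]" 0] by simp
  next
    case (single u a)
    show ?case using *[of "letters u" a] by simp
  qed (rule supported_add[OF HG])
qed

text \<open>A nonzero element of a degree outside \<open>H\<close> would equal a sum of components
  with degrees in \<open>H\<close>; bringing it to the other side contradicts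
  \<open>V_indep\<close>.\<close>

lemma support_subset:
  assumes H: "subgroup H G" "\<And>f. supported H f" and g: "g \<in> carrier G" "V g \<noteq> {\<zero>\<^bsub>skew_poly_ring p q r\<^esub>}"
  shows "g \<in> H"
proof (rule ccontr)
  assume "g \<notin> H"
  obtain f where f: "pr f \<in> V g" "pr f \<noteq> pr 0"
    using g V_zero[OF g(1)] V_subset[OF g(1)] unfolding skew_poly_ring_simps by blast
  obtain T b where T: "finite T" "T \<subseteq> H" "\<forall>g\<in>T. pr (b g) \<in> V g" "pr f = pr (sum b T)"
    using H(2)[of f] unfolding supported_def by blast
  have gT: "g \<notin> T" using T(2) \<open>g \<notin> H\<close> by blast
  define c where "c x = (if x = g then - f else b x)" for x
  have "sum c T = sum b T" using gT by (intro sum.cong) (auto simp: c_def)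
  then have "sum c (insert g T) = - (f - sum b T)" using T(1) gT by (simp add: c_def)
  then have "pr (sum c (insert g T)) = pr 0"
    using T(4) skew_ideal_minus[of "f - sum b T" p q r] by (simp add: proj_eq_iff)
  then have "pr (c g) = pr 0"
    by (rule V_indep[rotated 3])
      (use T gT g V_neg[OF g(1) f(1)] subgroup.subset[OF H(1)] in \<open>auto simp: c_def\<close>)
  then show False using f(2) skew_ideal_minus[of "- f" p q r] by (simp add: c_def proj_eq_iff)
qed

text \<open>Used twice to show that \<open>G\<close> is abelian if the degrees commute: first the
  centralizer of the degrees is all of \<open>G\<close>, and then, the degrees being central, so is
  the center.\<close>

lemma centralizer_subgroup:
  assumes "S \<subseteq> carrier G"
  shows "subgroup {x \<in> carrier G. \<forall>y\<in>S. x \<otimes> y = y \<otimes> x} G"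
proof
  fix x assume x: "x \<in> {x \<in> carrier G. \<forall>y\<in>S. x \<otimes> y = y \<otimes> x}"
  show "inv x \<in> {x \<in> carrier G. \<forall>y\<in>S. x \<otimes> y = y \<otimes> x}"
  proof safe
    fix y assume y: "y \<in> S"
    then have xy: "x \<otimes> y = y \<otimes> x" "x \<in> carrier G" "y \<in> carrier G" using x assms by auto
    have "inv x \<otimes> y = inv x \<otimes> (y \<otimes> x) \<otimes> inv x" using xy(2,3) by (simp add: m_assoc)
    also have "\<dots> = y \<otimes> inv x" unfolding xy(1)[symmetric] using xy(2,3) by (simp add: m_assoc[symmetric])
    finally show "inv x \<otimes> y = y \<otimes> inv x" .
  qed (use x in simp)
next
  fix x z assume x: "x \<in> {x \<in> carrier G. \<forall>y\<in>S. x \<otimes> y = y \<otimes> x}" "z \<in> {x \<in> carrier G. \<forall>y\<in>S. x \<otimes> y = y \<otimes> x}"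
  show "x \<otimes> z \<in> {x \<in> carrier G. \<forall>y\<in>S. x \<otimes> y = y \<otimes> x}"
  proof safe
    fix y assume y: "y \<in> S"
    then have c: "x \<in> carrier G" "z \<in> carrier G" "y \<in> carrier G" "x \<otimes> y = y \<otimes> x" "z \<otimes> y = y \<otimes> z" using x assms by auto
    have "x \<otimes> z \<otimes> y = x \<otimes> (z \<otimes> y)" using c(1-3) by (simp add: m_assoc)
    also have "\<dots> = (x \<otimes> y) \<otimes> z" unfolding c(5) using c(1-3) by (simp add: m_assoc)
    also have "\<dots> = y \<otimes> (x \<otimes> z)" unfolding c(4) using c(1-3) by (simp add: m_assoc)
    finally show "x \<otimes> z \<otimes> y = y \<otimes> (x \<otimes> z)" .
  qed (use x in simp)
qed (use assms in auto)

end

theorem nonabelian_grading_params: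
  fixes p q r :: "'k::field_char_0" and T :: "'g itself"
  assumes nz: "p \<noteq> 0" "q \<noteq> 0" "r \<noteq> 0" and "has_nonabelian_grading T p q r"
  shows "params p q r"
proof -
  obtain G :: "'g monoid" and V where G: "group_grading G (skew_poly_ring p q r) V" "faithful_grading G (skew_poly_ring p q r) V"
    "refines_grading G (skew_poly_ring p q r) V (skew_degree p q r)" "\<not> comm_group G"
    using assms(4) unfolding has_nonabelian_grading_def by blast
  interpret group G using G(1) unfolding group_grading_def by blast
  interpret skew_refined_grading G p q r V
    using G by unfold_locales
  obtain P d where P: "det3 (P X1) (P X2) (P X3) \<noteq> 0" "\<And>i. d i \<in> carrier G" "\<And>i. pr (lin (P i)) \<in> V (d i)"
    using homogeneous_basis by blast
  obtain e where e: "\<And>i j. (\<Sum>x\<in>UNIV. P i x * e j x) = (if i = j then 1 else 0)"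
    "\<And>x y. (\<Sum>i\<in>UNIV. P i x * e i y) = (if x = y then 1 else 0)"
    "det3 (e X1) (e X2) (e X3) \<noteq> 0" using dual_basis[OF P(1)] by blast
  obtain g0 where g0: "\<And>i j k. qdet p q r (e i) (e j) (e k) \<noteq> 0 \<Longrightarrow> d i \<otimes>\<^bsub>G\<^esub> d j \<otimes>\<^bsub>G\<^esub> d k = g0"
    using superpotential_homogeneous[OF nz P(2,3) e(1,2)] by blast
  have full: "carrier G \<subseteq> H" if H: "subgroup H G" "\<And>i. d i \<in> H" for H
  proof -
    have "supported H f" for f
      by (rule all_supported[OF H P(3) unit_vec_combination[OF e(2)]])
    then have "{g \<in> carrier G. V g \<noteq> {\<zero>\<^bsub>skew_poly_ring p q r\<^esub>}} \<subseteq> H"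
      using support_subset[OF H(1)] by blast
    then have "generate G {g \<in> carrier G. V g \<noteq> {\<zero>\<^bsub>skew_poly_ring p q r\<^esub>}} \<subseteq> H"
      by (rule generate_subgroup_incl[OF _ H(1)])
    then show ?thesis using G(2) unfolding faithful_grading_def by simp
  qed
  have "\<exists>i j. d i \<otimes>\<^bsub>G\<^esub> d j \<noteq> d j \<otimes>\<^bsub>G\<^esub> d i"
  proof (rule ccontr)
    assume comm: "\<not> ?thesis"
    have central: "carrier G \<subseteq> {x \<in> carrier G. \<forall>y\<in>range d. x \<otimes>\<^bsub>G\<^esub> y = y \<otimes>\<^bsub>G\<^esub> x}"
      using comm P(2) by (intro full centralizer_subgroup) auto
    have "carrier G \<subseteq> {x \<in> carrier G. \<forall>y\<in>carrier G. x \<otimes>\<^bsub>G\<^esub> y = y \<otimes>\<^bsub>G\<^esub> x}"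
    proof (rule full[OF centralizer_subgroup[OF subset_refl]])
      show "d i \<in> {x \<in> carrier G. \<forall>y\<in>carrier G. x \<otimes>\<^bsub>G\<^esub> y = y \<otimes>\<^bsub>G\<^esub> x}" for i
        using P(2)[of i] subsetD[OF central] by fastforce
    qed
    then have "comm_group G" by (intro group_comm_groupI) auto
    then show False using G(4) by blast
  qed
  then interpret graded_qdet G p q r e d g0
    using nz e(3) P(2) g0 by unfold_locales auto
  show ?thesis by (rule parameters)
qed

section \<open>Construction of gradings\<close>

text \<open>The algebra endomorphism of the free algebra that sends \<open>var i\<close> to
  \<open>lin (P i)\<close>; it expresses a polynomial in the new basis through the
  generators.\<close>

definition substitute :: "(gen \<Rightarrow> gen \<Rightarrow> 'k) \<Rightarrow> 'k::field free_alg \<Rightarrow> 'k free_alg" where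
  "substitute P f = (\<Sum>w\<in>Poly_Mapping.keys f. const (lookup f w) * prod_list (map (\<lambda>i. lin (P i)) (letters w)))"

lemma substitute_superset:
  assumes "finite S" "Poly_Mapping.keys f \<subseteq> S"
  shows "substitute P f = (\<Sum>w\<in>S. const (lookup f w) * prod_list (map (\<lambda>i. lin (P i)) (letters w)))"
  unfolding substitute_def using assms
  by (intro sum.mono_neutral_left) (auto simp: not_in_keys_iff_lookup_eq_zero const_simps)

lemma substitute_add: "substitute P (f + g) = substitute P f + substitute P g"
  using keys_add[of f g]
  by (simp add: substitute_superset[of "Poly_Mapping.keys f \<union> Poly_Mapping.keys g"] lookup_add const_simps distrib_right sum.distrib)

lemma substitute_zero [simp]: "substitute P 0 = 0"
  by (simp add: substitute_def)

lemma substitute_diff: "substitute P (f - g) = substitute P f - substitute P g"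
  using substitute_add[of P "f - g" g] by simp

lemma substitute_sum: "substitute P (sum f S) = (\<Sum>i\<in>S. substitute P (f i))"
  by (induction S rule: infinite_finite_induct) (simp_all add: substitute_add)

lemma substitute_single: "substitute P (Poly_Mapping.single w a) = const a * prod_list (map (\<lambda>i. lin (P i)) (letters w))"
  by (subst substitute_superset[of "{w}"]) simp_all

lemma substitute_mult: "substitute P (f * g) = substitute P f * substitute P g"
proof (induction f rule: poly_mapping_additive_induct)
  case (single u a)
  show ?case
  proof (induction g rule: poly_mapping_additive_induct)
    case (single v b)
    obtain us vs where uv: "u = Word us" "v = Word vs" by (metis word.exhaust)
    define x y where "x = prod_list (map (\<lambda>i. lin (P i)) us)" and "y = prod_list (map (\<lambda>i. lin (P i)) vs)"
    have "const a * const b * (x * y) = const a * x * (const b * y)"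
      using const_commute[of b x] by (simp add: mult.assoc[symmetric]) (simp add: mult.assoc)
    then show ?case by (simp add: mult_single substitute_single uv const_simps x_def y_def)
  qed (simp_all add: distrib_left substitute_add)
qed (simp_all add: distrib_right substitute_add)

lemma substitute_var: "substitute P (var i) = lin (P i)"
  by (simp add: var_def substitute_single const_simps)

lemma substitute_const: "substitute P (const c) = const c"
  by (simp add: const_def substitute_single word_zero)

lemma quad_var: "quad m = (\<Sum>i\<in>UNIV. \<Sum>j\<in>UNIV. const (m i j) * (var i * var j))"
  unfolding quad_def by (intro sum.cong refl) (simp add: var_def const_def mult_single word_zero)

lemma lin_var: "lin v = (\<Sum>i\<in>UNIV. const (v i) * var i)"
  unfolding lin_def by (intro sum.cong refl) (simp add: var_def const_def mult_single word_zero)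

lemma substitute_quad: "substitute P (quad m) = quad (congr P m)"
  unfolding quad_var[of m] quad_congr by (simp add: substitute_sum substitute_mult substitute_const substitute_var)

lemma substitute_lin: "substitute P (lin v) = lin (\<lambda>x. \<Sum>i\<in>UNIV. v i * P i x)"
  unfolding lin_var[of v] by (simp add: substitute_sum substitute_mult substitute_const substitute_var const_lin lin_sum)

lemma single_Cons: "Poly_Mapping.single (Word (x # xs)) a = var x * Poly_Mapping.single (Word xs) a"
  by (simp add: var_def mult_single)

lemma substitute_inverse:
  assumes "\<And>i x. (\<Sum>j\<in>UNIV. Q i j * P j x) = (if x = i then 1 else 0)"
  shows "substitute P (substitute Q f) = f"
proof (induction f rule: poly_mapping_additive_induct)
  case (single u a)
  have "substitute P (substitute Q (Poly_Mapping.single (Word xs) a)) = Poly_Mapping.single (Word xs) a" for xs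
  proof (induction xs)
    case Nil
    show ?case by (simp add: substitute_single substitute_const) (simp add: const_def word_zero)
  next
    case (Cons x xs)
    have "substitute P (substitute Q (var x)) = var x"
      by (simp add: substitute_var substitute_lin assms) (simp add: var_lin)
    then show ?case using Cons by (simp add: single_Cons substitute_mult)
  qed
  then show ?case by (metis word.exhaust)
qed (simp_all add: substitute_add)

text \<open>Comparing coefficients in \<open>substitute_inverse\<close> avoids a computation with
  fourfold sums.\<close>

lemma congr_inverse:
  assumes "\<And>i x. (\<Sum>j\<in>UNIV. Q i j * P j x) = (if x = i then 1 else 0)"
  shows "congr P (congr Q m) = m"
proof (intro ext)
  fix x y
  have "quad (congr P (congr Q m)) = quad m" by (simp add: substitute_inverse[OF assms] flip: substitute_quad)
  from arg_cong[OF this, of "\<lambda>f. lookup f (Word [x, y])"] show "congr P (congr Q m) x y = m x y"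
    by (simp add: lookup_quad)
qed

definition homog :: "nat \<Rightarrow> 'k::zero free_alg \<Rightarrow> bool" where
  "homog n f \<longleftrightarrow> (\<forall>w\<in>Poly_Mapping.keys f. length (letters w) = n)"

lemma homog_add: "homog n f \<Longrightarrow> homog n g \<Longrightarrow> homog n (f + g)"
  using keys_add[of f g] unfolding homog_def by blast

lemma homog_diff: "homog n f \<Longrightarrow> homog n g \<Longrightarrow> homog n (f - g)" for f :: "'k::ab_group_add free_alg"
  unfolding homog_def by (metis diff_zero in_keys_iff lookup_minus)

lemma homog_sum: "(\<And>i. i \<in> S \<Longrightarrow> homog n (f i)) \<Longrightarrow> homog n (sum f S)"
  by (induction S rule: infinite_finite_induct) (simp_all add: homog_add, simp_all add: homog_def)

lemma homog_mult: "homog n f \<Longrightarrow> homog m g \<Longrightarrow> homog (n + m) (f * g)"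
  using keys_mult[of f g] unfolding homog_def by (fastforce simp: plus_word_def)

lemma homog_const: "homog 0 (const c)"
  by (simp add: homog_def const_def word_zero)

lemma homog_lin: "homog 1 (lin v)"
  unfolding homog_def
proof
  fix w assume "w \<in> Poly_Mapping.keys (lin v)"
  then show "length (letters w) = 1"
    by (cases w) (auto simp: in_keys_iff lookup_lin split: list.splits)
qed

lemma homog_subst: "homog n f \<Longrightarrow> homog n (substitute P f)"
  unfolding substitute_def
proof (rule homog_sum)
  fix w assume "homog n f" "w \<in> Poly_Mapping.keys f"
  then have n: "n = 0 + length (letters w)" by (simp add: homog_def)
  have "homog (length xs) (prod_list (map (\<lambda>i. lin (P i)) xs))" for xs
  proof (induction xs)
    case Nil
    show ?case by (simp add: homog_def word_zero)
  next
    case (Cons x xs)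
    then show ?case using homog_mult[OF homog_lin, of "length xs" _ "P x"] by simp
  qed
  then show "homog n (const (lookup f w) * prod_list (map (\<lambda>i. lin (P i)) (letters w)))"
    unfolding n by (intro homog_mult homog_const)
qed

lemma skew_degree_homog: "skew_degree p q r n = proj p q r ` {f. homog n f}"
  by (simp add: skew_degree_proj homog_def)

section \<open>From gradings of the free algebra to gradings of the quotient\<close>

locale word_degree = group G for G (structure) +
  fixes d :: "gen \<Rightarrow> 'a"
  assumes d_closed [simp]: "d i \<in> carrier G"
begin

definition wdeg :: "gen list \<Rightarrow> 'a" where
  "wdeg xs = foldr (\<lambda>i g. d i \<otimes> g) xs \<one>"

lemma wdeg_simps [simp]: "wdeg [] = \<one>" "wdeg (x # xs) = d x \<otimes> wdeg xs"
  by (simp_all add: wdeg_def)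

lemma wdeg_closed [simp]: "wdeg xs \<in> carrier G"
  by (induction xs) simp_all

lemma wdeg_append [simp]: "wdeg (xs @ ys) = wdeg xs \<otimes> wdeg ys"
  by (induction xs) (simp_all add: m_assoc)

definition hom_deg :: "'a \<Rightarrow> 'k::zero free_alg \<Rightarrow> bool" where
  "hom_deg g f \<longleftrightarrow> (\<forall>w\<in>Poly_Mapping.keys f. wdeg (letters w) = g)"

definition component :: "'a \<Rightarrow> 'k::comm_monoid_add free_alg \<Rightarrow> 'k free_alg" where
  "component g f = (\<Sum>w\<in>{w \<in> Poly_Mapping.keys f. wdeg (letters w) = g}. Poly_Mapping.single w (lookup f w))"

lemma lookup_component: "lookup (component g f) w = (if wdeg (letters w) = g then lookup f w else 0)"
proof -
  have "lookup (component g f) w = (\<Sum>w'\<in>{w \<in> Poly_Mapping.keys f. wdeg (letters w) = g}. if w' = w then lookup f w else 0)"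
    unfolding component_def lookup_sum by (rule sum.cong) (auto simp: lookup_single when_def)
  also have "\<dots> = (if wdeg (letters w) = g then lookup f w else 0)"
    by (auto simp: not_in_keys_iff_lookup_eq_zero)
  finally show ?thesis .
qed

lemma component_zero [simp]: "component g 0 = 0"
  by (rule poly_mapping_eqI) (simp add: lookup_component)

lemma component_add: "component g (f + f') = component g f + component g f'"
  by (rule poly_mapping_eqI) (simp add: lookup_component lookup_add)

lemma component_sum: "component g (sum f S) = (\<Sum>i\<in>S. component g (f i))"
  by (induction S rule: infinite_finite_induct) (simp_all add: component_add)

lemma component_single: "component g (Poly_Mapping.single w a) = (if wdeg (letters w) = g then Poly_Mapping.single w a else 0)"
  by (rule poly_mapping_eqI) (auto simp: lookup_component lookup_single when_def)

lemma component_single_mult: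
  assumes "g \<in> carrier G"
  shows "component g (Poly_Mapping.single u a * f) = Poly_Mapping.single u a * component (inv (wdeg (letters u)) \<otimes> g) f"
proof (induction f rule: poly_mapping_additive_induct)
  case (single v b)
  obtain us vs where uv: "u = Word us" "v = Word vs" by (metis word.exhaust)
  have "wdeg us \<otimes> wdeg vs = g \<longleftrightarrow> wdeg vs = inv (wdeg us) \<otimes> g"
    using assms by (metis inv_solve_left wdeg_closed)
  then show ?case by (simp add: component_single mult_single uv)
qed (simp_all add: component_add distrib_left)

lemma component_mult_single:
  assumes "g \<in> carrier G"
  shows "component g (f * Poly_Mapping.single u a) = component (g \<otimes> inv (wdeg (letters u))) f * Poly_Mapping.single u a"
proof (induction f rule: poly_mapping_additive_induct)
  case (single v b)
  obtain us vs where uv: "u = Word us" "v = Word vs" by (metis word.exhaust)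
  have "wdeg vs \<otimes> wdeg us = g \<longleftrightarrow> wdeg vs = g \<otimes> inv (wdeg us)"
    using assms by (metis inv_solve_right wdeg_closed)
  then show ?case by (simp add: component_single mult_single uv)
qed (simp_all add: component_add distrib_right)

lemma hom_deg_component: "hom_deg g (component g f)"
  by (auto simp: hom_deg_def in_keys_iff lookup_component split: if_splits)

lemma component_hom_deg: "hom_deg g f \<Longrightarrow> component h f = (if h = g then f else 0)"
  by (rule poly_mapping_eqI) (auto simp: lookup_component hom_deg_def in_keys_iff)

lemma hom_deg_zero: "hom_deg g 0"
  by (simp add: hom_deg_def)

lemma hom_deg_diff: "hom_deg g f \<Longrightarrow> hom_deg g f' \<Longrightarrow> hom_deg g (f - f')" for f :: "'k::ab_group_add free_alg"
  unfolding hom_deg_def by (metis diff_zero in_keys_iff lookup_minus)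

lemma hom_deg_mult: "hom_deg g f \<Longrightarrow> hom_deg h f' \<Longrightarrow> hom_deg (g \<otimes> h) (f * f')"
  using keys_mult[of f f'] unfolding hom_deg_def by (fastforce simp: plus_word_def)

lemma hom_deg_const: "hom_deg \<one> (const c)"
  by (simp add: hom_deg_def const_def word_zero)

lemma hom_deg_var: "hom_deg (d i) (var i)"
  by (simp add: hom_deg_def var_def)

lemma sum_component:
  assumes "finite T" "(wdeg \<circ> letters) ` Poly_Mapping.keys f \<subseteq> T"
  shows "(\<Sum>g\<in>T. component g f) = f"
proof (rule poly_mapping_eqI)
  fix w
  have "lookup (\<Sum>g\<in>T. component g f) w = (\<Sum>g\<in>T. if wdeg (letters w) = g then lookup f w else 0)"
    by (simp add: lookup_sum lookup_component)
  also have "\<dots> = (if wdeg (letters w) \<in> T then lookup f w else 0)" using assms(1) by simp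
  also have "\<dots> = lookup f w" using assms(2) by (auto simp: image_subset_iff in_keys_iff)
  finally show "lookup (\<Sum>g\<in>T. component g f) w = lookup f w" .
qed

lemma homog_component: "homog n f \<Longrightarrow> homog n (component g f)"
  by (auto simp: homog_def in_keys_iff lookup_component split: if_splits)

lemma component_quad: "component g (quad m) = quad (\<lambda>i j. if d i \<otimes> d j = g then m i j else 0)"
  by (rule free_alg_eqI) (auto simp: lookup_component lookup_quad split: list.split)

end

text \<open>The assumption \<open>mask\<close> says that the relations, written in the basis \<open>P\<close>, form a graded
  subspace.\<close>

locale graded_presentation = word_degree G d for G :: "'a monoid" (structure) and d +
  fixes p q r :: "'k::field" and P Q :: "gen \<Rightarrow> gen \<Rightarrow> 'k"
  assumes QP: "\<And>i x. (\<Sum>j\<in>UNIV. Q i j * P j x) = (if x = i then 1 else 0)"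
    and PQ: "\<And>i x. (\<Sum>j\<in>UNIV. P i j * Q j x) = (if x = i then 1 else 0)"
    and mask: "\<And>m g. qrel p q r (congr P m) \<Longrightarrow> qrel p q r (congr P (\<lambda>i j. if d i \<otimes> d j = g then m i j else 0))"
    and generated: "carrier G = generate G (range d)"
begin

abbreviation "pr \<equiv> proj p q r"

definition V :: "'a \<Rightarrow> 'k free_alg set set" where
  "V g = {pr (substitute P f) | f. hom_deg g f}"

lemma substitute_PQ [simp]: "substitute P (substitute Q f) = f"
  by (rule substitute_inverse[OF QP])

lemma substitute_QP [simp]: "substitute Q (substitute P f) = f"
  by (rule substitute_inverse[OF PQ])

text \<open>The set \<open>K\<close> of polynomials whose components all map into the ideal is
  itself an ideal, since multiplication by a monomial only shifts degrees. By \<open>mask\<close> it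
  contains the relations, and minimality of the ideal finishes the proof.\<close>

lemma component_in_ideal:
  assumes "substitute P f \<in> skew_ideal p q r" and g: "g \<in> carrier G"
  shows "substitute P (component g f) \<in> skew_ideal p q r"
proof -
  let ?I = "skew_ideal p q r"
  define K where "K = {f. \<forall>g\<in>carrier G. substitute P (component g f) \<in> ?I}"
  have add: "f + f' \<in> K" if "f \<in> K" "f' \<in> K" for f f'
    using that by (simp add: K_def component_add substitute_add skew_ideal_add)
  have zero: "0 \<in> K" by (simp add: K_def skew_ideal_zero)
  have left: "h * f \<in> K" if "f \<in> K" for h f
  proof (induction h rule: poly_mapping_additive_induct)
    case (single u a)
    show ?case using that
      by (auto simp: K_def component_single_mult substitute_mult intro: skew_ideal_mult)
  qed (simp_all add: distrib_right add zero)
  have right: "f * h \<in> K" if "f \<in> K" for h f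
  proof (induction h rule: poly_mapping_additive_induct)
    case (single u a)
    show ?case using that
      by (auto simp: K_def component_mult_single substitute_mult intro: skew_ideal_mult)
  qed (simp_all add: distrib_left add zero)
  have "?I \<subseteq> {h. substitute Q h \<in> K}"
  proof (rule skew_ideal_minimal)
    fix m assume "qrel p q r m"
    then have "qrel p q r (congr P (\<lambda>i j. if d i \<otimes> d j = g then congr Q m i j else 0))" for g
      by (intro mask) (simp add: congr_inverse[OF QP])
    then show "quad m \<in> {h. substitute Q h \<in> K}"
      by (simp add: K_def substitute_quad component_quad quad_in_skew_ideal_iff)
  qed (use zero add left right in \<open>auto simp: substitute_add substitute_mult\<close>)
  then have "substitute Q (substitute P f) \<in> K" using assms(1) by blast
  then show ?thesis using g by (simp add: K_def)
qed

text \<open>Each summand is lifted to the free algebra in its own degree. The sum of the lifts maps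
  into the ideal, and its component of degree \<open>i\<close> is the single lift
  \<open>f i\<close>.\<close>

lemma V_indep:
  assumes "finite T" "T \<subseteq> carrier G" "\<And>i. i \<in> T \<Longrightarrow> pr (b i) \<in> V i" "pr (sum b T) = pr 0" "i \<in> T"
  shows "pr (b i) = pr 0"
proof -
  have "\<forall>i\<in>T. \<exists>f. pr (b i) = pr (substitute P f) \<and> hom_deg i f"
    using assms(3) unfolding V_def by blast
  from bchoice[OF this] obtain f where f: "\<forall>i\<in>T. pr (b i) = pr (substitute P (f i)) \<and> hom_deg i (f i)"
    by (rule exE)
  have "sum b T - substitute P (sum f T) \<in> skew_ideal p q r"
    unfolding substitute_sum sum_subtractf[symmetric] using f by (intro skew_ideal_sum) (simp add: proj_eq_iff)
  then have "sum b T - (sum b T - substitute P (sum f T)) \<in> skew_ideal p q r"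
    by (rule skew_ideal_diff[rotated]) (use assms(4) in \<open>simp add: proj_eq_iff\<close>)
  then have "substitute P (component i (sum f T)) \<in> skew_ideal p q r"
    using assms(2,5) by (intro component_in_ideal) auto
  moreover have "component i (sum f T) = (\<Sum>j\<in>T. if j = i then f i else 0)"
    unfolding component_sum using f component_hom_deg by (intro sum.cong) fastforce+
  ultimately have "substitute P (f i) \<in> skew_ideal p q r" using assms(1,5) by simp
  then have "pr (substitute P (f i)) = pr 0" by (simp add: proj_eq_iff)
  then show ?thesis using f assms(5) by simp
qed

lemma V_subset: "V g \<subseteq> range pr"
  unfolding V_def by blast

lemma V_zero: "pr 0 \<in> V g"
  unfolding V_def using hom_deg_zero by (auto intro!: exI[of _ 0])

lemma V_diff:
  assumes "pr f \<in> V g" "pr f' \<in> V g" shows "pr (f - f') \<in> V g"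
proof -
  obtain a where a: "pr f = pr (substitute P a)" "hom_deg g a" using assms(1) unfolding V_def by blast
  obtain b where b: "pr f' = pr (substitute P b)" "hom_deg g b" using assms(2) unfolding V_def by blast
  have "(f - f') - substitute P (a - b) = (f - substitute P a) - (f' - substitute P b)" by (simp add: substitute_diff)
  also have "\<dots> \<in> skew_ideal p q r" using a b by (intro skew_ideal_diff[of "f - substitute P a"]) (simp_all add: proj_eq_iff)
  finally have "pr (f - f') = pr (substitute P (a - b))" by (simp add: proj_eq_iff)
  then show ?thesis unfolding V_def using hom_deg_diff[OF a(2) b(2)] by blast
qed

lemma V_mult:
  assumes "x \<in> V g" "y \<in> V h" shows "x \<otimes>\<^bsub>skew_poly_ring p q r\<^esub> y \<in> V (g \<otimes> h)"
proof -
  obtain a where a: "x = pr (substitute P a)" "hom_deg g a" using assms(1) unfolding V_def by blast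
  obtain b where b: "y = pr (substitute P b)" "hom_deg h b" using assms(2) unfolding V_def by blast
  have "x \<otimes>\<^bsub>skew_poly_ring p q r\<^esub> y = pr (substitute P (a * b))" by (simp add: a b skew_poly_ring_simps substitute_mult)
  then show ?thesis unfolding V_def using hom_deg_mult[OF a(2) b(2)] by blast
qed

lemma V_smult:
  assumes "x \<in> V g" "g \<in> carrier G" shows "c \<odot>\<^bsub>skew_poly_ring p q r\<^esub> x \<in> V g"
proof -
  obtain a where a: "x = pr (substitute P a)" "hom_deg g a" using assms(1) unfolding V_def by blast
  have "c \<odot>\<^bsub>skew_poly_ring p q r\<^esub> x = pr (substitute P (const c * a))"
    by (simp add: a skew_poly_ring_simps substitute_mult substitute_const)
  then show ?thesis unfolding V_def using hom_deg_mult[OF hom_deg_const a(2)] assms(2) by force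
qed

lemma V_direct: "internal_direct_sum (skew_poly_ring p q r) (carrier G) V (range pr)"
proof (rule internal_direct_sumI)
  show "pr (b i) = pr 0" if "finite T" "T \<subseteq> carrier G" "\<And>i. i \<in> T \<Longrightarrow> pr (b i) \<in> V i"
    "pr (sum b T) = pr 0" "i \<in> T" for T b i
    using that by (rule V_indep)
  show "pr (f - f') \<in> V g" if "pr f \<in> V g" "pr f' \<in> V g" for g f f'
    using that by (rule V_diff)
  fix f
  let ?T = "(wdeg \<circ> letters) ` Poly_Mapping.keys (substitute Q f)"
  have "(\<Sum>g\<in>?T. component g (substitute Q f)) = substitute Q f" by (rule sum_component) simp_all
  then have "substitute P (\<Sum>g\<in>?T. component g (substitute Q f)) = f" by simp
  then have "pr f = pr (\<Sum>g\<in>?T. substitute P (component g (substitute Q f)))" by (simp add: substitute_sum)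
  moreover have "\<forall>g\<in>?T. pr (substitute P (component g (substitute Q f))) \<in> V g"
    unfolding V_def using hom_deg_component by blast
  moreover have "finite ?T" "?T \<subseteq> carrier G" by auto
  ultimately show "\<exists>T b. finite T \<and> T \<subseteq> carrier G \<and> (\<forall>i\<in>T. pr (b i) \<in> V i) \<and> pr f = pr (sum b T)"
    by (intro exI[of _ ?T] exI[of _ "\<lambda>g. substitute P (component g (substitute Q f))"] conjI)
qed (rule V_subset subset_refl V_zero)+

text \<open>Linear substitution and taking components preserve word length, so a representative of
  degree \<open>n\<close> decomposes within that degree.\<close>

lemma degree_direct:
  "internal_direct_sum (skew_poly_ring p q r) (carrier G) (\<lambda>g. skew_degree p q r n \<inter> V g) (skew_degree p q r n)"
proof (rule internal_direct_sumI)
  have zero: "pr 0 \<in> skew_degree p q r n"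
    unfolding skew_degree_homog by (rule imageI) (simp add: homog_def)
  then show "pr 0 \<in> skew_degree p q r n \<inter> V g" for g using V_zero by blast
  show "pr (f - f') \<in> skew_degree p q r n \<inter> V g"
    if fg: "pr f \<in> skew_degree p q r n \<inter> V g" "pr f' \<in> skew_degree p q r n \<inter> V g" for g f f'
  proof
    obtain a where a: "pr f = pr a" "homog n a" using fg(1) unfolding skew_degree_homog by blast
    obtain b where b: "pr f' = pr b" "homog n b" using fg(2) unfolding skew_degree_homog by blast
    have "(f - f') - (a - b) = (f - a) - (f' - b)" by simp
    also have "\<dots> \<in> skew_ideal p q r" using a b by (intro skew_ideal_diff[of "f - a"]) (simp_all add: proj_eq_iff)
    finally have "pr (f - f') = pr (a - b)" by (simp add: proj_eq_iff)
    then show "pr (f - f') \<in> skew_degree p q r n"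
      unfolding skew_degree_homog using homog_diff[OF a(2) b(2)] by blast
    show "pr (f - f') \<in> V g" using fg V_diff by blast
  qed
  show "\<exists>T b. finite T \<and> T \<subseteq> carrier G \<and> (\<forall>g\<in>T. pr (b g) \<in> skew_degree p q r n \<inter> V g) \<and> pr f = pr (sum b T)"
    if f: "pr f \<in> skew_degree p q r n" for f
  proof -
    obtain a where a: "pr f = pr a" "homog n a" using f unfolding skew_degree_homog by blast
    let ?T = "(wdeg \<circ> letters) ` Poly_Mapping.keys (substitute Q a)"
    have "(\<Sum>g\<in>?T. component g (substitute Q a)) = substitute Q a" by (rule sum_component) simp_all
    then have "substitute P (\<Sum>g\<in>?T. component g (substitute Q a)) = a" by simp
    then have "pr f = pr (\<Sum>g\<in>?T. substitute P (component g (substitute Q a)))" unfolding a(1) by (simp add: substitute_sum)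
    moreover have "\<forall>g\<in>?T. pr (substitute P (component g (substitute Q a))) \<in> skew_degree p q r n \<inter> V g"
    proof (intro ballI IntI)
      show "pr (substitute P (component g (substitute Q a))) \<in> V g" for g
        unfolding V_def using hom_deg_component by blast
      show "pr (substitute P (component g (substitute Q a))) \<in> skew_degree p q r n" for g
        unfolding skew_degree_homog by (intro imageI CollectI homog_subst homog_component a(2))
    qed
    moreover have "finite ?T" "?T \<subseteq> carrier G" by auto
    ultimately show ?thesis
      by (intro exI[of _ ?T] exI[of _ "\<lambda>g. substitute P (component g (substitute Q a))"] conjI)
  qed
  show "pr (b i) = pr 0" if "finite T" "T \<subseteq> carrier G" "\<And>i. i \<in> T \<Longrightarrow> pr (b i) \<in> skew_degree p q r n \<inter> V i"
    "pr (sum b T) = pr 0" "i \<in> T" for T b i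
    by (rule V_indep[of T b i]) (use that in auto)
qed (auto intro: subsetD[OF skew_degree_subset])

lemma V_submodule:
  assumes g: "g \<in> carrier G" shows "submodule (V g) univ_ring (skew_poly_ring p q r)"
proof (intro submodule.intro subgroup.intro submodule_axioms.intro)
  have el: "\<exists>f. x = pr f" if "x \<in> V g" for x using that unfolding V_def by blast
  have neg: "pr (- f) \<in> V g" if "pr f \<in> V g" for f
    using V_diff[OF V_zero that] by simp
  show "V g \<subseteq> carrier (add_monoid (skew_poly_ring p q r))"
    using V_subset by (simp add: skew_poly_ring_simps)
  show "x \<otimes>\<^bsub>add_monoid (skew_poly_ring p q r)\<^esub> y \<in> V g" if xy: "x \<in> V g" "y \<in> V g" for x y
  proof -
    obtain f f' where f: "x = pr f" "y = pr f'" using el xy by blast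
    then show ?thesis using V_diff[of f g "- f'"] neg[of f'] xy by (simp add: skew_poly_ring_simps)
  qed
  show "\<one>\<^bsub>add_monoid (skew_poly_ring p q r)\<^esub> \<in> V g" using V_zero by (simp add: skew_poly_ring_simps)
  show "inv\<^bsub>add_monoid (skew_poly_ring p q r)\<^esub> x \<in> V g" if x: "x \<in> V g" for x
  proof -
    obtain f where f: "x = pr f" using el x by blast
    then show ?thesis using neg x a_inv_skew_poly_ring[of p q r f] by (simp add: a_inv_def)
  qed
qed (use V_smult g in auto)

lemma var_degree: "pr (lin (P i)) \<in> V (d i)"
  unfolding V_def using hom_deg_var[of i] substitute_var[of P i] by (metis (mono_tags, lifting) mem_Collect_eq)

lemma P_nonzero: "pr (lin (P i)) \<noteq> pr 0"
proof
  assume "pr (lin (P i)) = pr 0"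
  then have "P i x = 0" for x using lin_in_skew_ideal[of "P i"] by (simp add: proj_eq_iff)
  then show False using PQ[of i i] by simp
qed

lemma faithful: "faithful_grading G (skew_poly_ring p q r) V"
  unfolding faithful_grading_def skew_poly_ring_simps
proof
  let ?S = "{g \<in> carrier G. V g \<noteq> {pr 0}}"
  show "generate G ?S \<subseteq> carrier G" by (rule generate_incl) blast
  have "range d \<subseteq> ?S" using var_degree P_nonzero by fastforce
  then show "carrier G \<subseteq> generate G ?S" using generated mono_generate by blast
qed

lemma has_grading:
  assumes "d i \<otimes> d j \<noteq> d j \<otimes> d i"
  shows "has_nonabelian_grading TYPE('a) p q r"
proof -
  have "group_grading G (skew_poly_ring p q r) V"
    unfolding group_grading_def skew_poly_ring_simps(1)
    using V_submodule V_direct V_mult is_group by blast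
  moreover have "refines_grading G (skew_poly_ring p q r) V (skew_degree p q r)"
    unfolding refines_grading_def using degree_direct by blast
  moreover have "\<not> comm_group G"
    using assms comm_monoid.m_comm[of G "d i" "d j"] by (auto simp: comm_group_def)
  ultimately show ?thesis
    unfolding has_nonabelian_grading_def using faithful by blast
qed

end

text \<open>The affine group of the field with seven elements; \<open>7 * u + v\<close> encodes the map
  \<open>x \<mapsto> u * x + v\<close>.  It contains enough of the group presented by each of the four sets of
  homogeneous relations: a dihedral group, and the semidirect product of orders 7 and 3.\<close>

definition aff7 :: "nat monoid" where
  "aff7 = \<lparr>carrier = {n. 7 \<le> n \<and> n < 49},
     mult = (\<lambda>m n. 7 * (m div 7 * (n div 7) mod 7) + (m mod 7 + m div 7 * (n mod 7)) mod 7), one = 7\<rparr>"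

lemma aff7_simps: "carrier aff7 = {n. 7 \<le> n \<and> n < 49}"
  "m \<otimes>\<^bsub>aff7\<^esub> n = 7 * (m div 7 * (n div 7) mod 7) + (m mod 7 + m div 7 * (n mod 7)) mod 7" "\<one>\<^bsub>aff7\<^esub> = 7"
  by (simp_all add: aff7_def)

lemma aff7_carrierE:
  assumes "x \<in> carrier aff7" obtains u v where "x = 7 * u + v" "u \<in> {1,2,3,4,5,6}" "v < 7"
proof (rule that[of "x div 7" "x mod 7"])
  have "1 \<le> x div 7" "x div 7 < 7" using assms by (auto simp: aff7_simps)
  then show "x div 7 \<in> {1,2,3,4,5,6}" by auto
qed simp_all

lemma aff7_mult: "v < 7 \<Longrightarrow> v' < 7 \<Longrightarrow> (7 * u + v) \<otimes>\<^bsub>aff7\<^esub> (7 * u' + v') = 7 * (u * u' mod 7) + (v + u * v') mod 7"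
  by (simp add: aff7_simps)

lemma group_aff7: "group aff7"
proof (rule groupI)
  fix x y assume "x \<in> carrier aff7" "y \<in> carrier aff7"
  then obtain u v u' v' where x: "x = 7 * u + v" "u \<in> {1,2,3,4,5,6}" "v < 7" and y: "y = 7 * u' + v'" "u' \<in> {1,2,3,4,5,6}" "v' < 7"
    by (metis aff7_carrierE)
  have "1 \<le> u * u' mod 7" "u * u' mod 7 \<le> 6" using x(2) y(2) by auto
  moreover have "(v + u * v') mod 7 < 7" by simp
  ultimately show "x \<otimes>\<^bsub>aff7\<^esub> y \<in> carrier aff7"
    unfolding x(1) y(1) aff7_mult[OF x(3) y(3)] aff7_simps(1) mem_Collect_eq by linarith
next
  fix x y z assume "x \<in> carrier aff7" "y \<in> carrier aff7" "z \<in> carrier aff7"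
  then obtain u v u' v' u'' v'' where x: "x = 7 * u + v" "v < 7" and y: "y = 7 * u' + v'" "v' < 7"
    and z: "z = 7 * u'' + v''" "v'' < 7"
    by (metis aff7_carrierE)
  have "(u * u' mod 7) * u'' mod 7 = u * (u' * u'' mod 7) mod 7" by (simp add: mod_simps mult.assoc)
  moreover have "((v + u * v') mod 7 + (u * u' mod 7) * v'') mod 7 = (v + u * ((v' + u' * v'') mod 7)) mod 7"
  proof -
    have "((v + u * v') mod 7 + (u * u' mod 7) * v'') mod 7 = (v + u * v' + u * u' * v'') mod 7"
      by (metis mod_add_left_eq mod_add_right_eq mod_mult_left_eq)
    also have "\<dots> = (v + u * (v' + u' * v'')) mod 7" by (simp add: algebra_simps)
    also have "\<dots> = (v + u * ((v' + u' * v'') mod 7)) mod 7" by (metis mod_add_right_eq mod_mult_right_eq)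
    finally show ?thesis .
  qed
  ultimately show "x \<otimes>\<^bsub>aff7\<^esub> y \<otimes>\<^bsub>aff7\<^esub> z = x \<otimes>\<^bsub>aff7\<^esub> (y \<otimes>\<^bsub>aff7\<^esub> z)"
    unfolding x y z using x(2) y(2) z(2) by (simp add: aff7_mult)
next
  fix x assume "x \<in> carrier aff7"
  then obtain u v where x: "x = 7 * u + v" "u \<in> {1,2,3,4,5,6}" "v < 7" by (rule aff7_carrierE)
  show "\<one>\<^bsub>aff7\<^esub> \<otimes>\<^bsub>aff7\<^esub> x = x" using x by (auto simp: aff7_simps)
  have "\<exists>u'\<in>{1,2,3,4,5,6}. u' * u mod 7 = 1" using x(2) by auto
  then obtain u' where u': "u' \<in> {1,2,3,4,5,6}" "u' * u mod 7 = 1" by blast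
  \<comment> \<open>The inverse of u x + v has translation part - u' v; \<open>7 - u'\<close> stands
    for - u' modulo 7, as natural numbers have no negatives.\<close>
  define w where "w = (7 - u') * v mod 7"
  have "(w + u' * v) mod 7 = ((7 - u') * v + u' * v) mod 7" by (simp add: w_def mod_simps)
  also have "(7 - u') * v + u' * v = 7 * v" using u'(1) by auto
  finally have "(w + u' * v) mod 7 = 0" by simp
  then have "(7 * u' + w) \<otimes>\<^bsub>aff7\<^esub> x = 7"
    unfolding x(1) using x(3) u'(2) by (subst aff7_mult) (simp_all add: w_def)
  moreover have "7 * u' + w \<in> carrier aff7"
  proof -
    have "1 \<le> u'" "u' \<le> 6" "w < 7" using u'(1) by (auto simp: w_def)
    then show ?thesis unfolding aff7_simps(1) mem_Collect_eq by linarith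
  qed
  ultimately show "\<exists>y\<in>carrier aff7. y \<otimes>\<^bsub>aff7\<^esub> x = \<one>\<^bsub>aff7\<^esub>" by (auto simp: aff7_simps(3))
qed (simp add: aff7_simps)

text \<open>The grading group is the subgroup generated by the degrees, which makes the grading
  faithful whichever elements of \<open>aff7\<close> are chosen.\<close>

lemma aff7_grading:
  fixes d :: "gen \<Rightarrow> nat"
  assumes d: "\<And>i. d i \<in> carrier aff7"
    and QP: "\<And>i x. (\<Sum>j\<in>UNIV. Q i j * P j x) = (if x = i then 1 else 0)"
    and PQ: "\<And>i x. (\<Sum>j\<in>UNIV. P i j * Q j x) = (if x = i then 1 else 0)"
    and mask: "\<And>m g. qrel p q r (congr P m) \<Longrightarrow>
      qrel p q r (congr P (\<lambda>i j. if d i \<otimes>\<^bsub>aff7\<^esub> d j = g then m i j else 0))"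
    and "d i \<otimes>\<^bsub>aff7\<^esub> d j \<noteq> d j \<otimes>\<^bsub>aff7\<^esub> d i"
  shows "has_nonabelian_grading TYPE(nat) p q r"
proof -
  interpret aff: group aff7 by (rule group_aff7)
  have dc: "range d \<subseteq> carrier aff7" using d by blast
  let ?H = "generate aff7 (range d)"
  let ?G = "aff7\<lparr>carrier := ?H\<rparr>"
  have sub: "subgroup ?H aff7" by (rule aff.generate_is_subgroup[OF dc])
  interpret graded_presentation ?G d p q r P Q
  proof (intro graded_presentation.intro word_degree.intro)
    show "group ?G" by (rule subgroup.subgroup_is_group[OF sub group_aff7])
    show "word_degree_axioms ?G d"
      by unfold_locales (simp add: generate.incl)
    have "range d \<subseteq> ?H" by (auto intro: generate.incl)
    then have "generate ?G (range d) = ?H" by (rule aff.generate_consistent[OF _ sub])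
    then show "graded_presentation_axioms ?G d p q r P Q"
      using QP PQ mask by unfold_locales simp_all
  qed
  show ?thesis by (rule has_grading[of i j]) (use assms(5) in simp)
qed

section \<open>Gradings of the three families with signs\<close>

definition half_basis :: "gen \<Rightarrow> gen \<Rightarrow> 'k::field" where
  "half_basis i x = (case i of X1 \<Rightarrow> (case x of X1 \<Rightarrow> 1 | X2 \<Rightarrow> 1 | X3 \<Rightarrow> 0)
     | X2 \<Rightarrow> (case x of X1 \<Rightarrow> 1 | X2 \<Rightarrow> -1 | X3 \<Rightarrow> 0) | X3 \<Rightarrow> (case x of X1 \<Rightarrow> 0 | X2 \<Rightarrow> 0 | X3 \<Rightarrow> 1))"

definition half_inverse :: "gen \<Rightarrow> gen \<Rightarrow> 'k::field" where
  "half_inverse i x = (case i of X1 \<Rightarrow> (case x of X1 \<Rightarrow> 1/2 | X2 \<Rightarrow> 1/2 | X3 \<Rightarrow> 0)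
     | X2 \<Rightarrow> (case x of X1 \<Rightarrow> 1/2 | X2 \<Rightarrow> -1/2 | X3 \<Rightarrow> 0) | X3 \<Rightarrow> (case x of X1 \<Rightarrow> 0 | X2 \<Rightarrow> 0 | X3 \<Rightarrow> 1))"

lemma half_inverse:
  "(\<Sum>j\<in>UNIV. half_inverse i j * half_basis j x) = (if x = i then 1 else (0::'k::field_char_0))"
  "(\<Sum>j\<in>UNIV. half_basis i j * half_inverse j x) = (if x = i then 1 else (0::'k::field_char_0))"
  by (cases i; cases x; simp add: sum_gen half_basis_def half_inverse_def)+

lemma eq_neg_pair:
  fixes a b c d :: "'k::field_char_0"
  shows "a + b = c + d \<and> a - b = c - d \<longleftrightarrow> a = c \<and> b = d"
proof
  assume *: "a + b = c + d \<and> a - b = c - d"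
  then have "(a + b) + (a - b) = (c + d) + (c - d)" "(a + b) - (a - b) = (c + d) - (c - d)" by simp_all
  then have "2 * a = 2 * c" "2 * b = 2 * d" by (simp_all add: algebra_simps)
  then show "a = c \<and> b = d" by simp
qed auto

text \<open>In the basis y1 = x1 + x2, y2 = x1 - x2, y3 = x3 the relations become, in this order of
  parameters: y1^2 = y2^2, y3 y2 = q y1 y3, y3 y1 = q y2 y3; then y1^2 = y2^2, y3 y1 = q y1 y3, y3
  y2 = q y2 y3; and y2 y1 = y1 y2, y3 y2 = q y1 y3, y3 y1 = q y2 y3.\<close>

lemma half_basis_qrel:
  fixes m :: "gen \<Rightarrow> gen \<Rightarrow> 'k::field_char_0"
  shows "qrel (-1) q (-q) (congr half_basis m) \<longleftrightarrow> m X1 X2 = 0 \<and> m X2 X1 = 0 \<and> m X3 X3 = 0 \<and>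
      m X2 X2 = - m X1 X1 \<and> m X1 X3 = - q * m X3 X2 \<and> m X2 X3 = - q * m X3 X1"
    "qrel (-1) q q (congr half_basis m) \<longleftrightarrow> m X1 X2 = 0 \<and> m X2 X1 = 0 \<and> m X3 X3 = 0 \<and>
      m X2 X2 = - m X1 X1 \<and> m X1 X3 = - q * m X3 X1 \<and> m X2 X3 = - q * m X3 X2"
    "qrel 1 q (-q) (congr half_basis m) \<longleftrightarrow> m X1 X1 = 0 \<and> m X2 X2 = 0 \<and> m X3 X3 = 0 \<and>
      m X1 X2 = - m X2 X1 \<and> m X1 X3 = - q * m X3 X2 \<and> m X2 X3 = - q * m X3 X1"
proof -
  let ?c = "congr half_basis m"
  have c: "?c X1 X1 = (m X1 X1 + m X2 X2) + (m X1 X2 + m X2 X1)"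
    "?c X2 X2 = (m X1 X1 + m X2 X2) - (m X1 X2 + m X2 X1)"
    "?c X1 X2 = (m X1 X1 - m X2 X2) + (m X2 X1 - m X1 X2)"
    "?c X2 X1 = (m X1 X1 - m X2 X2) - (m X2 X1 - m X1 X2)"
    "?c X1 X3 = m X1 X3 + m X2 X3" "?c X2 X3 = m X1 X3 - m X2 X3"
    "?c X3 X1 = m X3 X1 + m X3 X2" "?c X3 X2 = m X3 X1 - m X3 X2" "?c X3 X3 = m X3 X3"
    by (simp_all add: congr_def sum_gen half_basis_def)
  have 1: "?c X1 X1 = 0 \<and> ?c X2 X2 = 0 \<longleftrightarrow> m X2 X2 = - m X1 X1 \<and> m X1 X2 = - m X2 X1"
    using eq_neg_pair[of "m X1 X1 + m X2 X2" "m X1 X2 + m X2 X1" 0 0] unfolding c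
    by (simp add: eq_neg_iff_add_eq_0 add.commute)
  have 2: "?c X1 X2 = ?c X2 X1 \<longleftrightarrow> m X2 X1 = m X1 X2"
    unfolding c by (simp add: diff_eq_eq eq_diff_eq algebra_simps)
  have 3: "?c X1 X2 = - ?c X2 X1 \<longleftrightarrow> m X1 X1 = m X2 X2"
    unfolding c by (simp add: diff_eq_eq eq_diff_eq algebra_simps)
  have 4: "?c X1 X3 = - q * ?c X3 X1 \<and> ?c X2 X3 = q * ?c X3 X2 \<longleftrightarrow> m X1 X3 = - q * m X3 X2 \<and> m X2 X3 = - q * m X3 X1"
    using eq_neg_pair[of "m X1 X3" "m X2 X3" "- q * m X3 X2" "- q * m X3 X1"] unfolding c
    by (simp add: algebra_simps)
  have 5: "?c X1 X3 = - q * ?c X3 X1 \<and> ?c X2 X3 = - q * ?c X3 X2 \<longleftrightarrow> m X1 X3 = - q * m X3 X1 \<and> m X2 X3 = - q * m X3 X2"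
    using eq_neg_pair[of "m X1 X3" "m X2 X3" "- q * m X3 X1" "- q * m X3 X2"] unfolding c
    by (simp add: algebra_simps)
  have z: "x = 0" if "x = - x" for x :: 'k using that by (simp add: eq_neg_iff_add_eq_0)
  show "qrel (-1) q (-q) ?c \<longleftrightarrow> m X1 X2 = 0 \<and> m X2 X1 = 0 \<and> m X3 X3 = 0 \<and>
      m X2 X2 = - m X1 X1 \<and> m X1 X3 = - q * m X3 X2 \<and> m X2 X3 = - q * m X3 X1"
    using 1 2 4 z[of "m X1 X2"] c(9) unfolding qrel_def minus_minus mult_1 by auto
  show "qrel (-1) q q ?c \<longleftrightarrow> m X1 X2 = 0 \<and> m X2 X1 = 0 \<and> m X3 X3 = 0 \<and>
      m X2 X2 = - m X1 X1 \<and> m X1 X3 = - q * m X3 X1 \<and> m X2 X3 = - q * m X3 X2"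
    using 1 2 5 z[of "m X1 X2"] c(9) unfolding qrel_def minus_minus mult_1 by auto
  show "qrel 1 q (-q) ?c \<longleftrightarrow> m X1 X1 = 0 \<and> m X2 X2 = 0 \<and> m X3 X3 = 0 \<and>
      m X1 X2 = - m X2 X1 \<and> m X1 X3 = - q * m X3 X2 \<and> m X2 X3 = - q * m X3 X1"
    using 1 3 4 z[of "m X1 X1"] c(9) unfolding qrel_def minus_minus mult_minus1 by auto
qed

definition triple :: "nat \<Rightarrow> nat \<Rightarrow> nat \<Rightarrow> gen \<Rightarrow> nat" where
  "triple a b c i = (case i of X1 \<Rightarrow> a | X2 \<Rightarrow> b | X3 \<Rightarrow> c)"

lemma triple_simps [simp]: "triple a b c X1 = a" "triple a b c X2 = b" "triple a b c X3 = c"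
  by (simp_all add: triple_def)

lemma triple_carrier: "{a, b, c} \<subseteq> {n. 7 \<le> n \<and> n < 49} \<Longrightarrow> triple a b c i \<in> carrier aff7"
  by (cases i) (simp_all add: aff7_simps)

text \<open>The codes 42, 44 and 43 are the reflections -x, -x + 2 and -x + 1. The first two have
  equal squares, and the third exchanges them by conjugation, as the relations demand.\<close>

lemma grading_minus_one_minus:
  "has_nonabelian_grading TYPE(nat) (-1) q (- q)" for q :: "'k::field_char_0"
  by (rule aff7_grading[of "triple 42 44 43" half_inverse half_basis _ _ _ X1 X2, OF triple_carrier half_inverse])
    (auto simp: half_basis_qrel aff7_simps)

text \<open>Two noncommuting reflections, -x and -x + 1, have equal squares; the identity, with code
  7, commutes with both.\<close>

lemma grading_minus_one_plus:
  "has_nonabelian_grading TYPE(nat) (-1) q q" for q :: "'k::field_char_0"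
  by (rule aff7_grading[of "triple 42 43 7" half_inverse half_basis _ _ _ X1 X2, OF triple_carrier half_inverse])
    (auto simp: half_basis_qrel aff7_simps)

text \<open>The codes 8 and 13 are the commuting translations x + 1 and x - 1; conjugation by the
  reflection -x, with code 42, exchanges them.\<close>

lemma grading_one_minus:
  "has_nonabelian_grading TYPE(nat) 1 q (- q)" for q :: "'k::field_char_0"
  by (rule aff7_grading[of "triple 8 13 42" half_inverse half_basis _ _ _ X1 X3, OF triple_carrier half_inverse])
    (auto simp: half_basis_qrel aff7_simps)

section \<open>Gradings for the third roots of unity\<close>

lemma card_gen: "card (UNIV :: gen set) = 3"
  by (simp add: UNIV_gen)

text \<open>For a primitive third root of unity \<open>z\<close> this is the discrete Fourier
  transform of order three. Writing z^2 as \<open>- 1 - z\<close> gives the simplifier expressions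
  linear in \<open>z\<close> to aim at.\<close>

definition fourier :: "'k \<Rightarrow> gen \<Rightarrow> gen \<Rightarrow> 'k::field" where
  "fourier z i x = (case i of X1 \<Rightarrow> 1 | X2 \<Rightarrow> (case x of X1 \<Rightarrow> 1 | X2 \<Rightarrow> - 1 - z | X3 \<Rightarrow> z)
     | X3 \<Rightarrow> (case x of X1 \<Rightarrow> 1 | X2 \<Rightarrow> z | X3 \<Rightarrow> - 1 - z))"

text \<open>The transposed matrix with \<open>z\<close> replaced by its inverse, divided by 3;
  exchanging \<open>X2\<close> and \<open>X3\<close> performs that replacement.\<close>

definition fourier_inverse :: "'k \<Rightarrow> gen \<Rightarrow> gen \<Rightarrow> 'k::field" where
  "fourier_inverse z i x = fourier z (case x of X1 \<Rightarrow> X1 | X2 \<Rightarrow> X3 | X3 \<Rightarrow> X2) i / 3"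

lemma fourier_inverse:
  fixes z :: "'k::field_char_0"
  assumes z: "z * z = - 1 - z"
  shows "(\<Sum>j\<in>UNIV. fourier_inverse z i j * fourier z j x) = (if x = i then 1 else 0)"
    and "(\<Sum>j\<in>UNIV. fourier z i j * fourier_inverse z j x) = (if x = i then 1 else 0)"
proof -
  have third: "(\<Sum>j\<in>UNIV. f j / 3 * g j) = (\<Sum>j\<in>UNIV. f j * g j) / 3" "(\<Sum>j\<in>UNIV. f j * (g j / 3)) = (\<Sum>j\<in>UNIV. f j * g j) / 3"
    for f g :: "gen \<Rightarrow> 'k" by (simp_all add: sum_divide_distrib)
  show "(\<Sum>j\<in>UNIV. fourier_inverse z i j * fourier z j x) = (if x = i then 1 else 0)"
    unfolding fourier_inverse_def third
    by (cases i; cases x) (simp_all add: sum_gen fourier_def algebra_simps z card_gen)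
  show "(\<Sum>j\<in>UNIV. fourier z i j * fourier_inverse z j x) = (if x = i then 1 else 0)"
    unfolding fourier_inverse_def third
    by (cases i; cases x) (simp_all add: sum_gen fourier_def algebra_simps z card_gen)
qed

text \<open>In the Fourier basis the relations are y1^2 = y2 y3, y2^2 = y3 y1 and y3^2 = y1
  y2.\<close>

lemma fourier_qrel:
  fixes z :: "'k::field_char_0"
  assumes z: "z * z = - 1 - z"
  shows "qrel z (- 1 - z) z (congr (fourier z) m) \<longleftrightarrow>
    m X3 X2 = 0 \<and> m X1 X3 = 0 \<and> m X2 X1 = 0 \<and>
    m X2 X3 = - m X1 X1 \<and> m X3 X1 = - m X2 X2 \<and> m X1 X2 = - m X3 X3"
    (is "?L \<longleftrightarrow> ?R")
proof
  \<comment> \<open>The version of \<open>z\<close> for nested products, needed because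
    simplification associates products to the right.\<close>
  have z': "z * (z * x) = - x - z * x" for x
  proof -
    have "z * (z * x) = (z * z) * x" by (simp add: mult.assoc)
    then show ?thesis unfolding z by (simp add: algebra_simps)
  qed
  {
    assume ?R
    then have *: "congr (fourier z) m x y = m X1 X1 * (1 - fourier z X2 x * fourier z X3 y)
        + m X2 X2 * (fourier z X2 x * fourier z X2 y - fourier z X3 x)
        + m X3 X3 * (fourier z X3 x * fourier z X3 y - fourier z X2 y)" for x y
      by (simp add: congr_def sum_gen) (simp add: fourier_def algebra_simps)
    show ?L
      unfolding qrel_def * by (simp add: fourier_def algebra_simps z z')
  next
    assume L: ?L
    \<comment> \<open>Instead of solving nine equations for \<open>m\<close>, the inverse transform
      expresses \<open>m\<close> through its image \<open>c\<close>, whose entries are tied together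
      by the relations.\<close>
    define c where "c = congr (fourier z) m"
    have "congr (fourier_inverse z) c = m"
      unfolding c_def by (rule congr_inverse[OF fourier_inverse(2)[OF z]])
    then have m: "m i j = congr (fourier_inverse z) c i j" for i j by simp
    have c: "c X1 X1 = 0" "c X2 X2 = 0" "c X3 X3 = 0" "c X1 X2 = - z * c X2 X1"
      "c X1 X3 = (1 + z) * c X3 X1" "c X2 X3 = - z * c X3 X2"
      using L by (simp_all add: qrel_def c_def)
    have *: "m i j = (\<Sum>x\<in>UNIV. \<Sum>y\<in>UNIV. c x y * fourier z (case i of X1 \<Rightarrow> X1 | X2 \<Rightarrow> X3 | X3 \<Rightarrow> X2) x *
        fourier z (case j of X1 \<Rightarrow> X1 | X2 \<Rightarrow> X3 | X3 \<Rightarrow> X2) y) / 9" for i j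
      by (simp add: m congr_def fourier_inverse_def sum_divide_distrib)
    show ?R
      unfolding * by (simp add: sum_gen c fourier_def algebra_simps z z' add_divide_distrib[symmetric] minus_divide_left)
  }
qed

lemma primitive_third_root:
  fixes z :: "'k::field_char_0"
  shows "primitive_root 3 z \<longleftrightarrow> z^2 + z + 1 = 0"
proof
  assume z: "primitive_root 3 z"
  then have "z^3 = 1" "z \<noteq> 1" by (auto simp: primitive_root_def dest: spec[of _ 1])
  moreover have "(z - 1) * (z^2 + z + 1) = z^3 - 1"
    by (simp add: algebra_simps power2_eq_square power3_eq_cube)
  ultimately show "z^2 + z + 1 = 0" by simp
next
  assume z: "z^2 + z + 1 = 0"
  have 1: "z \<noteq> 1" using z by auto
  have "z^2 \<noteq> 1"
  proof
    assume "z^2 = 1"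
    then have "z = - 2" using z by (simp add: eq_neg_iff_add_eq_0 add.commute)
    then show False using \<open>z^2 = 1\<close> by simp
  qed
  then have "z ^ m \<noteq> 1" if "0 < m" "m < 3" for m
  proof -
    have "m = 1 \<or> m = 2" using that by linarith
    then show ?thesis using 1 \<open>z^2 \<noteq> 1\<close> by auto
  qed
  moreover have "z ^ 3 = 1"
  proof -
    have "(z - 1) * (z^2 + z + 1) = z^3 - 1"
      by (simp add: algebra_simps power2_eq_square power3_eq_cube)
    then show ?thesis using z by simp
  qed
  ultimately show "primitive_root 3 z" by (simp add: primitive_root_def)
qed

text \<open>The degrees have to satisfy d1^2 = d2 d3, d2^2 = d3 d1 and d3^2 = d1 d2. The codes 14,
  15 and 17 are 2x, 2x + 1 and 2x + 3, which do so modulo 7 and generate the nonabelian group of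
  order 21.\<close>

lemma grading_zeta:
  fixes z :: "'k::field_char_0"
  assumes "primitive_root 3 z"
  shows "has_nonabelian_grading TYPE(nat) z (z^2) z"
proof -
  have z0: "z^2 + z + 1 = 0" using assms by (simp add: primitive_third_root)
  have z2: "z^2 = - 1 - z"
  proof -
    have "z^2 = (z^2 + z + 1) - 1 - z" by simp
    then show ?thesis unfolding z0 by simp
  qed
  then have z: "z * z = - 1 - z" by (simp add: power2_eq_square)
  show ?thesis unfolding z2
    by (rule aff7_grading[of "triple 14 15 17" "fourier_inverse z" "fourier z" _ _ _ X1 X2,
          OF triple_carrier fourier_inverse[OF z]])
      (auto simp: fourier_qrel[OF z] aff7_simps)
qed

section \<open>Isomorphisms\<close>

text \<open>By \<open>fwd\<close> the substitution descends to the quotients; \<open>bwd\<close>,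
  applied to the inverse substitution, gives injectivity, and the inverse also supplies
  preimages.\<close>

lemma skew_algebra_isomorphicI:
  assumes QP: "\<And>i x. (\<Sum>j\<in>UNIV. Q i j * P j x) = (if x = i then 1 else 0)"
    and PQ: "\<And>i x. (\<Sum>j\<in>UNIV. P i j * Q j x) = (if x = i then 1 else 0)"
    and fwd: "\<And>m. qrel p q r m \<Longrightarrow> qrel p' q' r' (congr P m)"
    and bwd: "\<And>m. qrel p' q' r' m \<Longrightarrow> qrel p q r (congr Q m)"
  shows "skew_poly_ring p q r \<cong>\<^sub>a\<^sub>l\<^sub>g skew_poly_ring p' q' r'"
proof -
  have maps: "skew_ideal a b c \<subseteq> {f. substitute S f \<in> skew_ideal a' b' c'}"
    if "\<And>m. qrel a b c m \<Longrightarrow> qrel a' b' c' (congr S m)" for a b c a' b' c' S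
    by (rule skew_ideal_minimal)
      (auto simp: skew_ideal_zero skew_ideal_add skew_ideal_mult substitute_add substitute_mult substitute_quad quad_in_skew_ideal_iff that)
  have P: "substitute P f \<in> skew_ideal p' q' r'" if "f \<in> skew_ideal p q r" for f
    using maps[OF fwd] that by blast
  have Q: "f \<in> skew_ideal p q r" if "substitute P f \<in> skew_ideal p' q' r'" for f
  proof -
    have "substitute Q (substitute P f) \<in> skew_ideal p q r" using maps[OF bwd] that by blast
    then show ?thesis by (simp add: substitute_inverse[OF PQ])
  qed
  define h where "h x = proj p' q' r' (substitute P (SOME f. proj p q r f = x))" for x
  have h: "h (proj p q r f) = proj p' q' r' (substitute P f)" for f
  proof -
    have "proj p q r (SOME g. proj p q r g = proj p q r f) = proj p q r f" by (rule someI) simp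
    then show ?thesis using P by (simp add: h_def proj_eq_iff flip: substitute_diff)
  qed
  have "bij_betw h (range (proj p q r)) (range (proj p' q' r'))"
  proof (rule bij_betwI')
    show "h x = h y \<longleftrightarrow> x = y" if xy: "x \<in> range (proj p q r)" "y \<in> range (proj p q r)" for x y
    proof -
      obtain f g where "x = proj p q r f" "y = proj p q r g" using xy by blast
      then show ?thesis using P[of "f - g"] Q[of "f - g"] by (auto simp: h proj_eq_iff substitute_diff)
    qed
    show "h x \<in> range (proj p' q' r')" for x by (simp add: h_def)
    show "\<exists>x\<in>range (proj p q r). y = h x" if y: "y \<in> range (proj p' q' r')" for y
    proof -
      obtain g where "y = proj p' q' r' g" using y by blast
      then have "y = h (proj p q r (substitute Q g))" by (simp add: h substitute_inverse[OF QP])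
      then show ?thesis by blast
    qed
  qed
  moreover have "h \<in> ring_hom (skew_poly_ring p q r) (skew_poly_ring p' q' r')"
    using substitute_const[of P 1]
    by (intro ring_hom_memI) (auto simp: skew_poly_ring_simps h substitute_mult substitute_add const_simps)
  ultimately have "h \<in> ring_iso (skew_poly_ring p q r) (skew_poly_ring p' q' r')"
    by (simp add: ring_iso_def skew_poly_ring_simps)
  moreover have "h (c \<odot>\<^bsub>skew_poly_ring p q r\<^esub> a) = c \<odot>\<^bsub>skew_poly_ring p' q' r'\<^esub> h a"
    if "a \<in> carrier (skew_poly_ring p q r)" for c a
    using that by (auto simp: skew_poly_ring_simps h substitute_mult substitute_const)
  ultimately show ?thesis unfolding algebra_isomorphic_def by blast
qed

lemma skew_permutation_isomorphic:
  assumes s: "\<And>x. s' (s x) = x" "\<And>x. s (s' x) = x"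
    and rel: "\<And>m. qrel p q r m \<longleftrightarrow> qrel p' q' r' (\<lambda>x y. m (s' x) (s' y))"
  shows "skew_poly_ring p q r \<cong>\<^sub>a\<^sub>l\<^sub>g skew_poly_ring p' q' r'"
proof -
  define P where "P t i x = (if x = t i then 1 else 0 :: 'a)" for t :: "gen \<Rightarrow> gen" and i x
  have PP: "(\<Sum>j\<in>UNIV. P u i j * P t j x) = (if x = i then 1 else 0)" if "\<And>x. t (u x) = x" for t u i x
  proof -
    have "(\<Sum>j\<in>UNIV. P u i j * P t j x) = (\<Sum>j\<in>UNIV. if j = u i then P t (u i) x else 0)"
      by (rule sum.cong) (auto simp: P_def)
    then show ?thesis by (simp add: P_def that)
  qed
  have cong: "congr (P t) m = (\<lambda>x y. m (u x) (u y))" if tu: "\<And>x. t (u x) = x" "\<And>x. u (t x) = x" for t u m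
  proof (intro ext)
    fix x y
    have *: "x = t i \<longleftrightarrow> i = u x" for x i using tu by auto
    have "m i j * P t i x * P t j y = (if j = u y then if i = u x then m (u x) (u y) else 0 else 0)" for i j
      by (simp add: P_def *)
    then show "congr (P t) m x y = m (u x) (u y)" by (simp add: congr_def)
  qed
  show ?thesis
  proof (rule skew_algebra_isomorphicI[of "P s'" "P s"])
    show "(\<Sum>j\<in>UNIV. P s' i j * P s j x) = (if x = i then 1 else 0)" for i x
      by (rule PP) (rule s)
    show "(\<Sum>j\<in>UNIV. P s i j * P s' j x) = (if x = i then 1 else 0)" for i x
      by (rule PP) (rule s)
    have "congr (P s) m = (\<lambda>x y. m (s' x) (s' y))" for m by (rule cong) (rule s)+
    then show "qrel p' q' r' (congr (P s) m)" if "qrel p q r m" for m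
      using that rel by simp
    have "congr (P s') m = (\<lambda>x y. m (s x) (s y))" for m by (rule cong) (rule s)+
    then show "qrel p q r (congr (P s') m)" if "qrel p' q' r' m" for m
      using that by (simp add: rel s)
  qed
qed

text \<open>Exchanging \<open>X2\<close> and \<open>X3\<close> brings \<open>q\<close> to the first
  place, and a cyclic permutation brings \<open>r\<close> there. A parameter equal to 1 or -1 can
  thus be assumed to come first, where the listed rings have it; the cubic family is already in
  listed form.\<close>

lemma params_isomorphic:
  fixes p q r :: "'k::field_char_0"
  assumes nz: "p \<noteq> 0" "q \<noteq> 0" "r \<noteq> 0" and "params p q r"
  shows "(\<exists>t. t \<noteq> 0 \<and>
      (skew_poly_ring p q r \<cong>\<^sub>a\<^sub>l\<^sub>g skew_poly_ring (-1) t (-t) \<or>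
       skew_poly_ring p q r \<cong>\<^sub>a\<^sub>l\<^sub>g skew_poly_ring (-1) t t \<or>
       skew_poly_ring p q r \<cong>\<^sub>a\<^sub>l\<^sub>g skew_poly_ring 1 t (-t))) \<or>
    (\<exists>\<zeta>. primitive_root 3 \<zeta> \<and> skew_poly_ring p q r \<cong>\<^sub>a\<^sub>l\<^sub>g skew_poly_ring \<zeta> (\<zeta>^2) \<zeta>)"
proof -
  let ?A = "skew_poly_ring p q r"
  have refl: "?A \<cong>\<^sub>a\<^sub>l\<^sub>g ?A"
    by (rule skew_permutation_isomorphic[of id id]) simp_all
  have sw23: "?A \<cong>\<^sub>a\<^sub>l\<^sub>g skew_poly_ring q p (1/r)"
  proof -
    have sw: "sw23 (sw23 x) = x" for x by (cases x) simp_all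
    show ?thesis
    proof (rule skew_permutation_isomorphic[of sw23 sw23, OF sw sw])
      show "qrel p q r m \<longleftrightarrow> qrel q p (1/r) (\<lambda>x y. m (sw23 x) (sw23 y))" for m
        using nz by (auto simp: qrel_def)
    qed
  qed
  have rot: "?A \<cong>\<^sub>a\<^sub>l\<^sub>g skew_poly_ring r (1/p) (1/q)"
  proof (rule skew_permutation_isomorphic[of "sw12 \<circ> sw23" "sw23 \<circ> sw12"])
    show "(sw12 \<circ> sw23) ((sw23 \<circ> sw12) x) = x" "(sw23 \<circ> sw12) ((sw12 \<circ> sw23) x) = x" for x
      by (cases x; simp)+
    show "qrel p q r m \<longleftrightarrow> qrel r (1/p) (1/q) (\<lambda>x y. m ((sw12 \<circ> sw23) x) ((sw12 \<circ> sw23) y))" for m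
      using nz by (auto simp: qrel_def)
  qed
  from assms(4) consider
    "p = -1" "q^2 = r^2" | "p = 1" "r = -q" | "q = -1" "(p * r)^2 = 1" | "q = 1" "p * r = -1" |
    "r = -1" "p^2 = q^2" | "r = 1" "p = -q" | "p^2 + p + 1 = 0" "q = p^2" "r = p"
    unfolding params_def by blast
  then show ?thesis
  proof cases
    case 1
    then have "r = q \<or> r = -q" by (auto simp: power2_eq_iff)
    then show ?thesis using refl 1(1) nz by blast
  next
    case 2
    then show ?thesis using refl nz by blast
  next
    case 3
    then have "p * r = 1 \<or> p * r = -1" by (simp add: power2_eq_1_iff)
    then have "1/r = p \<or> 1/r = -p" using nz by (auto simp: divide_eq_eq minus_equation_iff)
    then show ?thesis using sw23 3(1) nz by metis
  next
    case 4
    then have "1/r = -p" using nz by (simp add: divide_eq_eq)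
    then show ?thesis using sw23 4(1) nz by metis
  next
    case 5
    then have "1/q = 1/p \<or> 1/q = -(1/p)" by (auto simp: power2_eq_iff)
    moreover have "1/p \<noteq> 0" using nz by simp
    ultimately show ?thesis using rot 5(1) by metis
  next
    case 6
    then have "1/q = -(1/p)" by simp
    moreover have "1/p \<noteq> 0" using nz by simp
    ultimately show ?thesis using rot 6(1) by metis
  next
    case 7
    then show ?thesis using refl primitive_third_root[of p] by blast
  qed
qed

text \<open>Existence is witnessed by groups on \<open>nat\<close>, whereas the classification
  leaves the type \<open>'g\<close> of group elements arbitrary and so covers every grading
  group.\<close>

theorem corollary3p13:
  shows
    "(\<forall>q::'k::{alg_closed_field, field_char_0}. q \<noteq> 0 \<longrightarrow>
        has_nonabelian_grading TYPE(nat) (-1) q (-q) \<and>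
        has_nonabelian_grading TYPE(nat) (-1) q q \<and>
        has_nonabelian_grading TYPE(nat) 1 q (-q)) \<and>
     (\<forall>\<zeta>::'k. primitive_root 3 \<zeta> \<longrightarrow> has_nonabelian_grading TYPE(nat) \<zeta> (\<zeta>^2) \<zeta>) \<and>
     (\<forall>p' q' r' :: 'k.
        p' \<noteq> 0 \<longrightarrow> q' \<noteq> 0 \<longrightarrow> r' \<noteq> 0 \<longrightarrow>
        has_nonabelian_grading TYPE('g) p' q' r' \<longrightarrow>
        (\<exists>q. q \<noteq> 0 \<and>
           (skew_poly_ring p' q' r' \<cong>\<^sub>a\<^sub>l\<^sub>g skew_poly_ring (-1) q (-q) \<or>
            skew_poly_ring p' q' r' \<cong>\<^sub>a\<^sub>l\<^sub>g skew_poly_ring (-1) q q \<or>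
            skew_poly_ring p' q' r' \<cong>\<^sub>a\<^sub>l\<^sub>g skew_poly_ring 1 q (-q))) \<or>
        (\<exists>\<zeta>. primitive_root 3 \<zeta> \<and>
           skew_poly_ring p' q' r' \<cong>\<^sub>a\<^sub>l\<^sub>g skew_poly_ring \<zeta> (\<zeta>^2) \<zeta>))"
  by (intro conjI allI impI;
      (rule grading_minus_one_minus grading_minus_one_plus grading_one_minus
       | rule grading_zeta, assumption
       | rule params_isomorphic[OF _ _ _ nonabelian_grading_params]; assumption))

end
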